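(* Unless $\mathrm{P}=\mathrm{NP}$, the Single Source Maximum Reachability Trip Temporalisation problem (ss-mrtt) cannot be approximated within a factor less than $\frac{\sqrt{n}}{12}$ ($n$ the number of nodes), even if the input trip network is strongly temporalisable.
   Context: A weighted multidigraph $D=(V,E)$ has a finite node set $V$ and a finite multiset $E$ of edges $(u,v,w)$ with weight $w>0$. A trip network is a pair $(D,\mathbb{T})$ where $\mathbb{T}$ is a finite multiset of walks in $D$ (trips); every node and edge of $D$ appears in some trip. A temporalisation $\tau$ assigns a real starting time $\tau(T)$ to each trip. For a trip $T=e_1,\dots,e_k$ with $e_i=(u_i,v_i,w_i)$, it induces temporal edges $(u_i,v_i,\tau(T)+\sum_{j<i}w_j,w_i)$ (tail, head, starting time, travel time). The induced temporal graph $G[D,\mathbb{T},\tau]$ has node set $V$ and all temporal edges induced by all trips. A temporal path from $u$ to $v$ is a sequence of consecutive temporal edges from $u$ to $v$ in which each edge's starting time is at least the arrival time (starting time plus travel time) of the previous one; $v$ is $\tau$-reachable from $u$ if such a path exists (every node reaches itself). ss-mrtt: given a trip network and a node $s$, find a temporalisation $\tau$ maximising the number of nodes $\tau$-reachable from $s$. Approximation within factor $\rho$ means a polynomial-time algorithm always returning a solution of value at least $1/\rho$ times the optimum. A trip network is strongly temporalisable if for every two nodes $s,t$ there exists a temporalisation $\tau$ such that $t$ is $\tau$-reachable from $s$. *)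

theory Defs
  imports Complex_Main "HOL-Library.Multiset" "HOL-Computational_Algebra.Polynomial"
begin

section \<open>Trip networks and temporalisations\<close>

type_synonym 'v edge = "'v \<times> 'v \<times> real"
type_synonym 'v temporal_edge = "'v \<times> 'v \<times> real \<times> real"

text \<open>The multiset of trips is given by an enumeration, so that a temporalisation can give
  different starting times to different copies of the same walk.\<close>

record 'v trip_network =
  nodes :: "'v set"
  edges :: "'v edge multiset"
  trips :: "'v edge list list"

definition weight :: "'v edge \<Rightarrow> real" where
  "weight e = (case e of (u, v, w) \<Rightarrow> w)"

definition walk_in :: "'v edge multiset \<Rightarrow> 'v edge list \<Rightarrow> bool" where
  "walk_in E T \<longleftrightarrow> T \<noteq> [] \<and> set T \<subseteq> set_mset E
     \<and> successively (\<lambda>(u, v, w) (u', v', w'). v = u') T"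

definition is_trip_network :: "'v trip_network \<Rightarrow> bool" where
  "is_trip_network N \<longleftrightarrow>
     finite (nodes N)
   \<and> (\<forall>(u, v, w) \<in># edges N. u \<in> nodes N \<and> v \<in> nodes N \<and> w > 0)
   \<and> (\<forall>T \<in> set (trips N). walk_in (edges N) T)
   \<and> (\<forall>x \<in> nodes N. \<exists>T \<in> set (trips N). \<exists>(u, v, w) \<in> set T. x = u \<or> x = v)
   \<and> (\<forall>e \<in># edges N. \<exists>T \<in> set (trips N). e \<in> set T)"

text \<open>The starting time of the \<open>i\<close>-th trip is the value at \<open>i\<close>; values at indices
  beyond the number of trips are irrelevant.\<close>

type_synonym temporalisation = "nat \<Rightarrow> real"

definition induced_by_trip :: "'v edge list \<Rightarrow> real \<Rightarrow> 'v temporal_edge set" where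
  "induced_by_trip T t =
     {(u, v, t + (\<Sum>j<i. weight (T ! j)), w) | u v w i. i < length T \<and> T ! i = (u, v, w)}"

definition induced_edges :: "'v trip_network \<Rightarrow> temporalisation \<Rightarrow> 'v temporal_edge set" where
  "induced_edges N \<tau> = (\<Union>i<length (trips N). induced_by_trip (trips N ! i) (\<tau> i))"

definition temporal_path ::
  "'v temporal_edge set \<Rightarrow> 'v \<Rightarrow> 'v temporal_edge list \<Rightarrow> 'v \<Rightarrow> bool" where
  "temporal_path A u es v \<longleftrightarrow>
     es \<noteq> [] \<and> set es \<subseteq> A \<and> fst (hd es) = u \<and> fst (snd (last es)) = v
   \<and> successively (\<lambda>(u, v, t, w) (u', v', t', w'). v = u' \<and> t + w \<le> t') es"

definition reachable :: "'v trip_network \<Rightarrow> temporalisation \<Rightarrow> 'v \<Rightarrow> 'v \<Rightarrow> bool" where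
  "reachable N \<tau> u v \<longleftrightarrow> u = v \<or> (\<exists>es. temporal_path (induced_edges N \<tau>) u es v)"

definition strongly_temporalisable :: "'v trip_network \<Rightarrow> bool" where
  "strongly_temporalisable N \<longleftrightarrow>
     (\<forall>s \<in> nodes N. \<forall>t \<in> nodes N. \<exists>\<tau>. reachable N \<tau> s t)"

definition ss_reach :: "'v trip_network \<Rightarrow> 'v \<Rightarrow> temporalisation \<Rightarrow> nat" where
  "ss_reach N s \<tau> = card {v \<in> nodes N. reachable N \<tau> s v}"

definition ss_opt :: "'v trip_network \<Rightarrow> 'v \<Rightarrow> nat" where
  "ss_opt N s = Max (range (ss_reach N s))"


section \<open>Deterministic multi-tape Turing machines\<close>

text \<open>States are \<open>0, \<dots>, num_states - 1\<close>, with initial state \<open>0\<close>, together with the halting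
  state \<open>num_states\<close>.  Tape symbols are \<open>0, \<dots>, num_symbols - 1\<close>, where \<open>0\<close> is the blank and
  \<open>1\<close>, \<open>2\<close> stand for the bits \<open>False\<close>, \<open>True\<close>.  Tapes are infinite in both directions.
  Tape 0 carries the input and tape 1 the output.\<close>

record tm =
  num_tapes :: nat
  num_symbols :: nat
  num_states :: nat
  trans :: "nat \<Rightarrow> nat list \<Rightarrow> nat \<times> (nat \<times> int) list"

definition wf_tm :: "tm \<Rightarrow> bool" where
  "wf_tm M \<longleftrightarrow> num_tapes M \<ge> 2 \<and> num_symbols M \<ge> 3
   \<and> (\<forall>q < num_states M. \<forall>as. length as = num_tapes M \<and> set as \<subseteq> {..<num_symbols M} \<longrightarrow>
        fst (trans M q as) \<le> num_states M
      \<and> length (snd (trans M q as)) = num_tapes M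
      \<and> set (snd (trans M q as)) \<subseteq> {..<num_symbols M} \<times> {-1, 0, 1})"

text \<open>A tape consists of the head position and the contents.\<close>

type_synonym tape = "int \<times> (int \<Rightarrow> nat)"
type_synonym config = "nat \<times> tape list"

fun act :: "nat \<times> int \<Rightarrow> tape \<Rightarrow> tape" where
  "act (a, d) (h, c) = (h + d, c(h := a))"

definition tm_step :: "tm \<Rightarrow> config \<Rightarrow> config" where
  "tm_step M cfg = (case cfg of (q, tps) \<Rightarrow>
     if q \<ge> num_states M then cfg
     else let (q', acts) = trans M q (map (\<lambda>(h, c). c h) tps) in (q', map2 act acts tps))"

definition string_contents :: "bool list \<Rightarrow> int \<Rightarrow> nat" where
  "string_contents x i =
     (if 0 \<le> i \<and> i < int (length x) then (if x ! nat i then 2 else 1) else 0)"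

definition tm_init :: "tm \<Rightarrow> bool list \<Rightarrow> config" where
  "tm_init M x = (0, (0, string_contents x) # replicate (num_tapes M - 1) (0, \<lambda>_. 0))"

definition outputs_within :: "tm \<Rightarrow> bool list \<Rightarrow> nat \<Rightarrow> bool list \<Rightarrow> bool" where
  "outputs_within M x t y \<longleftrightarrow>
     (let (q, tps) = (tm_step M ^^ t) (tm_init M x)
      in q = num_states M \<and> snd (tps ! 1) = string_contents y)"


section \<open>Encodings\<close>

text \<open>Self-delimiting: each bit is preceded by \<open>True\<close>, and the end is marked by \<open>False\<close>.\<close>

definition enc_bits :: "bool list \<Rightarrow> bool list" where
  "enc_bits x = concat (map (\<lambda>b. [True, b]) x) @ [False]"

definition enc_pair :: "bool list \<Rightarrow> bool list \<Rightarrow> bool list" where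
  "enc_pair x y = enc_bits x @ y"

text \<open>Binary representation, least significant bit first.\<close>

fun bits_of_nat :: "nat \<Rightarrow> bool list" where
  "bits_of_nat n = (if n = 0 then [] else odd n # bits_of_nat (n div 2))"

declare bits_of_nat.simps [simp del]

definition enc_nat :: "nat \<Rightarrow> bool list" where
  "enc_nat n = enc_bits (bits_of_nat n)"

definition enc_int :: "int \<Rightarrow> bool list" where
  "enc_int i = (i < 0) # enc_nat (nat \<bar>i\<bar>)"

definition enc_rat :: "rat \<Rightarrow> bool list" where
  "enc_rat r = (case quotient_of r of (a, b) \<Rightarrow> enc_int a @ enc_int b)"

definition enc_list :: "('a \<Rightarrow> bool list) \<Rightarrow> 'a list \<Rightarrow> bool list" where
  "enc_list f xs = concat (map (\<lambda>x. True # f x) xs) @ [False]"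

definition enc_edge :: "nat \<times> nat \<times> rat \<Rightarrow> bool list" where
  "enc_edge e = (case e of (u, v, w) \<Rightarrow> enc_nat u @ enc_nat v @ enc_rat w)"

definition enc_instance ::
  "nat list \<Rightarrow> (nat \<times> nat \<times> rat) list \<Rightarrow> (nat \<times> nat \<times> rat) list list \<Rightarrow> nat \<Rightarrow> bool list" where
  "enc_instance vs es ts s =
     enc_list enc_nat vs @ enc_list enc_edge es @ enc_list (enc_list enc_edge) ts @ enc_nat s"


section \<open>Complexity classes and approximability\<close>

definition class_P :: "bool list set set" where
  "class_P = {L. \<exists>M (p :: nat poly). wf_tm M
     \<and> (\<forall>x. outputs_within M x (poly p (length x)) [x \<in> L])}"

definition class_NP :: "bool list set set" where
  "class_NP = {L. \<exists>R \<in> class_P. \<exists>p :: nat poly.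
     \<forall>x. x \<in> L \<longleftrightarrow> (\<exists>y. length y \<le> poly p (length x) \<and> enc_pair x y \<in> R)}"

definition real_edge :: "nat \<times> nat \<times> rat \<Rightarrow> nat edge" where
  "real_edge e = (case e of (u, v, w) \<Rightarrow> (u, v, of_rat w))"

definition network_of ::
  "nat list \<Rightarrow> (nat \<times> nat \<times> rat) list \<Rightarrow> (nat \<times> nat \<times> rat) list list \<Rightarrow> nat trip_network" where
  "network_of vs es ts =
     \<lparr>nodes = set vs, edges = mset (map real_edge es), trips = map (map real_edge) ts\<rparr>"

text \<open>Algorithms receive instances with rational weights and return rational starting times, while
  the optimum is taken over all real temporalisations.  The factor \<open>\<rho>\<close> is a function of the number
  of nodes.  Nothing is required of the algorithm on networks outside the class \<open>C\<close>.\<close>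

definition ss_mrtt_approximable :: "(nat trip_network \<Rightarrow> bool) \<Rightarrow> (nat \<Rightarrow> real) \<Rightarrow> bool" where
  "ss_mrtt_approximable C \<rho> \<longleftrightarrow>
     (\<exists>M (p :: nat poly). wf_tm M \<and>
        (\<forall>vs es ts s.
           let N = network_of vs es ts; x = enc_instance vs es ts s in
           distinct vs \<and> is_trip_network N \<and> s \<in> nodes N \<and> C N \<longrightarrow>
           (\<exists>sol :: rat list. length sol = length ts
              \<and> outputs_within M x (poly p (length x)) (enc_list enc_rat sol)
              \<and> real (ss_reach N s (\<lambda>i. of_rat (sol ! i)))
                  \<ge> 1 / \<rho> (card (nodes N)) * real (ss_opt N s))))"

end

theory Submission
  imports Defs
begin

text \<open>Suppose that ss-mrtt can be approximated within the given factor; we decide a language in NP in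
  polynomial time.  Given an input, the run of its verifier on an unknown certificate is described
  by a formula in conjunctive normal form, and the formula by a trip network.  The solution returned
  for this network is turned into a candidate certificate by comparing pairs of starting times, and
  the verifier is run on that candidate.

  In the network, the trip of a literal \<open>l\<close> in a clause \<open>C\<close> first crosses \<open>C\<close> and later a chain
  belonging to the variable of \<open>l\<close>.  A temporal path from the source has to traverse, for each
  variable, the chain of all occurrences of one of its two literals, and afterwards all clauses.  A
  trip that was used on a chain has already left its clause, so the clauses are crossed by literals
  that are true in the assignment that makes the literals of the traversed chains false.

  The end of this path opens gates to \<open>m\<close> blocks of \<open>m + 1\<close> nodes each.  To make the network strongly
  temporalisable there is a second path to the gates, but it uses up all gates except one, because it
  is built from the later parts of the gate trips.  So without a satisfying assignment at most one
  block is reached besides the gadget, whose size is linear in \<open>m\<close>, against \<open>m (m + 1)\<close> nodes with one.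

  Polynomial time is handled through a class of functions on binary trees, closed under composition,
  pairing, case distinction and iterations of polynomially bounded growth.  Such functions are
  computed by structured programs on five stacks of bits, which Turing machines simulate, and
  conversely a run of a Turing machine is an iteration of this kind.\<close>

subsection \<open>Stack programs\<close>

text \<open>The constant 12 combines three estimates. The gadget is counted against
  \<open>m\<close>, so without a satisfying assignment at most \<open>4 * m + 4\<close> nodes are
  reached, and with one at least \<open>m * (m + 1)\<close>: a gap of \<open>m / 4\<close>. All
  nodes together number at most \<open>(m + 2) * (m + 2)\<close>, so a factor below
  \<open>sqrt n / 12\<close> is below \<open>(m + 2) / 12\<close>, which is at most
  \<open>m / 4\<close> once \<open>m\<close> is positive. A good solution does not exhibit the
  temporal path behind its value. Wrong positive answers are excluded without any look at the
  network, because the candidate has to pass the verifier. The function class has unary numbers,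
  which keeps size bounds simple, while starting times and node numbers can be exponentially large;
  these are therefore handled only as bit strings. Polynomial time then always comes down to one
  point: no intermediate value may outgrow a polynomial.\<close>

datatype sop = Keep | Drop | Put bool

fun apply_sop :: "sop \<Rightarrow> bool list \<Rightarrow> bool list" where
  "apply_sop Keep l = l"
| "apply_sop Drop l = tl l"
| "apply_sop (Put b) l = b # l"

definition bsym :: "bool \<Rightarrow> nat" where
  "bsym b = (if b then 2 else 1)"

definition sym_at :: "bool list \<Rightarrow> nat \<Rightarrow> nat" where
  "sym_at l i = (if i < length l then bsym (l ! i) else 0)"

type_synonym instr = "nat \<times> (nat \<Rightarrow> nat \<times> sop)"
type_synonym store = "nat \<Rightarrow> bool list"

text \<open>Beyond the program the machine loops in place, so the final address is a fixed point of
  \<open>gstep\<close> and a finished run can be prolonged to any later time.\<close>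

definition instr_at :: "instr list \<Rightarrow> nat \<Rightarrow> instr" where
  "instr_at P q = (if q < length P then P ! q else (0, \<lambda>_. (q, Keep)))"

definition gstep :: "instr list \<Rightarrow> nat \<times> store \<Rightarrow> nat \<times> store" where
  "gstep P cfg = (case cfg of (q, s) \<Rightarrow> case instr_at P q of (r, f) \<Rightarrow>
     case f (sym_at (s r) 0) of (q', a) \<Rightarrow> (q', s(r := apply_sop a (s r))))"

datatype com =
    SKIP
  | PUSH nat bool
  | POP nat
  | SEQ com com  (infixr ";;" 60)
  | IF nat "nat set" com com
  | WHILE nat "nat set" com

text \<open>Jump targets are absolute, with \<open>o1\<close> the address where the code will be
  placed. Control leaves a piece of code only at the address right behind it.\<close>

fun compile :: "com \<Rightarrow> nat \<Rightarrow> instr list" where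
  "compile SKIP o1 = []"
| "compile (PUSH r b) o1 = [(r, \<lambda>_. (o1 + 1, Put b))]"
| "compile (POP r) o1 = [(r, \<lambda>_. (o1 + 1, Drop))]"
| "compile (c1 ;; c2) o1 = (let p1 = compile c1 o1 in p1 @ compile c2 (o1 + length p1))"
| "compile (IF r A c1 c2) o1 =
     (let p1 = compile c1 (o1 + 1); p2 = compile c2 (o1 + 2 + length p1) in
      [(r, \<lambda>a. (if a \<in> A then o1 + 1 else o1 + 2 + length p1, Keep))] @ p1 @
      [(r, \<lambda>a. (o1 + 2 + length p1 + length p2, Keep))] @ p2)"
| "compile (WHILE r A c) o1 =
     (let p = compile c (o1 + 1) in
      [(r, \<lambda>a. (if a \<in> A then o1 + 1 else o1 + 2 + length p, Keep))] @ p @ [(r, \<lambda>_. (o1, Keep))])"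

text \<open>The counter is the exact number of \<open>gstep\<close> steps of the compiled code: in
  \<open>IF\<close> the first branch costs one step more than the second, for the jump over the
  second block.\<close>

inductive exec :: "com \<Rightarrow> store \<Rightarrow> nat \<Rightarrow> store \<Rightarrow> bool" where
  Skip: "exec SKIP s 0 s"
| Push: "exec (PUSH r b) s 1 (s(r := b # s r))"
| Pop: "exec (POP r) s 1 (s(r := tl (s r)))"
| Seq: "exec c1 s n s' \<Longrightarrow> exec c2 s' m s'' \<Longrightarrow> exec (c1 ;; c2) s (n + m) s''"
| IfT: "sym_at (s r) 0 \<in> A \<Longrightarrow> exec c1 s n s' \<Longrightarrow> exec (IF r A c1 c2) s (n + 2) s'"
| IfF: "sym_at (s r) 0 \<notin> A \<Longrightarrow> exec c2 s n s' \<Longrightarrow> exec (IF r A c1 c2) s (n + 1) s'"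
| WhileF: "sym_at (s r) 0 \<notin> A \<Longrightarrow> exec (WHILE r A c) s 1 s"
| WhileT: "sym_at (s r) 0 \<in> A \<Longrightarrow> exec c s n s' \<Longrightarrow> exec (WHILE r A c) s' m s''
    \<Longrightarrow> exec (WHILE r A c) s (n + m + 2) s''"

definition code_at :: "instr list \<Rightarrow> nat \<Rightarrow> instr list \<Rightarrow> bool" where
  "code_at P q L \<longleftrightarrow> (\<forall>i < length L. q + i < length P \<and> P ! (q + i) = L ! i)"

lemma code_at_append [simp]:
  "code_at P q (L1 @ L2) \<longleftrightarrow> code_at P q L1 \<and> code_at P (q + length L1) L2"
proof
  assume a: "code_at P q (L1 @ L2)"
  have "code_at P q L1"
    unfolding code_at_def
  proof (intro allI impI)
    fix i assume i: "i < length L1"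
    with a show "q + i < length P \<and> P ! (q + i) = L1 ! i"
      unfolding code_at_def by (metis length_append nth_append trans_less_add1)
  qed
  moreover have "code_at P (q + length L1) L2"
    unfolding code_at_def
  proof (intro allI impI)
    fix i assume i: "i < length L2"
    hence "length L1 + i < length (L1 @ L2)" by simp
    with a show "q + length L1 + i < length P \<and> P ! (q + length L1 + i) = L2 ! i"
      unfolding code_at_def by (metis add.assoc nth_append_length_plus)
  qed
  ultimately show "code_at P q L1 \<and> code_at P (q + length L1) L2" ..
next
  assume a: "code_at P q L1 \<and> code_at P (q + length L1) L2"
  show "code_at P q (L1 @ L2)"
    unfolding code_at_def
  proof (intro allI impI)
    fix i assume i: "i < length (L1 @ L2)"
    show "q + i < length P \<and> P ! (q + i) = (L1 @ L2) ! i"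
    proof (cases "i < length L1")
      case True
      with a show ?thesis by (simp add: code_at_def nth_append)
    next
      case False
      then obtain j where j: "i = length L1 + j" using le_Suc_ex not_less by blast
      with a i show ?thesis by (auto simp add: code_at_def nth_append add.assoc)
    qed
  qed
qed

lemma code_at_Cons [simp]:
  "code_at P q (x # L) \<longleftrightarrow> q < length P \<and> P ! q = x \<and> code_at P (Suc q) L"
  using code_at_append[of P q "[x]" L] by (simp add: code_at_def)

lemma code_at_Nil [simp]: "code_at P q []"
  by (simp add: code_at_def)

lemma funpow_trans:
  "(f ^^ n) a = b \<Longrightarrow> (f ^^ m) b = c \<Longrightarrow> (f ^^ (n + m)) a = c"
  by (metis add.commute comp_apply funpow_add)

text \<open>As the counter of \<open>exec\<close> matches the compiled code step by step, the same
  \<open>n\<close> serves on both sides. Allowing the code to lie anywhere inside \<open>P\<close>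
  is what the induction needs for subcommands.\<close>

lemma compile_correct:
  "exec c s n s' \<Longrightarrow> code_at P q (compile c q) \<Longrightarrow>
    (gstep P ^^ n) (q, s) = (q + length (compile c q), s')"
proof (induction c s n s' arbitrary: q rule: exec.induct)
  case (Seq c1 s n s' c2 m s'')
  have "(gstep P ^^ n) (q, s) = (q + length (compile c1 q), s')"
    using Seq by (simp add: Let_def)
  moreover have "(gstep P ^^ m) (q + length (compile c1 q), s') =
    (q + length (compile c1 q) + length (compile c2 (q + length (compile c1 q))), s'')"
    using Seq by (simp add: Let_def)
  ultimately show ?case by (simp add: Let_def funpow_trans add.assoc)
next
  case (IfT s r A c1 n s' c2)
  let ?l = "length (compile c1 (q + 1))"
  have 1: "(gstep P ^^ 1) (q, s) = (q + 1, s)"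
    using IfT by (simp add: Let_def gstep_def instr_at_def)
  have 2: "(gstep P ^^ n) (q + 1, s) = (q + 1 + ?l, s')"
    using IfT by (simp add: Let_def)
  have 3: "(gstep P ^^ 1) (q + 1 + ?l, s') = (q + length (compile (IF r A c1 c2) q), s')"
    using IfT.prems by (simp add: Let_def gstep_def instr_at_def)
  have "(gstep P ^^ (1 + n + 1)) (q, s) = (q + length (compile (IF r A c1 c2) q), s')"
    by (rule funpow_trans[OF funpow_trans[OF 1 2] 3])
  moreover have "1 + n + 1 = n + 2" by simp
  ultimately show ?case by metis
next
  case (IfF s r A c2 n s' c1)
  let ?l = "length (compile c1 (q + 1))"
  have 1: "(gstep P ^^ 1) (q, s) = (q + 2 + ?l, s)"
    using IfF by (simp add: Let_def gstep_def instr_at_def)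
  have 2: "(gstep P ^^ n) (q + 2 + ?l, s) = (q + length (compile (IF r A c1 c2) q), s')"
    using IfF by (simp add: Let_def)
  show ?case using funpow_trans[OF 1 2] by (metis add.commute)
next
  case (WhileT s r A c n s' m s'')
  let ?l = "length (compile c (q + 1))"
  have 1: "(gstep P ^^ 1) (q, s) = (q + 1, s)"
    using WhileT by (simp add: Let_def gstep_def instr_at_def)
  have 2: "(gstep P ^^ n) (q + 1, s) = (q + 1 + ?l, s')"
    using WhileT by (simp add: Let_def)
  have 3: "(gstep P ^^ 1) (q + 1 + ?l, s') = (q, s')"
    using WhileT.prems by (simp add: Let_def gstep_def instr_at_def)
  have 4: "(gstep P ^^ m) (q, s') = (q + length (compile (WHILE r A c) q), s'')"
    using WhileT by simp
  have "(gstep P ^^ (1 + n + 1 + m)) (q, s) = (q + length (compile (WHILE r A c) q), s'')"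
    by (rule funpow_trans[OF funpow_trans[OF funpow_trans[OF 1 2] 3] 4])
  moreover have "1 + n + 1 + m = n + m + 2" by simp
  ultimately show ?case by metis
qed (auto simp: Let_def gstep_def instr_at_def)

fun stacks :: "com \<Rightarrow> nat set" where
  "stacks SKIP = {}"
| "stacks (PUSH r b) = {r}"
| "stacks (POP r) = {r}"
| "stacks (c1 ;; c2) = stacks c1 \<union> stacks c2"
| "stacks (IF r A c1 c2) = insert r (stacks c1 \<union> stacks c2)"
| "stacks (WHILE r A c) = insert r (stacks c)"

definition wf_com :: "com \<Rightarrow> bool" where
  "wf_com c \<longleftrightarrow> stacks c \<subseteq> {..<5}"

lemma wf_com_simps [simp]:
  "wf_com SKIP" "wf_com (PUSH r b) \<longleftrightarrow> r < 5" "wf_com (POP r) \<longleftrightarrow> r < 5"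
  "wf_com (c1 ;; c2) \<longleftrightarrow> wf_com c1 \<and> wf_com c2"
  "wf_com (IF r A c1 c2) \<longleftrightarrow> r < 5 \<and> wf_com c1 \<and> wf_com c2"
  "wf_com (WHILE r A c) \<longleftrightarrow> r < 5 \<and> wf_com c"
  by (auto simp: wf_com_def)

definition wf_instr :: "nat \<Rightarrow> instr \<Rightarrow> bool" where
  "wf_instr n x \<longleftrightarrow> fst x < 5 \<and> (\<forall>a. fst (snd x a) \<le> n)"

definition wf_prog :: "instr list \<Rightarrow> bool" where
  "wf_prog P \<longleftrightarrow> (\<forall>x \<in> set P. wf_instr (length P) x)"

lemma wf_instr_mono: "wf_instr n x \<Longrightarrow> n \<le> n' \<Longrightarrow> wf_instr n' x"
  unfolding wf_instr_def using le_trans by blast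

lemma compile_wf_instr:
  "wf_com c \<Longrightarrow> x \<in> set (compile c q) \<Longrightarrow> wf_instr (q + length (compile c q)) x"
proof (induction c arbitrary: q)
  case (SEQ c1 c2)
  let ?p = "compile c1 q"
  from SEQ.prems(2) consider "x \<in> set ?p" | "x \<in> set (compile c2 (q + length ?p))"
    by (auto simp: Let_def)
  then show ?case
  proof cases
    case 1
    show ?thesis by (rule wf_instr_mono[OF SEQ.IH(1)[OF _ 1]]) (use SEQ.prems in \<open>auto simp: Let_def\<close>)
  next
    case 2
    show ?thesis by (rule wf_instr_mono[OF SEQ.IH(2)[OF _ 2]]) (use SEQ.prems in \<open>auto simp: Let_def\<close>)
  qed
next
  case (IF r A c1 c2)
  let ?p = "compile c1 (q + 1)"
  from IF.prems consider "x \<in> set ?p" | "x \<in> set (compile c2 (q + 2 + length ?p))"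
     | "wf_instr (q + length (compile (IF r A c1 c2) q)) x"
    by (auto simp: Let_def wf_instr_def)
  then show ?case
  proof cases
    case 1
    show ?thesis by (rule wf_instr_mono[OF IF.IH(1)[OF _ 1]]) (use IF.prems in \<open>auto simp: Let_def\<close>)
  next
    case 2
    show ?thesis by (rule wf_instr_mono[OF IF.IH(2)[OF _ 2]]) (use IF.prems in \<open>auto simp: Let_def\<close>)
  qed
next
  case (WHILE r A c)
  from WHILE.prems consider "x \<in> set (compile c (q + 1))"
     | "wf_instr (q + length (compile (WHILE r A c) q)) x"
    by (auto simp: Let_def wf_instr_def)
  then show ?case
  proof cases
    case 1
    show ?thesis by (rule wf_instr_mono[OF WHILE.IH[OF _ 1]]) (use WHILE.prems in \<open>auto simp: Let_def\<close>)
  qed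
qed (auto simp: wf_instr_def)

lemma wf_prog_compile: "wf_com c \<Longrightarrow> wf_prog (compile c 0)"
  using compile_wf_instr[of c _ 0] by (simp add: wf_prog_def)

lemma wf_prog_nth:
  assumes "wf_prog P" "q < length P" "P ! q = (r, f)"
  shows "r < 5" "fst (f a) \<le> length P"
  using assms nth_mem[OF assms(2)] by (auto simp: wf_prog_def wf_instr_def)

lemma gstep_halted: "length P \<le> q \<Longrightarrow> (gstep P ^^ n) (q, s) = (q, s)"
  by (induction n) (auto simp: gstep_def instr_at_def)

lemma compile_run:
  assumes "exec c s n s'" "n \<le> t"
  shows "(gstep (compile c 0) ^^ t) (0, s) = (length (compile c 0), s')"
proof -
  have "code_at (compile c 0) 0 (compile c 0)" by (simp add: code_at_def)
  from compile_correct[OF assms(1) this]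
  have "(gstep (compile c 0) ^^ n) (0, s) = (length (compile c 0), s')" by simp
  from funpow_trans[OF this gstep_halted[of _ _ "t - n"]] assms(2) show ?thesis by simp
qed

subsection \<open>Stack programs as Turing machines\<close>

definition tape_of :: "nat \<Rightarrow> nat" where
  "tape_of r = (if r = 0 then 0 else r + 1)"

definition write_at :: "nat list \<Rightarrow> nat \<Rightarrow> nat \<times> int \<Rightarrow> (nat \<times> int) list" where
  "write_at as i x = (map (\<lambda>c. (c, 0)) as)[i := x]"

text \<open>State \<open>q < length P\<close> reads and moves; the symbol \<open>a\<close> it has read is remembered in state
  \<open>length P + 1 + 3 * q + a\<close>, which completes a push.  State \<open>length P\<close> copies the top of stack 1
  (on tape 2) to the output tape 1, which no stack lives on.\<close>

definition tm_of :: "instr list \<Rightarrow> tm" where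
  "tm_of P = (let n = length P in
     \<lparr>num_tapes = 6, num_symbols = 3, num_states = 4 * n + 1,
      trans = (\<lambda>q as.
        if q < n then
          (case P ! q of (r, f) \<Rightarrow> let a = as ! tape_of r in
            (n + 1 + 3 * q + a, write_at as (tape_of r)
              (case snd (f a) of Keep \<Rightarrow> (a, 0) | Drop \<Rightarrow> (0, 1) | Put b \<Rightarrow> (a, -1))))
        else if q = n then (4 * n + 1, write_at as 1 (as ! 2, 0))
        else (let k = q - (n + 1); a = k mod 3 in
          case P ! (k div 3) of (r, f) \<Rightarrow>
            (fst (f a), write_at as (tape_of r)
              (case snd (f a) of Put b \<Rightarrow> (bsym b, 0) | _ \<Rightarrow> (as ! tape_of r, 0)))))\<rparr>)"

lemma wf_tm_tm_of: assumes "wf_prog P" shows "wf_tm (tm_of P)"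
proof -
  let ?n = "length P"
  have P: "fst (P ! q) < 5 \<and> fst (snd (P ! q) a) \<le> ?n" if "q < ?n" for q a
    using wf_prog_nth[OF assms that, of "fst (P ! q)" "snd (P ! q)"] by simp
  have W: "length (write_at as i x) = 6" "set (write_at as i x) \<subseteq> {..<3} \<times> {-1, 0, 1}"
    if "length as = 6" "set as \<subseteq> {..<3}" "x \<in> {..<3} \<times> {-1, 0, 1}" for as i x
  proof -
    show "length (write_at as i x) = 6" using that by (simp add: write_at_def)
    have "set (write_at as i x) \<subseteq> insert x (set (map (\<lambda>c. (c, 0)) as))"
      unfolding write_at_def by (rule set_update_subset_insert)
    also have "\<dots> \<subseteq> {..<3} \<times> {-1, 0, 1}" using that by auto
    finally show "set (write_at as i x) \<subseteq> {..<3} \<times> {-1, 0, 1}" .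
  qed
  have S: "as ! i < 3" if "length as = 6" "set as \<subseteq> {..<3}" "i < 6" for as :: "nat list" and i
    using that nth_mem[of i as] by (metis lessThan_iff subsetD)
  have T: "tape_of r < 6" if "r < 5" for r using that by (simp add: tape_of_def)
  have main: "fst (trans (tm_of P) q as) \<le> 4 * ?n + 1
      \<and> length (snd (trans (tm_of P) q as)) = 6
      \<and> set (snd (trans (tm_of P) q as)) \<subseteq> {..<3} \<times> {-1, 0, 1}"
    if q: "q < 4 * ?n + 1" and as: "length as = 6" "set as \<subseteq> {..<3}" for q as
  proof -
    consider "q < ?n" | "q = ?n" | "q > ?n" by linarith
    then show ?thesis
    proof cases
      case 1
      obtain r f where rf: "P ! q = (r, f)" by fastforce
      with P[OF 1] have r: "r < 5" by simp
      have a: "as ! tape_of r < 3" using S[OF as T[OF r]] .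
      have x: "(case snd (f (as ! tape_of r)) of Keep \<Rightarrow> (as ! tape_of r, 0) | Drop \<Rightarrow> (0, 1)
          | Put b \<Rightarrow> (as ! tape_of r, -1)) \<in> {..<3} \<times> {-1, 0, 1::int}"
        using a by (auto split: sop.split)
      have "?n + 1 + 3 * q + as ! tape_of r \<le> 4 * ?n + 1" using a 1 by simp
      with 1 rf W[OF as x] show ?thesis by (simp add: tm_of_def Let_def)
    next
      case 2
      have x: "(as ! 2, 0) \<in> {..<3} \<times> {-1, 0, 1::int}" using S[OF as, of 2] by simp
      with 2 W[OF as x] show ?thesis by (simp add: tm_of_def Let_def)
    next
      case 3
      define k where "k = q - (?n + 1)"
      have "k div 3 < ?n" using q 3 by (simp add: k_def)
      obtain r f where rf: "P ! (k div 3) = (r, f)" by fastforce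
      with P[OF \<open>k div 3 < ?n\<close>] have r: "r < 5" "fst (f (k mod 3)) \<le> ?n" by auto
      have a: "as ! tape_of r < 3" using S[OF as T[OF r(1)]] .
      have x: "(case snd (f (k mod 3)) of Put b \<Rightarrow> (bsym b, 0) | _ \<Rightarrow> (as ! tape_of r, 0))
         \<in> {..<3} \<times> {-1, 0, 1::int}"
        using a by (auto split: sop.split simp: bsym_def)
      have "trans (tm_of P) q as = (fst (f (k mod 3)), write_at as (tape_of r)
          (case snd (f (k mod 3)) of Put b \<Rightarrow> (bsym b, 0) | _ \<Rightarrow> (as ! tape_of r, 0)))"
        using 3 rf by (simp add: tm_of_def Let_def k_def)
      with r(2) W[OF as x] show ?thesis by simp
    qed
  qed
  show ?thesis unfolding wf_tm_def using main by (simp add: tm_of_def Let_def)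
qed

text \<open>The top of the stack is under the head and the stack extends to the right. A push has to
  read the top, move left and write there, which is why an instruction takes two machine
  steps.\<close>

definition tape_holds :: "tape \<Rightarrow> bool list \<Rightarrow> bool" where
  "tape_holds tp l \<longleftrightarrow> (case tp of (h, c) \<Rightarrow>
     (\<forall>i. c i = (if h \<le> i then sym_at l (nat (i - h)) else 0)))"

definition holds :: "tape list \<Rightarrow> store \<Rightarrow> bool" where
  "holds tps s \<longleftrightarrow> length tps = 6 \<and> tps ! 1 = (0, \<lambda>_. 0)
     \<and> (\<forall>r<5. tape_holds (tps ! tape_of r) (s r))"

lemma tape_holds_read: "tape_holds (h, c) l \<Longrightarrow> c h = sym_at l 0"
  by (simp add: tape_holds_def)

lemma sym_at_Cons: "sym_at (b # l) i = (if i = 0 then bsym b else sym_at l (i - 1))"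
  by (cases i) (auto simp: sym_at_def)

lemma sym_at_tl: "sym_at (tl l) i = sym_at l (Suc i)"
  by (cases l) (auto simp: sym_at_def)

lemma sym_at_Nil [simp]: "sym_at [] i = 0"
  by (simp add: sym_at_def)

lemma map2_write_at:
  assumes "length as = length tps" "as = map (\<lambda>(h, c). c h) tps" "i < length tps"
  shows "map2 act (write_at as i x) tps = tps[i := act x (tps ! i)]"
proof (rule nth_equalityI)
  show "length (map2 act (write_at as i x) tps) = length (tps[i := act x (tps ! i)])"
    using assms by (simp add: write_at_def)
  fix j assume "j < length (map2 act (write_at as i x) tps)"
  hence j: "j < length tps" using assms by (simp add: write_at_def)
  obtain h c where hc: "tps ! j = (h, c)" by fastforce
  show "map2 act (write_at as i x) tps ! j = tps[i := act x (tps ! i)] ! j"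
    using assms j hc by (cases "i = j") (auto simp: write_at_def nth_list_update)
qed

lemma tape_of_inj: "tape_of r = tape_of r' \<longleftrightarrow> r = r'"
  by (auto simp: tape_of_def)

lemma tape_of_ne_1 [simp]: "tape_of r \<noteq> Suc 0"
  by (auto simp: tape_of_def)

lemma tm_of_simulates_step:
  assumes P: "wf_prog P" and q: "q < length P" and h: "holds tps s"
    and g: "gstep P (q, s) = (q', s')"
  shows "\<exists>tps'. (tm_step (tm_of P) ^^ 2) (q, tps) = (q', tps') \<and> holds tps' s'"
proof -
  let ?n = "length P" and ?M = "tm_of P"
  obtain r f where rf: "P ! q = (r, f)" by fastforce
  have r: "r < 5" using wf_prog_nth[OF P q rf] by simp
  let ?i = "tape_of r"
  define a where "a = sym_at (s r) 0"
  have a3: "a < 3" by (simp add: a_def sym_at_def bsym_def)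
  obtain op where op: "f a = (q', op)" "s' = s(r := apply_sop op (s r))"
    using g q rf by (auto simp: gstep_def instr_at_def a_def split: prod.splits)
  have len: "length tps = 6" and i6: "?i < 6" and t1: "tps ! 1 = (0, \<lambda>_. 0)"
    using h r by (auto simp: holds_def tape_of_def)
  obtain hd0 c0 where hc: "tps ! ?i = (hd0, c0)" by fastforce
  have th: "tape_holds (hd0, c0) (s r)" using h r hc by (auto simp: holds_def)
  have rd: "map (\<lambda>(h, c). c h) tps ! ?i = a"
    using len i6 hc tape_holds_read[OF th] by (simp add: a_def)
  define x1 where "x1 = (case op of Keep \<Rightarrow> (a, 0) | Drop \<Rightarrow> (0, 1) | Put b \<Rightarrow> (a, -1::int))"
  define tps1 where "tps1 = tps[?i := act x1 (tps ! ?i)]"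
  let ?rd = "\<lambda>tps :: tape list. map (\<lambda>(h, c). c h) tps"
  have "trans ?M q (?rd tps) = (?n + 1 + 3 * q + a, write_at (?rd tps) ?i x1)"
    using q rf op rd by (cases op) (simp_all add: tm_of_def Let_def x1_def del: nth_map)
  moreover have "map2 act (write_at (?rd tps) ?i x1) tps = tps1"
    unfolding tps1_def by (rule map2_write_at) (use len i6 in auto)
  moreover have "q < num_states ?M" using q by (simp add: tm_of_def Let_def)
  ultimately have s1: "tm_step ?M (q, tps) = (?n + 1 + 3 * q + a, tps1)"
    by (simp add: tm_step_def del: map_map)
  obtain h1 c1 where hc1: "tps1 ! ?i = (h1, c1)" by fastforce
  have len1: "length tps1 = 6" using len by (simp add: tps1_def)
  have rd1: "map (\<lambda>(h, c). c h) tps1 ! ?i = c1 h1"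
    using len1 i6 hc1 by simp
  define x2 where "x2 = (case op of Put b \<Rightarrow> (bsym b, 0) | _ \<Rightarrow> (c1 h1, 0::int))"
  define tps2 where "tps2 = tps1[?i := act x2 (tps1 ! ?i)]"
  have dm: "(3 * q + a) div 3 = q" "(3 * q + a) mod 3 = a" using a3 by auto
  have "trans ?M (?n + 1 + 3 * q + a) (?rd tps1) = (q', write_at (?rd tps1) ?i x2)"
    using rf op rd1 dm a3 by (cases op) (simp_all add: tm_of_def Let_def x2_def del: nth_map)
  moreover have "map2 act (write_at (?rd tps1) ?i x2) tps1 = tps2"
    unfolding tps2_def by (rule map2_write_at) (use len1 i6 in auto)
  moreover have "?n + 1 + 3 * q + a < num_states ?M" using q a3 by (simp add: tm_of_def Let_def)
  ultimately have s2: "tm_step ?M (?n + 1 + 3 * q + a, tps1) = (q', tps2)"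
    by (simp add: tm_step_def del: map_map)
  have h2: "tape_holds (tps2 ! ?i) (apply_sop op (s r))"
  proof (cases op)
    case Keep
    have "c0(hd0 := a) = c0" using tape_holds_read[OF th] by (auto simp: a_def)
    then show ?thesis using Keep th len i6 hc hc1
      by (auto simp: tps2_def tps1_def x1_def x2_def)
  next
    case Drop
    then have "tps2 ! ?i = (hd0 + 1, c0(hd0 := 0))" using len i6 hc hc1
      by (auto simp: tps2_def tps1_def x1_def x2_def)
    moreover have "tape_holds (hd0 + 1, c0(hd0 := 0)) (tl (s r))"
      unfolding tape_holds_def prod.case
    proof
      fix i
      have "hd0 < i \<Longrightarrow> nat (i - hd0) = Suc (nat (i - (hd0 + 1)))" by linarith
      then show "(c0(hd0 := 0)) i = (if hd0 + 1 \<le> i then sym_at (tl (s r)) (nat (i - (hd0 + 1))) else 0)"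
        using th by (auto simp: tape_holds_def sym_at_tl)
    qed
    ultimately show ?thesis using Drop by simp
  next
    case (Put b)
    have "c0(hd0 := a) = c0" using tape_holds_read[OF th] by (auto simp: a_def)
    then have "tps2 ! ?i = (hd0 - 1, c0(hd0 - 1 := bsym b))" using len i6 hc hc1 Put
      by (auto simp: tps2_def tps1_def x1_def x2_def)
    moreover have "tape_holds (hd0 - 1, c0(hd0 - 1 := bsym b)) (b # s r)"
      unfolding tape_holds_def prod.case
    proof
      fix i
      have "hd0 \<le> i \<Longrightarrow> nat (i - (hd0 - 1)) = Suc (nat (i - hd0))" by linarith
      then show "(c0(hd0 - 1 := bsym b)) i =
          (if hd0 - 1 \<le> i then sym_at (b # s r) (nat (i - (hd0 - 1))) else 0)"
        using th by (auto simp: tape_holds_def sym_at_Cons)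
    qed
    ultimately show ?thesis using Put by simp
  qed
  have "holds tps2 s'"
    unfolding holds_def
  proof (intro conjI allI impI)
    show "length tps2 = 6" using len1 by (simp add: tps2_def)
    show "tps2 ! 1 = (0, \<lambda>_. 0)" using t1 tape_of_ne_1[of r] by (simp add: tps2_def tps1_def)
    fix r' :: nat assume r': "r' < 5"
    show "tape_holds (tps2 ! tape_of r') (s' r')"
    proof (cases "r' = r")
      case True
      with h2 op show ?thesis by simp
    next
      case False
      with h r' op show ?thesis
        by (auto simp: tps2_def tps1_def holds_def tape_of_inj)
    qed
  qed
  with s1 s2 show ?thesis by (auto simp: numeral_2_eq_2)
qed

lemma tm_of_simulates:
  assumes P: "wf_prog P" and h: "holds tps s"
    and g: "(gstep P ^^ n) (q, s) = (length P, s')" and q: "q \<le> length P"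
  shows "\<exists>t tps'. t \<le> 2 * n \<and> (tm_step (tm_of P) ^^ t) (q, tps) = (length P, tps') \<and> holds tps' s'"
  using h g q
proof (induction n arbitrary: q s tps)
  case 0
  then show ?case by auto
next
  case (Suc n)
  show ?case
  proof (cases "q = length P")
    case True
    with Suc.prems gstep_halted[of P q "Suc n" s] have "s' = s" by simp
    with True Suc.prems show ?thesis by (intro exI[of _ 0]) auto
  next
    case False
    with Suc.prems have q: "q < length P" by simp
    obtain q1 s1 where g1: "gstep P (q, s) = (q1, s1)" by fastforce
    obtain r f where rf: "P ! q = (r, f)" by fastforce
    have q1: "q1 \<le> length P" using wf_prog_nth(2)[OF P q rf, of "sym_at (s r) 0"] g1 q rf
      by (simp add: gstep_def instr_at_def split: prod.splits)
    from tm_of_simulates_step[OF P q Suc.prems(1) g1] obtain tps1 where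
      t1: "(tm_step (tm_of P) ^^ 2) (q, tps) = (q1, tps1)" "holds tps1 s1" by blast
    have "(gstep P ^^ n) (q1, s1) = (length P, s')"
      using Suc.prems(2) g1 by (simp add: funpow_swap1)
    from Suc.IH[OF t1(2) this q1] obtain t tps' where
      t: "t \<le> 2 * n" "(tm_step (tm_of P) ^^ t) (q1, tps1) = (length P, tps')" "holds tps' s'" by blast
    show ?thesis using funpow_trans[OF t1(1) t(2)] t by (intro exI[of _ "2 + t"]) auto
  qed
qed

lemma tm_step_halted: "num_states M \<le> q \<Longrightarrow> (tm_step M ^^ n) (q, tps) = (q, tps)"
  by (induction n) (auto simp: tm_step_def)

text \<open>Tape 1 stays blank during the simulation, so after the copying step it holds exactly one
  symbol, as the output convention demands. This step is the \<open>+ 1\<close> in the time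
  bound.\<close>

lemma tm_of_outputs:
  assumes P: "wf_prog P"
    and g: "(gstep P ^^ n) (0, (\<lambda>_. [])(0 := x)) = (length P, s')" and s': "s' 1 = b # l"
    and t: "2 * n + 1 \<le> t"
  shows "outputs_within (tm_of P) x t [b]"
proof -
  let ?M = "tm_of P"
  let ?tps = "snd (tm_init ?M x)"
  have init: "tm_init ?M x = (0, ?tps)" by (simp add: tm_init_def)
  have tps: "?tps = (0, string_contents x) # replicate 5 (0, \<lambda>_. 0)"
    by (simp add: tm_init_def tm_of_def Let_def)
  have "holds ?tps ((\<lambda>_. [])(0 := x))"
    unfolding holds_def tps
  proof (intro conjI allI impI)
    fix r :: nat assume "r < 5"
    show "tape_holds (((0, string_contents x) # replicate 5 (0, \<lambda>_. 0)) ! tape_of r)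
            (((\<lambda>_. [])(0 := x)) r)"
      using \<open>r < 5\<close> by (cases "r = 0")
        (auto simp: tape_holds_def tape_of_def string_contents_def sym_at_def bsym_def nth_Cons')
  qed auto
  from tm_of_simulates[OF P this g] obtain t1 tps1 where
    t1: "t1 \<le> 2 * n" "(tm_step ?M ^^ t1) (0, ?tps) = (length P, tps1)" "holds tps1 s'" by auto
  have len: "length tps1 = 6" and o1: "tps1 ! 1 = (0, \<lambda>_. 0)"
    and "tape_holds (tps1 ! tape_of 1) (s' 1)"
    using t1(3) unfolding holds_def by auto
  hence h2: "tape_holds (tps1 ! 2) (b # l)" using s' by (simp add: tape_of_def numeral_2_eq_2)
  obtain h2 c2 where hc: "tps1 ! 2 = (h2, c2)" by fastforce
  have rd: "map (\<lambda>(h, c). c h) tps1 ! 2 = bsym b"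
    using len hc tape_holds_read[of h2 c2 "b # l"] h2 by (simp add: sym_at_def)
  define tps2 where "tps2 = tps1[1 := act (bsym b, 0) (tps1 ! 1)]"
  have "tm_step ?M (length P, tps1) = (num_states ?M, tps2)"
    using rd map2_write_at[OF _ refl, of tps1 1 "(bsym b, 0)"] len
    by (simp add: tm_step_def tm_of_def Let_def tps2_def)
  hence "(tm_step ?M ^^ 1) (length P, tps1) = (num_states ?M, tps2)" by simp
  from funpow_trans[OF funpow_trans[OF t1(2) this] tm_step_halted[of ?M "num_states ?M" "t - (t1 + 1)"]]
  have fin: "(tm_step ?M ^^ t) (0, ?tps) = (num_states ?M, tps2)" using t t1 by simp
  have "snd (tps2 ! 1) = string_contents [b]"
    using len o1 by (auto simp: tps2_def string_contents_def bsym_def fun_eq_iff)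
  with fin init show ?thesis by (simp add: outputs_within_def)
qed

subsection \<open>Polynomial-time functions on encodable types\<close>

datatype tree = Lf | Nd tree tree

text \<open>A prefix code, in preorder: the end of a value is recognised while reading it, so
  several values can lie on one stack without separators.\<close>

fun code :: "tree \<Rightarrow> bool list" where
  "code Lf = [False]"
| "code (Nd l r) = True # code l @ code r"

class encodable =
  fixes tree_of :: "'a \<Rightarrow> tree"
  assumes tree_of_inj: "tree_of x = tree_of y \<Longrightarrow> x = y"

instantiation tree :: encodable
begin
definition tree_of_tree :: "tree \<Rightarrow> tree" where "tree_of_tree t = t"
instance by standard (simp add: tree_of_tree_def)
end

instantiation unit :: encodable
begin
definition tree_of_unit :: "unit \<Rightarrow> tree" where "tree_of_unit u = Lf"
instance by standard simp
end

text \<open>Both truth values have codes of length 5, so that the code of a bit string has a shape that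
  depends only on its length.\<close>

instantiation bool :: encodable
begin
definition tree_of_bool :: "bool \<Rightarrow> tree" where
  "tree_of_bool b = (if b then Nd (Nd Lf Lf) Lf else Nd Lf (Nd Lf Lf))"
instance by standard (simp add: tree_of_bool_def split: if_splits)
end

instantiation nat :: encodable
begin
primrec tree_of_nat :: "nat \<Rightarrow> tree" where
  "tree_of_nat 0 = Lf"
| "tree_of_nat (Suc n) = Nd Lf (tree_of_nat n)"
instance
proof
  fix x y :: nat
  show "tree_of x = tree_of y \<Longrightarrow> x = y"
  proof (induction x arbitrary: y)
    case 0 then show ?case by (cases y) auto
  next
    case (Suc x) then show ?case by (cases y) auto
  qed
qed
end

instantiation prod :: (encodable, encodable) encodable
begin
definition tree_of_prod :: "'a \<times> 'b \<Rightarrow> tree" where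
  "tree_of_prod p = Nd (tree_of (fst p)) (tree_of (snd p))"
instance by standard (auto simp: tree_of_prod_def prod_eq_iff dest: tree_of_inj)
end

instantiation list :: (encodable) encodable
begin
primrec tree_of_list :: "'a list \<Rightarrow> tree" where
  "tree_of_list [] = Lf"
| "tree_of_list (x # xs) = Nd (tree_of x) (tree_of_list xs)"
instance
proof
  fix x y :: "'a list"
  show "tree_of x = tree_of y \<Longrightarrow> x = y"
  proof (induction x arbitrary: y)
    case Nil then show ?case by (cases y) auto
  next
    case (Cons a x) then show ?case by (cases y) (auto dest: tree_of_inj)
  qed
qed
end

abbreviation enc :: "'a::encodable \<Rightarrow> bool list" where
  "enc x \<equiv> code (tree_of x)"

section \<open>Sizes of encodings and polynomial bounds\<close>

definition sz :: "'a::encodable \<Rightarrow> nat" where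
  "sz x = length (enc x)"

lemma length_code_pos: "0 < length (code t)"
  by (cases t) auto

lemma sz_pos: "0 < sz x"
  unfolding sz_def by (rule length_code_pos)

lemma sz_simps [simp]:
  "sz (a, y) = Suc (sz a + sz y)"
  "sz (x # xs) = Suc (sz x + sz xs)"
  "sz ([] :: 'a::encodable list) = 1"
  "sz (0 :: nat) = 1" "sz (Suc n) = Suc (Suc (sz n))"
  "sz () = 1" "sz (b :: bool) = 5"
  by (auto simp: sz_def tree_of_prod_def tree_of_unit_def tree_of_bool_def)

lemma sz_nat: "sz (n :: nat) = 2 * n + 1"
  by (induction n) auto

lemma sz_append: "sz (xs @ ys) + 1 = sz xs + sz ys"
  by (induction xs) auto

lemma length_le_sz: "length xs \<le> sz xs"
  by (induction xs) auto

text \<open>The \<open>+ 2\<close> keeps the base at least 2, so that constants, sums and products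
  are all absorbed by a larger exponent and no coefficients occur.\<close>

definition pb :: "('a::encodable \<Rightarrow> nat) \<Rightarrow> bool" where
  "pb B \<longleftrightarrow> (\<exists>k. \<forall>x. B x \<le> (sz x + 2) ^ k)"

lemma pbI: "(\<And>x. B x \<le> (sz x + 2) ^ k) \<Longrightarrow> pb B"
  unfolding pb_def by blast

lemma pb_mono: assumes "pb B" "\<And>x. A x \<le> B x" shows "pb A"
proof -
  from assms(1) obtain k where "\<And>x. B x \<le> (sz x + 2) ^ k" unfolding pb_def by blast
  with assms(2) have "A x \<le> (sz x + 2) ^ k" for x by (meson le_trans)
  then show ?thesis by (rule pbI)
qed

lemma pb_const: "pb (\<lambda>_. c)"
proof (rule pbI)
  fix x :: 'a
  have "c \<le> 2 ^ c" by (simp add: less_imp_le)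
  also have "2 ^ c \<le> (sz x + 2) ^ c" by (rule power_mono) auto
  finally show "c \<le> (sz x + 2) ^ c" .
qed

lemma pb_sz: "pb sz"
  unfolding pb_def by (rule exI[of _ 1]) simp

lemma pb_obtain2:
  assumes "pb A" "pb B"
  obtains k where "\<And>x. A x \<le> (sz x + 2) ^ k" "\<And>x. B x \<le> (sz x + 2) ^ k"
proof -
  from assms obtain i j where i: "\<And>x. A x \<le> (sz x + 2) ^ i" and j: "\<And>x. B x \<le> (sz x + 2) ^ j"
    unfolding pb_def by auto
  have "A x \<le> (sz x + 2) ^ (i + j)" for x
    by (rule le_trans[OF i power_increasing]) auto
  moreover have "B x \<le> (sz x + 2) ^ (i + j)" for x
    by (rule le_trans[OF j power_increasing]) auto
  ultimately show thesis by (rule that)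
qed

lemma pb_add: assumes "pb A" "pb B" shows "pb (\<lambda>x. A x + B x)"
proof -
  obtain k where k: "\<And>x. A x \<le> (sz x + 2) ^ k" "\<And>x. B x \<le> (sz x + 2) ^ k"
    using pb_obtain2[OF assms] by blast
  have "A x + B x \<le> (sz x + 2) ^ (k + 1)" for x
  proof -
    have "A x + B x \<le> 2 * (sz x + 2) ^ k" using k[of x] by simp
    also have "\<dots> \<le> (sz x + 2) * (sz x + 2) ^ k" by (intro mult_right_mono) auto
    finally show ?thesis by simp
  qed
  then show ?thesis by (rule pbI)
qed

lemma pb_mult: assumes "pb A" "pb B" shows "pb (\<lambda>x. A x * B x)"
proof -
  obtain k where k: "\<And>x. A x \<le> (sz x + 2) ^ k" "\<And>x. B x \<le> (sz x + 2) ^ k"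
    using pb_obtain2[OF assms] by blast
  have "A x * B x \<le> (sz x + 2) ^ (k + k)" for x
    unfolding power_add using k[of x] by (intro mult_mono) auto
  then show ?thesis by (rule pbI)
qed

lemma pb_power: "pb A \<Longrightarrow> pb (\<lambda>x. A x ^ k)"
  by (induction k) (auto intro: pb_const pb_mult)

lemma pb_comp:
  assumes "pb B" "pb (\<lambda>x. sz (f x))"
  shows "pb (\<lambda>x. B (f x))"
proof -
  obtain k where k: "\<And>y. B y \<le> (sz y + 2) ^ k" using assms(1) unfolding pb_def by blast
  have "pb (\<lambda>x. (sz (f x) + 2) ^ k)" by (intro pb_power pb_add assms pb_const)
  then show ?thesis by (rule pb_mono) (rule k)
qed

lemmas pb_intros = pb_const pb_sz pb_add pb_mult pb_power

section \<open>Executions with time bounds, and macros that move whole values\<close>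

definition ex :: "com \<Rightarrow> store \<Rightarrow> nat \<Rightarrow> store \<Rightarrow> bool" where
  "ex c s N s' \<longleftrightarrow> (\<exists>n \<le> N. exec c s n s')"

lemma ex_weaken: "ex c s N s' \<Longrightarrow> N \<le> N' \<Longrightarrow> ex c s N' s'"
  unfolding ex_def using le_trans by blast

lemma ex_skip: "ex SKIP s 0 s"
  unfolding ex_def using exec.Skip by blast

lemma ex_push: "ex (PUSH r b) s 1 (s(r := b # s r))"
  unfolding ex_def using exec.Push by blast

lemma ex_pop: "ex (POP r) s 1 (s(r := tl (s r)))"
  unfolding ex_def using exec.Pop by blast

lemma ex_seq:
  assumes "ex c1 s N s'" "ex c2 s' M s''"
  shows "ex (c1 ;; c2) s (N + M) s''"
proof -
  from assms obtain n m where "n \<le> N" "m \<le> M" "exec c1 s n s'" "exec c2 s' m s''"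
    unfolding ex_def by blast
  then show ?thesis using exec.Seq[of c1 s n s' c2 m s''] unfolding ex_def
    by (intro exI[of _ "n + m"]) auto
qed

lemma ex_ifT: "sym_at (s r) 0 \<in> A \<Longrightarrow> ex c1 s N s' \<Longrightarrow> ex (IF r A c1 c2) s (N + 2) s'"
  unfolding ex_def using exec.IfT[of s r A c1 _ s' c2] by (meson add_le_mono1)

lemma ex_ifF: "sym_at (s r) 0 \<notin> A \<Longrightarrow> ex c2 s N s' \<Longrightarrow> ex (IF r A c1 c2) s (N + 1) s'"
  unfolding ex_def using exec.IfF[of s r A c2 _ s' c1] by (meson add_le_mono1)

lemma ex_whileF: "sym_at (s r) 0 \<notin> A \<Longrightarrow> ex (WHILE r A c) s 1 s"
  unfolding ex_def using exec.WhileF by blast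

lemma ex_whileT:
  assumes "sym_at (s r) 0 \<in> A" "ex c s N s'" "ex (WHILE r A c) s' M s''"
  shows "ex (WHILE r A c) s (N + M + 2) s''"
proof -
  from assms obtain n m where "n \<le> N" "m \<le> M" "exec c s n s'" "exec (WHILE r A c) s' m s''"
    unfolding ex_def by blast
  then show ?thesis using exec.WhileT[of s r A c n s' m s''] assms(1) unfolding ex_def
    by (intro exI[of _ "n + m + 2"]) auto
qed

lemma exec_length: "exec c s n s' \<Longrightarrow> length (s' r) \<le> length (s r) + n"
  by (induction c s n s' rule: exec.induct) auto

lemma sym_at_0 [simp]: "sym_at (True # l) 0 = 2" "sym_at (False # l) 0 = 1"
  by (auto simp: sym_at_def bsym_def)

lemma sym_at_0_eq: "sym_at l 0 \<in> {1, 2} \<longleftrightarrow> l \<noteq> []" "sym_at l 0 \<in> {2} \<longleftrightarrow> l \<noteq> [] \<and> hd l"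
  by (cases l; auto simp: sym_at_def bsym_def)+

text \<open>Stack 1 holds the arguments, stack 2 is a second stack of values, stack 3 is a buffer and
  stack 4 counts the subtrees that remain to be read.\<close>

definition pull :: "nat \<Rightarrow> com" where
  "pull a = PUSH 4 True ;; WHILE 4 {2} (IF a {2} (POP a ;; PUSH 3 True ;; PUSH 4 True)
     (POP a ;; PUSH 3 False ;; POP 4))"

text \<open>At an inner node one pending tree is replaced by two, so the list of pending trees may
  grow while the number of unread bits drops; the induction is on the latter. Each bit costs at most
  7 steps: three for the body, two for the branch, two for the loop.\<close>

lemma ex_pull_loop:
  assumes "a \<noteq> 3" "a \<noteq> 4" "s 4 = replicate (length ts) True" "s a = concat (map code ts) @ rest"
  shows "ex (WHILE 4 {2} (IF a {2} (POP a ;; PUSH 3 True ;; PUSH 4 True)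
     (POP a ;; PUSH 3 False ;; POP 4))) s (7 * length (concat (map code ts)) + 1)
     (s(a := rest, 3 := rev (concat (map code ts)) @ s 3, 4 := []))" (is "ex ?w _ _ _")
  using assms(3,4)
proof (induction "length (concat (map code ts))" arbitrary: ts s rule: less_induct)
  case less
  show ?case
  proof (cases ts)
    case Nil
    have "ex ?w s 1 s" by (rule ex_whileF) (simp add: less.prems Nil)
    moreover have "s(a := rest, 3 := rev (concat (map code ts)) @ s 3, 4 := []) = s"
      using less.prems Nil assms by (auto simp: fun_eq_iff)
    ultimately show ?thesis using Nil by simp
  next
    case (Cons t ts')
    show ?thesis
    proof (cases t)
      case Lf
      let ?s = "s(a := concat (map code ts') @ rest, 3 := False # s 3, 4 := replicate (length ts') True)"
      have "ex (POP a ;; PUSH 3 False ;; POP 4) s (1 + (1 + 1))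
          (s(a := tl (s a), 3 := False # (s(a := tl (s a))) 3,
             4 := tl ((s(a := tl (s a), 3 := False # (s(a := tl (s a))) 3)) 4)))"
        by (rule ex_seq[OF ex_pop ex_seq[OF ex_push ex_pop]])
      moreover have "(s(a := tl (s a), 3 := False # (s(a := tl (s a))) 3,
             4 := tl ((s(a := tl (s a), 3 := False # (s(a := tl (s a))) 3)) 4))) = ?s"
        using less.prems Cons Lf assms by (auto simp: fun_eq_iff)
      ultimately have 1: "ex (POP a ;; PUSH 3 False ;; POP 4) s 3 ?s" by (simp add: numeral_3_eq_3)
      have 2: "ex (IF a {2} (POP a ;; PUSH 3 True ;; PUSH 4 True) (POP a ;; PUSH 3 False ;; POP 4)) s 5 ?s"
        by (rule ex_weaken, rule ex_ifF[OF _ 1]) (simp_all add: less.prems Cons Lf)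
      have 3: "ex ?w ?s (7 * length (concat (map code ts')) + 1)
        (?s(a := rest, 3 := rev (concat (map code ts')) @ ?s 3, 4 := []))"
        by (rule less.hyps) (use Cons Lf assms in auto)
      have "ex ?w s (5 + (7 * length (concat (map code ts')) + 1) + 2)
         (?s(a := rest, 3 := rev (concat (map code ts')) @ ?s 3, 4 := []))"
        by (rule ex_whileT[OF _ 2 3]) (simp add: less.prems Cons)
      moreover have "?s(a := rest, 3 := rev (concat (map code ts')) @ ?s 3, 4 := []) =
         s(a := rest, 3 := rev (concat (map code ts)) @ s 3, 4 := [])"
        using Cons Lf assms by (auto simp: fun_eq_iff)
      ultimately show ?thesis using Cons Lf by (auto elim: ex_weaken)
    next
      case (Nd l r)
      let ?ts = "l # r # ts'"
      let ?s = "s(a := concat (map code ?ts) @ rest, 3 := True # s 3, 4 := replicate (length ?ts) True)"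
      have "ex (POP a ;; PUSH 3 True ;; PUSH 4 True) s (1 + (1 + 1))
          (s(a := tl (s a), 3 := True # (s(a := tl (s a))) 3,
             4 := True # ((s(a := tl (s a), 3 := True # (s(a := tl (s a))) 3)) 4)))"
        by (rule ex_seq[OF ex_pop ex_seq[OF ex_push ex_push]])
      moreover have "(s(a := tl (s a), 3 := True # (s(a := tl (s a))) 3,
             4 := True # ((s(a := tl (s a), 3 := True # (s(a := tl (s a))) 3)) 4))) = ?s"
        using less.prems Cons Nd assms by (auto simp: fun_eq_iff)
      ultimately have 1: "ex (POP a ;; PUSH 3 True ;; PUSH 4 True) s 3 ?s" by (simp add: numeral_3_eq_3)
      have 2: "ex (IF a {2} (POP a ;; PUSH 3 True ;; PUSH 4 True) (POP a ;; PUSH 3 False ;; POP 4)) s 5 ?s"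
        by (rule ex_weaken, rule ex_ifT[OF _ 1]) (simp_all add: less.prems Cons Nd)
      have 3: "ex ?w ?s (7 * length (concat (map code ?ts)) + 1)
        (?s(a := rest, 3 := rev (concat (map code ?ts)) @ ?s 3, 4 := []))"
        by (rule less.hyps) (use Cons Nd assms in auto)
      have "ex ?w s (5 + (7 * length (concat (map code ?ts)) + 1) + 2)
         (?s(a := rest, 3 := rev (concat (map code ?ts)) @ ?s 3, 4 := []))"
        by (rule ex_whileT[OF _ 2 3]) (simp add: less.prems Cons)
      moreover have "?s(a := rest, 3 := rev (concat (map code ?ts)) @ ?s 3, 4 := []) =
         s(a := rest, 3 := rev (concat (map code ts)) @ s 3, 4 := [])"
        using Cons Nd assms by (auto simp: fun_eq_iff)
      ultimately show ?thesis using Cons Nd by (auto elim: ex_weaken)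
    qed
  qed
qed

lemma ex_pull:
  assumes "a \<noteq> 3" "a \<noteq> 4" "s 4 = []" "s a = code t @ rest"
  shows "ex (pull a) s (7 * length (code t) + 2) (s(a := rest, 3 := rev (code t) @ s 3))"
proof -
  let ?s = "s(4 := True # s 4)"
  have "ex (pull a) s (1 + (7 * length (concat (map code [t])) + 1))
    (?s(a := rest, 3 := rev (concat (map code [t])) @ ?s 3, 4 := []))"
    unfolding pull_def by (rule ex_seq, rule ex_push, rule ex_pull_loop) (use assms in auto)
  moreover have "?s(a := rest, 3 := rev (concat (map code [t])) @ ?s 3, 4 := []) =
     s(a := rest, 3 := rev (code t) @ s 3)"
    using assms by (auto simp: fun_eq_iff)
  ultimately show ?thesis by simp
qed

definition drain :: "nat \<Rightarrow> (bool \<Rightarrow> com) \<Rightarrow> com" where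
  "drain a c = WHILE a {1, 2} (IF a {2} (POP a ;; c True) (POP a ;; c False))"

text \<open>The side conditions say that the effect \<open>h\<close> of the handler neither changes
  nor inspects the drained stack, so that popping commutes with it.\<close>

lemma ex_drain:
  assumes c: "\<And>x s. ex (c x) s K (h x s)"
    and a: "\<And>x s. h x s a = s a" "\<And>x s l. h x (s(a := l)) = (h x s)(a := l)"
  shows "ex (drain a c) s ((K + 5) * length (s a) + 1) ((fold h (s a) s)(a := []))"
proof (induction "s a" arbitrary: s)
  case Nil
  have "ex (drain a c) s 1 s" unfolding drain_def by (rule ex_whileF) (simp add: Nil[symmetric])
  moreover have e: "(fold h (s a) s)(a := []) = s" using Nil[symmetric] by (auto simp: fun_eq_iff)
  ultimately show ?case unfolding e using Nil[symmetric] by simp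
next
  case (Cons x l)
  have upd: "fold h l (s(a := k)) = (fold h l s)(a := k)" for k l s
    by (induction l arbitrary: s) (auto simp: a)
  let ?s = "h x (s(a := l))"
  have st: "s a = x # l" using Cons by simp
  have e: "ex (POP a ;; c x) s (1 + K) ?s"
    using ex_seq[OF ex_pop[of a s] c] by (simp add: st)
  have i: "ex (IF a {2} (POP a ;; c True) (POP a ;; c False)) s (K + 3) ?s"
  proof (cases x)
    case True
    then show ?thesis using e st by (auto intro: ex_weaken[OF ex_ifT])
  next
    case False
    then show ?thesis using e st by (auto intro: ex_weaken[OF ex_ifF])
  qed
  have w: "ex (drain a c) ?s ((K + 5) * length (?s a) + 1) ((fold h (?s a) ?s)(a := []))"
    by (rule Cons.hyps) (simp add: a)
  have w2: "ex (drain a c) s ((K + 3) + ((K + 5) * length (?s a) + 1) + 2) ((fold h (?s a) ?s)(a := []))"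
    using w unfolding drain_def
    by (intro ex_whileT[OF _ i]) (simp_all only: sym_at_0_eq st list.simps not_False_eq_True)
  have e: "(fold h (?s a) ?s)(a := []) = (fold h (s a) s)(a := [])"
    by (simp add: a st upd)
  from w2 show ?case unfolding e by (rule ex_weaken) (simp add: a st)
qed

definition unload :: "nat \<Rightarrow> com" where
  "unload b = drain 3 (PUSH b)"

definition unload2 :: com where
  "unload2 = drain 3 (\<lambda>x. PUSH 1 x ;; PUSH 2 x)"

definition clear :: com where
  "clear = WHILE 3 {1, 2} (POP 3)"

lemma fold_push: "fold (\<lambda>x s. s(b := x # s b)) l s = s(b := rev l @ s b)"
  by (induction l arbitrary: s) (auto simp: fun_eq_iff)

lemma ex_drain_push:
  assumes "a \<noteq> b"
  shows "ex (drain a (PUSH b)) s (6 * length (s a) + 1) (s(a := [], b := rev (s a) @ s b))"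
proof -
  have "ex (drain a (PUSH b)) s ((1 + 5) * length (s a) + 1) ((fold (\<lambda>x s. s(b := x # s b)) (s a) s)(a := []))"
    by (rule ex_drain) (use assms ex_push in \<open>auto simp: fun_upd_twist\<close>)
  then show ?thesis unfolding fold_push using assms by (simp add: fun_upd_twist)
qed

lemma ex_unload:
  "b \<noteq> 3 \<Longrightarrow> ex (unload b) s (6 * length (s 3) + 1) (s(3 := [], b := rev (s 3) @ s b))"
  unfolding unload_def by (rule ex_drain_push) simp

lemma ex_unload2:
  "ex unload2 s (7 * length (s 3) + 1) (s(3 := [], 1 := rev (s 3) @ s 1, 2 := rev (s 3) @ s 2))"
proof -
  let ?h = "\<lambda>x (s :: store). s(1 := x # s 1, 2 := x # s 2)"
  have "ex unload2 s ((2 + 5) * length (s 3) + 1) ((fold ?h (s 3) s)(3 := []))"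
    unfolding unload2_def
  proof (rule ex_drain)
    show "ex (PUSH 1 x ;; PUSH 2 x) s 2 (?h x s)" for x and s :: store
      using ex_seq[OF ex_push[of 1 x s] ex_push[of 2 x]] by (auto elim: ex_weaken)
  qed (auto simp: fun_eq_iff)
  moreover have "fold ?h l s = s(1 := rev l @ s 1, 2 := rev l @ s 2)" for l s
    by (induction l arbitrary: s) (auto simp: fun_eq_iff)
  ultimately have "ex unload2 s ((2 + 5) * length (s 3) + 1) (s(1 := rev (s 3) @ s 1, 2 := rev (s 3) @ s 2, 3 := []))"
    by simp
  moreover have e: "s(1 := rev (s 3) @ s 1, 2 := rev (s 3) @ s 2, 3 := []) =
     s(3 := [], 1 := rev (s 3) @ s 1, 2 := rev (s 3) @ s 2)" by (auto simp: fun_eq_iff)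
  ultimately show ?thesis unfolding e by simp
qed

lemma ex_clear: "ex clear s (3 * length (s 3) + 1) (s(3 := []))"
proof (induction "s 3" arbitrary: s)
  case Nil
  have "ex clear s 1 s" unfolding clear_def
    by (rule ex_whileF) (simp add: Nil[symmetric])
  moreover have "s = s(3 := [])" using Nil[symmetric] by (auto simp: fun_eq_iff)
  ultimately show ?case using Nil by simp
next
  case (Cons x l)
  let ?s = "s(3 := tl (s 3))"
  have st: "s 3 = x # l" using Cons by simp
  have w: "ex clear ?s (3 * length (?s 3) + 1) (?s(3 := []))"
    by (rule Cons.hyps) (simp add: st)
  have "ex clear s (1 + (3 * length (?s 3) + 1) + 2) (?s(3 := []))"
    using w unfolding clear_def
    by (intro ex_whileT[OF _ ex_pop]) (simp_all only: sym_at_0_eq st list.simps not_False_eq_True)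
  then show ?case using st by (auto elim: ex_weaken)
qed

definition mv :: "nat \<Rightarrow> nat \<Rightarrow> com" where
  "mv a b = pull a ;; unload b"

text \<open>The way through the buffer reverses the code twice, so it arrives in its original
  order.\<close>

lemma ex_mv:
  assumes "a \<noteq> 3" "a \<noteq> 4" "b \<noteq> 3" "a \<noteq> b" "s 3 = []" "s 4 = []" "s a = code t @ rest"
  shows "ex (mv a b) s (13 * length (code t) + 3) (s(a := rest, b := code t @ s b))"
proof -
  let ?s = "s(a := rest, 3 := rev (code t) @ s 3)"
  have "ex (mv a b) s ((7 * length (code t) + 2) + (6 * length (?s 3) + 1)) (?s(3 := [], b := rev (?s 3) @ ?s b))"
    unfolding mv_def by (rule ex_seq[OF ex_pull ex_unload]) (use assms in auto)
  moreover have "?s(3 := [], b := rev (?s 3) @ ?s b) = s(a := rest, b := code t @ s b)"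
    using assms by (auto simp: fun_eq_iff)
  ultimately show ?thesis using assms by (auto intro: ex_weaken)
qed

definition dup :: com where
  "dup = pull 1 ;; unload2 ;; mv 2 1"

lemma ex_dup:
  assumes "s 3 = []" "s 4 = []" "s 1 = code t @ rest"
  shows "ex dup s (27 * length (code t) + 6) (s(1 := code t @ code t @ rest))"
proof -
  let ?s = "s(1 := rest, 3 := rev (code t) @ s 3)"
  let ?s' = "?s(3 := [], 1 := rev (?s 3) @ ?s 1, 2 := rev (?s 3) @ ?s 2)"
  have "ex dup s ((7 * length (code t) + 2) + ((7 * length (?s 3) + 1) + (13 * length (code t) + 3)))
     (?s'(2 := s 2, 1 := code t @ ?s' 1))"
    unfolding dup_def by (rule ex_seq[OF ex_pull ex_seq[OF ex_unload2 ex_mv]]) (use assms in auto)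
  moreover have "?s'(2 := s 2, 1 := code t @ ?s' 1) = s(1 := code t @ code t @ rest)"
    using assms by (auto simp: fun_eq_iff)
  ultimately show ?thesis using assms by (auto intro: ex_weaken)
qed

definition discard :: "nat \<Rightarrow> com" where
  "discard a = pull a ;; clear"

lemma ex_discard:
  assumes "a \<noteq> 3" "a \<noteq> 4" "s 3 = []" "s 4 = []" "s a = code t @ rest"
  shows "ex (discard a) s (10 * length (code t) + 3) (s(a := rest))"
proof -
  let ?s = "s(a := rest, 3 := rev (code t) @ s 3)"
  have "ex (discard a) s ((7 * length (code t) + 2) + (3 * length (?s 3) + 1)) (?s(3 := []))"
    unfolding discard_def by (rule ex_seq[OF ex_pull ex_clear]) (use assms in auto)
  moreover have "?s(3 := []) = s(a := rest)"
    using assms by (auto simp: fun_eq_iff)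
  ultimately show ?thesis using assms by (auto intro: ex_weaken)
qed

primrec push_all :: "nat \<Rightarrow> bool list \<Rightarrow> com" where
  "push_all r [] = SKIP"
| "push_all r (b # l) = push_all r l ;; PUSH r b"

lemma ex_push_all: "ex (push_all r l) s (length l) (s(r := l @ s r))"
proof (induction l)
  case Nil
  then show ?case using ex_skip by simp
next
  case (Cons b l)
  have "(s(r := l @ s r))(r := b # (s(r := l @ s r)) r) = s(r := (b # l) @ s r)"
    by (auto simp: fun_eq_iff)
  with ex_seq[OF Cons ex_push[of r b]] show ?case by (metis push_all.simps(2) length_Cons Suc_eq_plus1)
qed

lemma wf_com_prims [simp]:
  "wf_com (pull a) \<longleftrightarrow> a < 5" "wf_com (unload a) \<longleftrightarrow> a < 5" "wf_com unload2" "wf_com clear"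
  "wf_com (mv a b) \<longleftrightarrow> a < 5 \<and> b < 5" "wf_com dup" "wf_com (discard a) \<longleftrightarrow> a < 5"
  by (auto simp: pull_def drain_def unload_def unload2_def clear_def mv_def dup_def discard_def)

lemma wf_com_push_all [simp]: "r < 5 \<Longrightarrow> wf_com (push_all r l)"
  by (induction l) auto

text \<open>The part \<open>rest\<close> below the argument and all other stacks must come back
  unchanged. This frame condition is what allows intermediate values to be parked while further
  programs run.\<close>

definition runs :: "com \<Rightarrow> ('a::encodable \<Rightarrow> 'b::encodable) \<Rightarrow> ('a \<Rightarrow> nat) \<Rightarrow> bool" where
  "runs c f B \<longleftrightarrow> (\<forall>x s rest. s 3 = [] \<longrightarrow> s 4 = [] \<longrightarrow> s 1 = enc x @ rest \<longrightarrow>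
     ex c s (B x) (s(1 := enc (f x) @ rest)))"

definition fp :: "('a::encodable \<Rightarrow> 'b::encodable) \<Rightarrow> bool" where
  "fp f \<longleftrightarrow> (\<exists>c B. wf_com c \<and> pb B \<and> runs c f B)"

lemma fpI: "runs c f B \<Longrightarrow> pb B \<Longrightarrow> wf_com c \<Longrightarrow> fp f"
  unfolding fp_def by blast

lemma fpE:
  assumes "fp f" obtains c B where "runs c f B" "wf_com c" "pb B"
  using assms unfolding fp_def by blast

lemma runsI:
  "(\<And>x s rest. s 3 = [] \<Longrightarrow> s 4 = [] \<Longrightarrow> s 1 = enc x @ rest \<Longrightarrow>
     ex c s (B x) (s(1 := enc (f x) @ rest))) \<Longrightarrow> runs c f B"
  unfolding runs_def by blast

lemma runsD:
  "runs c f B \<Longrightarrow> s 3 = [] \<Longrightarrow> s 4 = [] \<Longrightarrow> s 1 = enc x @ rest \<Longrightarrow>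
     ex c s (B x) (s(1 := enc (f x) @ rest))"
  unfolding runs_def by blast

lemma ex_seq_eq:
  "ex c1 s N s1 \<Longrightarrow> ex c2 s1 M s2 \<Longrightarrow> s2 = s' \<Longrightarrow> ex (c1 ;; c2) s (N + M) s'"
  by (auto intro: ex_seq)

text \<open>A step pushes at most one bit, so a time bound is also a bound on the growth of the
  value. Without this the time of a composition could not be estimated.\<close>

lemma fp_sz: assumes "fp f" shows "pb (\<lambda>x. sz (f x))"
proof -
  from assms obtain c B where c: "runs c f B" "pb B" by (rule fpE)
  have "sz (f x) \<le> sz x + B x" for x
  proof -
    let ?s = "(\<lambda>_. [])(1 := enc x)"
    have "ex c ?s (B x) (?s(1 := enc (f x) @ []))"
      by (rule runsD[OF c(1)]) auto
    then obtain n where n: "n \<le> B x" "exec c ?s n (?s(1 := enc (f x) @ []))"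
      unfolding ex_def by blast
    from exec_length[OF n(2), of 1] n(1) show ?thesis by (simp add: sz_def)
  qed
  then show ?thesis by (rule pb_mono[rotated]) (intro pb_intros c)
qed

section \<open>Closure under composition, pairing, projections and case distinction\<close>

lemma fp_comp:
  fixes f :: "'a::encodable \<Rightarrow> 'b::encodable"
  assumes g: "fp g" and f: "fp f" shows "fp (\<lambda>x. g (f x))"
proof -
  from f obtain c1 B1 where 1: "runs c1 f B1" "wf_com c1" "pb B1" by (rule fpE)
  from g obtain c2 B2 where 2: "runs c2 g B2" "wf_com c2" "pb B2" by (rule fpE)
  have "runs (c1 ;; c2) (\<lambda>x. g (f x)) (\<lambda>x. B1 x + B2 (f x))"
  proof (rule runsI)
    fix x :: 'a and s :: store and rest assume s: "s 3 = []" "s 4 = []" "s 1 = enc x @ rest"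
    show "ex (c1 ;; c2) s (B1 x + B2 (f x)) (s(1 := enc (g (f x)) @ rest))"
      by (rule ex_seq_eq[OF runsD[OF 1(1) s] runsD[OF 2(1)]]) (use s in auto)
  qed
  moreover have "pb (\<lambda>x. B1 x + B2 (f x))"
    by (intro pb_add 1 pb_comp[OF 2(3)] fp_sz f)
  ultimately show ?thesis by (rule fpI) (use 1 2 in auto)
qed

text \<open>Programs see only trees, so passing to another result type with the same trees costs
  nothing. This is how lists of units become numbers and lists of numbers become nodes.\<close>

lemma fp_same_tree:
  assumes "\<And>x. tree_of (f x) = tree_of (g x)" "fp g"
  shows "fp f"
proof -
  from assms(2) obtain c B where "runs c g B" "wf_com c" "pb B" by (rule fpE)
  moreover from this(1) have "runs c f B" unfolding runs_def assms(1) .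
  ultimately show ?thesis by (intro fpI)
qed

lemma fp_id: "fp (\<lambda>x :: 'a::encodable. x)"
proof (rule fpI)
  show "runs SKIP (\<lambda>x :: 'a. x) (\<lambda>_. 0)"
  proof (rule runsI)
    fix x :: 'a and s :: store and rest
    assume "s 1 = enc x @ rest"
    then have "s(1 := enc x @ rest) = s" by (auto simp: fun_eq_iff)
    then show "ex SKIP s 0 (s(1 := enc x @ rest))" using ex_skip by simp
  qed
qed (auto intro: pb_intros)

lemma fp_tree: "fp (tree_of :: 'a::encodable \<Rightarrow> tree)"
  by (rule fp_same_tree[OF _ fp_id]) (simp add: tree_of_tree_def)

lemma fp_const: "fp (\<lambda>_ :: 'a::encodable. k)"
proof (rule fpI)
  let ?c = "discard 1 ;; push_all 1 (enc k)"
  show "runs ?c (\<lambda>_ :: 'a. k) (\<lambda>x. 10 * sz x + 3 + length (enc k))"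
  proof (rule runsI)
    fix x :: 'a and s :: store and rest
    assume s: "s 3 = []" "s 4 = []" "s 1 = enc x @ rest"
    show "ex ?c s (10 * sz x + 3 + length (enc k)) (s(1 := enc k @ rest))"
      unfolding sz_def
      by (rule ex_seq_eq[OF ex_discard ex_push_all]) (use s in \<open>auto simp: fun_eq_iff\<close>)
  qed
qed (auto intro!: pb_intros)

text \<open>The argument is duplicated, and the first result waits on stack 2 while the second is
  computed; the frame condition in \<open>runs\<close> keeps it safe.\<close>

lemma fp_Nd:
  fixes f :: "'a::encodable \<Rightarrow> 'b::encodable"
  assumes f: "fp f" and g: "fp g"
    and h: "\<And>x. tree_of (h x) = Nd (tree_of (f x)) (tree_of (g x))"
  shows "fp h"
proof -
  from f obtain c1 B1 where 1: "runs c1 f B1" "wf_com c1" "pb B1" by (rule fpE)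
  from g obtain c2 B2 where 2: "runs c2 g B2" "wf_com c2" "pb B2" by (rule fpE)
  let ?c = "dup ;; c1 ;; mv 1 2 ;; c2 ;; mv 2 1 ;; PUSH 1 True"
  let ?B = "\<lambda>x. (27 * sz x + 6) + (B1 x + ((13 * sz (f x) + 3) + (B2 x + ((13 * sz (f x) + 3) + 1))))"
  have "runs ?c h ?B"
  proof (rule runsI)
    fix x :: 'a and s :: store and rest assume s: "s 3 = []" "s 4 = []" "s 1 = enc x @ rest"
    let ?s1 = "s(1 := enc x @ enc x @ rest)"
    let ?s2 = "?s1(1 := enc (f x) @ enc x @ rest)"
    let ?s3 = "?s2(1 := enc x @ rest, 2 := enc (f x) @ ?s2 2)"
    let ?s4 = "?s3(1 := enc (g x) @ rest)"
    let ?s5 = "?s4(2 := s 2, 1 := enc (f x) @ ?s4 1)"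
    have a1: "ex dup s (27 * sz x + 6) ?s1" unfolding sz_def by (rule ex_dup) (use s in auto)
    have a2: "ex c1 ?s1 (B1 x) ?s2" by (rule runsD[OF 1(1)]) (use s in auto)
    have a3: "ex (mv 1 2) ?s2 (13 * sz (f x) + 3) ?s3" unfolding sz_def by (rule ex_mv) (use s in auto)
    have a4: "ex c2 ?s3 (B2 x) ?s4" by (rule runsD[OF 2(1)]) (use s in auto)
    have a5: "ex (mv 2 1) ?s4 (13 * sz (f x) + 3) ?s5" unfolding sz_def by (rule ex_mv) (use s in auto)
    have a6: "ex (PUSH 1 True) ?s5 1 (?s5(1 := True # ?s5 1))" by (rule ex_push)
    have e: "?s5(1 := True # ?s5 1) = s(1 := enc (h x) @ rest)"
      by (auto simp: fun_eq_iff h)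
    show "ex ?c s (?B x) (s(1 := enc (h x) @ rest))"
      unfolding e[symmetric]
      by (rule ex_seq[OF a1 ex_seq[OF a2 ex_seq[OF a3 ex_seq[OF a4 ex_seq[OF a5 a6]]]]])
  qed
  moreover have "pb ?B" by (intro pb_intros 1 2 fp_sz f)
  ultimately show ?thesis by (rule fpI) (use 1 2 in auto)
qed

lemma fp_pair: "fp f \<Longrightarrow> fp g \<Longrightarrow> fp (\<lambda>x. (f x, g x))"
  by (rule fp_Nd) (auto simp: tree_of_prod_def)

lemma fp_Cons: "fp f \<Longrightarrow> fp g \<Longrightarrow> fp (\<lambda>x. f x # g x)"
  by (rule fp_Nd) auto

lemma fp_Suc: "fp f \<Longrightarrow> fp (\<lambda>x. Suc (f x))"
  by (rule fp_Nd[of "\<lambda>_. ()" f]) (auto intro: fp_const simp: tree_of_unit_def)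

definition take_left :: com where
  "take_left = POP 1 ;; mv 1 2 ;; discard 1 ;; mv 2 1"

definition take_right :: com where
  "take_right = POP 1 ;; discard 1"

lemma ex_take_left:
  assumes s: "s 3 = []" "s 4 = []" "s 1 = code (Nd l r) @ rest"
  shows "ex take_left s (40 * length (code (Nd l r)) + 10) (s(1 := code l @ rest))"
proof -
  let ?s1 = "s(1 := tl (s 1))"
  let ?s2 = "?s1(1 := code r @ rest, 2 := code l @ ?s1 2)"
  let ?s3 = "?s2(1 := rest)"
  let ?s4 = "?s3(2 := s 2, 1 := code l @ ?s3 1)"
  have a1: "ex (POP 1) s 1 ?s1" by (rule ex_pop)
  have a2: "ex (mv 1 2) ?s1 (13 * length (code l) + 3) ?s2" by (rule ex_mv) (use s in auto)
  have a3: "ex (discard 1) ?s2 (10 * length (code r) + 3) ?s3" by (rule ex_discard) (use s in auto)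
  have a4: "ex (mv 2 1) ?s3 (13 * length (code l) + 3) ?s4" by (rule ex_mv) (use s in auto)
  have e: "?s4 = s(1 := code l @ rest)" by (auto simp: fun_eq_iff)
  have "ex take_left s (1 + ((13 * length (code l) + 3) + ((10 * length (code r) + 3) + (13 * length (code l) + 3)))) ?s4"
    unfolding take_left_def by (rule ex_seq[OF a1 ex_seq[OF a2 ex_seq[OF a3 a4]]])
  then show ?thesis unfolding e by (rule ex_weaken) simp
qed

lemma ex_take_right:
  assumes s: "s 3 = []" "s 4 = []" "s 1 = code (Nd l r) @ rest"
  shows "ex take_right s (40 * length (code (Nd l r)) + 10) (s(1 := code r @ rest))"
proof -
  let ?s1 = "s(1 := tl (s 1))"
  let ?s2 = "?s1(1 := code r @ rest)"
  have a1: "ex (POP 1) s 1 ?s1" by (rule ex_pop)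
  have a2: "ex (discard 1) ?s1 (10 * length (code l) + 3) ?s2" by (rule ex_discard) (use s in auto)
  have e: "?s2 = s(1 := code r @ rest)" by (auto simp: fun_eq_iff)
  have "ex take_right s (1 + (10 * length (code l) + 3)) ?s2"
    unfolding take_right_def by (rule ex_seq[OF a1 a2])
  then show ?thesis unfolding e by (rule ex_weaken) simp
qed

lemma wf_com_take [simp]: "wf_com take_left" "wf_com take_right"
  by (auto simp: take_left_def take_right_def)

lemma fp_fst': "fp (fst :: 'a::encodable \<times> 'b::encodable \<Rightarrow> 'a)"
proof (rule fpI)
  show "runs take_left (fst :: 'a \<times> 'b \<Rightarrow> 'a) (\<lambda>x. 40 * sz x + 10)"
  proof (rule runsI)
    fix x :: "'a \<times> 'b" and s :: store and rest
    assume s: "s 3 = []" "s 4 = []" "s 1 = enc x @ rest"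
    show "ex take_left s (40 * sz x + 10) (s(1 := enc (fst x) @ rest))"
      using ex_take_left[of s "tree_of (fst x)" "tree_of (snd x)" rest] s
      by (simp add: tree_of_prod_def sz_def)
  qed
qed (auto intro!: pb_intros)

lemma fp_snd': "fp (snd :: 'a::encodable \<times> 'b::encodable \<Rightarrow> 'b)"
proof (rule fpI)
  show "runs take_right (snd :: 'a \<times> 'b \<Rightarrow> 'b) (\<lambda>x. 40 * sz x + 10)"
  proof (rule runsI)
    fix x :: "'a \<times> 'b" and s :: store and rest
    assume s: "s 3 = []" "s 4 = []" "s 1 = enc x @ rest"
    show "ex take_right s (40 * sz x + 10) (s(1 := enc (snd x) @ rest))"
      using ex_take_right[of s "tree_of (fst x)" "tree_of (snd x)" rest] s
      by (simp add: tree_of_prod_def sz_def)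
  qed
qed (auto intro!: pb_intros)

lemma fp_fst: "fp f \<Longrightarrow> fp (\<lambda>x. fst (f x))"
  by (rule fp_comp[OF fp_fst'])

lemma fp_snd: "fp f \<Longrightarrow> fp (\<lambda>x. snd (f x))"
  by (rule fp_comp[OF fp_snd'])

text \<open>The first bit of a code tells a leaf from an inner node. The inner case is stated on
  trees, so one lemma covers \<open>hd\<close>, \<open>tl\<close> and the test for a leaf.\<close>

lemma fp_case_tree:
  fixes f :: "'a::encodable \<Rightarrow> 'b::encodable"
  assumes L: "\<And>x. tree_of x = Lf \<Longrightarrow> f x = k"
    and N: "\<And>x l r. tree_of x = Nd l r \<Longrightarrow> tree_of (f x) = g l r"
    and c: "wf_com c" "\<And>s l r rest. s 3 = [] \<Longrightarrow> s 4 = [] \<Longrightarrow> s 1 = code (Nd l r) @ rest \<Longrightarrow>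
      ex c s (40 * length (code (Nd l r)) + K) (s(1 := code (g l r) @ rest))"
  shows "fp f"
proof (rule fpI)
  let ?c = "IF 1 {2} c (POP 1 ;; push_all 1 (enc k))"
  let ?B = "\<lambda>x. (40 * sz x + K + 2) + (1 + length (enc k) + 1)"
  show "runs ?c f ?B"
  proof (rule runsI)
    fix x :: 'a and s :: store and rest assume s: "s 3 = []" "s 4 = []" "s 1 = enc x @ rest"
    show "ex ?c s (?B x) (s(1 := enc (f x) @ rest))"
    proof (cases "tree_of x")
      case Lf
      have L1: "ex (POP 1 ;; push_all 1 (enc k)) s (1 + length (enc k)) (s(1 := enc (f x) @ rest))"
        by (rule ex_seq_eq[OF ex_pop ex_push_all]) (use s Lf L in \<open>auto simp: fun_eq_iff\<close>)
      show ?thesis by (rule ex_weaken[OF ex_ifF[OF _ L1]]) (use s Lf in auto)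
    next
      case (Nd l r)
      have "ex c s (40 * length (code (Nd l r)) + K) (s(1 := code (g l r) @ rest))"
        using c(2) s Nd by simp
      then show ?thesis
        unfolding N[OF Nd, symmetric]
        by (rule ex_weaken[OF ex_ifT[rotated]]) (use s Nd in \<open>auto simp: sz_def\<close>)
    qed
  qed
  show "pb ?B" by (intro pb_intros)
qed (simp add: c(1))

lemma fp_tl': "fp (tl :: 'a::encodable list \<Rightarrow> 'a list)"
proof (rule fp_case_tree[where c = take_right and g = "\<lambda>l r. r" and K = 10 and k = "[]"])
  show "tree_of x = Lf \<Longrightarrow> tl x = []" for x :: "'a list" by (cases x) auto
  show "tree_of x = Nd l r \<Longrightarrow> tree_of (tl x) = r" for x :: "'a list" and l r by (cases x) auto
qed (rule wf_com_take, rule ex_take_right)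

lemma fp_hd': "fp (hd :: 'a::encodable list \<Rightarrow> 'a)"
proof (rule fp_case_tree[where c = take_left and g = "\<lambda>l r. l" and K = 10 and k = "hd []"])
  show "tree_of x = Lf \<Longrightarrow> hd x = hd []" for x :: "'a list" by (cases x) auto
  show "tree_of x = Nd l r \<Longrightarrow> tree_of (hd x) = l" for x :: "'a list" and l r by (cases x) auto
qed (rule wf_com_take, rule ex_take_left)

definition is_Lf :: "tree \<Rightarrow> bool" where
  "is_Lf t \<longleftrightarrow> t = Lf"

lemma fp_is_Lf': "fp is_Lf"
proof (rule fp_case_tree[where c = "discard 1 ;; push_all 1 (enc False)"
      and g = "\<lambda>l r. tree_of False" and K = 20 and k = "True"])
  fix s :: store and l r rest assume s: "s 3 = []" "s 4 = []" "s 1 = code (Nd l r) @ rest"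
  have "ex (discard 1 ;; push_all 1 (enc False)) s ((10 * length (code (Nd l r)) + 3) + length (enc False))
     (s(1 := enc False @ rest))"
    by (rule ex_seq_eq[OF ex_discard ex_push_all]) (use s in \<open>auto simp: fun_eq_iff\<close>)
  then show "ex (discard 1 ;; push_all 1 (enc False)) s (40 * length (code (Nd l r)) + 20)
     (s(1 := enc False @ rest))"
    by (rule ex_weaken) (simp add: tree_of_bool_def)
qed (auto simp: is_Lf_def tree_of_tree_def)

lemma fp_tl: "fp f \<Longrightarrow> fp (\<lambda>x. tl (f x))"
  by (rule fp_comp[OF fp_tl'])

lemma fp_hd: "fp f \<Longrightarrow> fp (\<lambda>x. hd (f x))"
  by (rule fp_comp[OF fp_hd'])

lemma fp_is_Lf: "fp f \<Longrightarrow> fp (\<lambda>x. is_Lf (f x))"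
  by (rule fp_comp[OF fp_is_Lf'])

lemma fp_Nil_eq: "fp f \<Longrightarrow> fp (\<lambda>x. f x = ([] :: 'b::encodable list))"
proof -
  assume f: "fp f"
  have "fp (\<lambda>x. is_Lf (tree_of (f x)))" by (intro fp_is_Lf fp_comp[OF fp_tree f])
  moreover have "is_Lf (tree_of (f x)) \<longleftrightarrow> f x = []" for x by (cases "f x") (auto simp: is_Lf_def)
  ultimately show ?thesis by simp
qed

lemma fp_zero_eq: "fp f \<Longrightarrow> fp (\<lambda>x. f x = (0 :: nat))"
proof -
  assume f: "fp f"
  have "fp (\<lambda>x. is_Lf (tree_of (f x)))" by (intro fp_is_Lf fp_comp[OF fp_tree f])
  moreover have "is_Lf (tree_of (f x)) \<longleftrightarrow> f x = 0" for x by (cases "f x") (auto simp: is_Lf_def)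
  ultimately show ?thesis by simp
qed

lemma fp_if:
  fixes f :: "'a::encodable \<Rightarrow> 'b::encodable"
  assumes p: "fp p" and f: "fp f" and g: "fp g"
  shows "fp (\<lambda>x. if p x then f x else g x)"
proof -
  from p obtain c0 B0 where 0: "runs c0 p B0" "wf_com c0" "pb B0" by (rule fpE)
  from f obtain c1 B1 where 1: "runs c1 f B1" "wf_com c1" "pb B1" by (rule fpE)
  from g obtain c2 B2 where 2: "runs c2 g B2" "wf_com c2" "pb B2" by (rule fpE)
  \<comment> \<open>The first bit of the code of a truth value is always \<open>True\<close>; the
    second is the value itself. After the test, the four bits that are left of the code have to be
    removed.\<close>
  let ?d = "POP 1 ;; POP 1 ;; POP 1 ;; POP 1"
  let ?c = "dup ;; c0 ;; POP 1 ;; IF 1 {2} (?d ;; c1) (?d ;; c2)"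
  let ?B = "\<lambda>x. (27 * sz x + 6) + (B0 x + (1 + ((1 + (1 + (1 + 1)) + (B1 x + B2 x)) + 2)))"
  have "runs ?c (\<lambda>x. if p x then f x else g x) ?B"
  proof (rule runsI)
    fix x :: 'a and s :: store and rest assume s: "s 3 = []" "s 4 = []" "s 1 = enc x @ rest"
    let ?s1 = "s(1 := enc x @ enc x @ rest)"
    let ?s2 = "?s1(1 := enc (p x) @ enc x @ rest)"
    let ?s3 = "?s2(1 := tl (?s2 1))"
    have a1: "ex dup s (27 * sz x + 6) ?s1" unfolding sz_def by (rule ex_dup) (use s in auto)
    have a2: "ex c0 ?s1 (B0 x) ?s2" by (rule runsD[OF 0(1)]) (use s in auto)
    have a3: "ex (POP 1) ?s2 1 ?s3" by (rule ex_pop)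
    let ?t1 = "?s3(1 := tl (?s3 1))"
    let ?t2 = "?t1(1 := tl (?t1 1))"
    let ?t3 = "?t2(1 := tl (?t2 1))"
    let ?t4 = "?t3(1 := tl (?t3 1))"
    have "ex ?d ?s3 (1 + (1 + (1 + 1))) ?t4"
      by (rule ex_seq[OF ex_pop ex_seq[OF ex_pop ex_seq[OF ex_pop ex_pop]]])
    moreover have "?t4 = s"
      using s by (auto simp: fun_eq_iff tree_of_bool_def)
    ultimately have d: "ex ?d ?s3 (1 + (1 + (1 + 1))) s" by simp
    have a4: "ex (IF 1 {2} (?d ;; c1) (?d ;; c2)) ?s3 ((1 + (1 + (1 + 1)) + (B1 x + B2 x)) + 2)
      (s(1 := enc (if p x then f x else g x) @ rest))"
    proof (cases "p x")
      case True
      from ex_ifT[OF _ ex_seq[OF d runsD[OF 1(1) s]], of 1 "{2}" "?d ;; c2"] True show ?thesis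
        by (auto elim!: ex_weaken simp: tree_of_bool_def)
    next
      case False
      from ex_ifF[OF _ ex_seq[OF d runsD[OF 2(1) s]], of 1 "{2}" "?d ;; c1"] False show ?thesis
        by (auto elim!: ex_weaken simp: tree_of_bool_def)
    qed
    show "ex ?c s (?B x) (s(1 := enc (if p x then f x else g x) @ rest))"
      by (rule ex_seq[OF a1 ex_seq[OF a2 ex_seq[OF a3 a4]]])
  qed
  moreover have "pb ?B" by (intro pb_intros 0 1 2)
  ultimately show ?thesis by (rule fpI) (use 0 1 2 in auto)
qed

text \<open>Iterating a polynomial-time function can produce exponentially large values; the assumed
  bound on all iterates rules this out and hence bounds the cost of each round. The list acts as the
  loop counter and waits on stack 2.\<close>

lemma fp_iterate:
  fixes g :: "'a::encodable \<Rightarrow> 'a"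
  assumes g: "fp g" and B: "pb B"
    and bound: "\<And>(xs :: 'b::encodable list) y i. i \<le> length xs \<Longrightarrow> sz ((g ^^ i) y) \<le> B (xs, y)"
  shows "fp (\<lambda>p :: 'b list \<times> 'a. (g ^^ length (fst p)) (snd p))"
proof -
  from g obtain c0 B0 where 0: "runs c0 g B0" "wf_com c0" "pb B0" by (rule fpE)
  obtain k where k: "\<And>x. B0 x \<le> (sz x + 2) ^ k" using 0(3) unfolding pb_def by blast
  let ?body = "POP 2 ;; discard 2 ;; c0"
  let ?w = "WHILE 2 {2} ?body"
  have loop: "ex ?w s (length xs * (1 + ((10 * M + 3) + (N + 2) ^ k) + 2) + 1)
      (s(1 := enc ((g ^^ length xs) y) @ rest, 2 := False # rest2))"
    if "s 3 = []" "s 4 = []" "s 1 = enc y @ rest" "s 2 = enc xs @ rest2"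
      "\<And>i. i \<le> length xs \<Longrightarrow> sz ((g ^^ i) y) \<le> N" "sz xs \<le> M"
    for s :: store and xs :: "'b list" and y N M rest rest2
    using that
  proof (induction xs arbitrary: s y)
    case Nil
    have e: "s(1 := enc ((g ^^ length ([] :: 'b list)) y) @ rest, 2 := False # rest2) = s"
      using Nil by (auto simp: fun_eq_iff)
    have "ex ?w s 1 s" by (rule ex_whileF) (use Nil in simp)
    then show ?case unfolding e by simp
  next
    case (Cons x xs)
    let ?s1 = "s(2 := tl (s 2))"
    let ?s2 = "?s1(2 := enc xs @ rest2)"
    let ?s3 = "?s2(1 := enc (g y) @ rest)"
    have "ex (POP 2) s 1 ?s1" by (rule ex_pop)
    moreover have "ex (discard 2) ?s1 (10 * sz x + 3) ?s2" unfolding sz_def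
      by (rule ex_discard) (use Cons in auto)
    moreover have "ex c0 ?s2 (B0 y) ?s3" by (rule runsD[OF 0(1)]) (use Cons in auto)
    ultimately have b: "ex ?body s (1 + ((10 * sz x + 3) + B0 y)) ?s3" by (intro ex_seq)
    have "sz x \<le> M" using Cons.prems(6) by simp
    moreover have "B0 y \<le> (N + 2) ^ k"
    proof -
      have "B0 y \<le> (sz y + 2) ^ k" by (rule k)
      also have "\<dots> \<le> (N + 2) ^ k" using Cons.prems(5)[of 0] by (intro power_mono) auto
      finally show ?thesis .
    qed
    ultimately have b': "ex ?body s (1 + ((10 * M + 3) + (N + 2) ^ k)) ?s3"
      by (intro ex_weaken[OF b]) simp
    have w: "ex ?w ?s3 (length xs * (1 + ((10 * M + 3) + (N + 2) ^ k) + 2) + 1)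
      (?s3(1 := enc ((g ^^ length xs) (g y)) @ rest, 2 := False # rest2))"
    proof (rule Cons.IH)
      fix i assume "i \<le> length xs"
      then show "sz ((g ^^ i) (g y)) \<le> N" using Cons.prems(5)[of "Suc i"] by (simp add: funpow_swap1)
    qed (use Cons.prems in auto)
    have w2: "ex ?w s (1 + ((10 * M + 3) + (N + 2) ^ k) + (length xs * (1 + ((10 * M + 3) + (N + 2) ^ k) + 2) + 1) + 2)
        (?s3(1 := enc ((g ^^ length xs) (g y)) @ rest, 2 := False # rest2))"
      by (rule ex_whileT[OF _ b' w]) (use Cons.prems in simp)
    have e: "?s3(1 := enc ((g ^^ length xs) (g y)) @ rest, 2 := False # rest2) =
      s(1 := enc ((g ^^ length (x # xs)) y) @ rest, 2 := False # rest2)"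
      by (auto simp: fun_eq_iff funpow_swap1)
    from w2 show ?case unfolding e by (rule ex_weaken) simp
  qed
  let ?c = "POP 1 ;; mv 1 2 ;; ?w ;; POP 2"
  let ?B = "\<lambda>p :: 'b list \<times> 'a. 1 + ((13 * sz p + 3) +
     ((sz p * (1 + ((10 * sz p + 3) + (B p + 2) ^ k) + 2) + 1) + 1))"
  have "runs ?c (\<lambda>p. (g ^^ length (fst p)) (snd p)) ?B"
  proof (rule runsI)
    fix p :: "'b list \<times> 'a" and s :: store and rest
    assume s: "s 3 = []" "s 4 = []" "s 1 = enc p @ rest"
    obtain xs y where p: "p = (xs, y)" by fastforce
    have s1: "s 1 = True # enc xs @ enc y @ rest" using s p by (simp add: tree_of_prod_def)
    let ?s1 = "s(1 := tl (s 1))"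
    let ?s2 = "?s1(1 := enc y @ rest, 2 := enc xs @ ?s1 2)"
    let ?s3 = "?s2(1 := enc ((g ^^ length xs) y) @ rest, 2 := False # s 2)"
    let ?s4 = "?s3(2 := tl (?s3 2))"
    have a1: "ex (POP 1) s 1 ?s1" by (rule ex_pop)
    have a2: "ex (mv 1 2) ?s1 (13 * sz p + 3) ?s2"
      by (rule ex_weaken[OF ex_mv[of _ _ _ "tree_of xs" "enc y @ rest"]]) (use s s1 p in \<open>auto simp: sz_def tree_of_prod_def\<close>)
    have w3: "ex ?w ?s2 (length xs * (1 + ((10 * sz p + 3) + (B p + 2) ^ k) + 2) + 1) ?s3"
    proof (rule loop)
      show "sz ((g ^^ i) y) \<le> B p" if "i \<le> length xs" for i using bound[OF that] p by simp
    qed (use s p in auto)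
    have lp: "length xs \<le> sz p" using length_le_sz[of xs] p by simp
    have a3: "ex ?w ?s2 (sz p * (1 + ((10 * sz p + 3) + (B p + 2) ^ k) + 2) + 1) ?s3"
      by (rule ex_weaken[OF w3]) (intro add_right_mono mult_right_mono lp, simp)
    have a4: "ex (POP 2) ?s3 1 ?s4" by (rule ex_pop)
    have e: "?s4 = s(1 := enc ((g ^^ length (fst p)) (snd p)) @ rest)"
      by (auto simp: fun_eq_iff p)
    show "ex ?c s (?B p) (s(1 := enc ((g ^^ length (fst p)) (snd p)) @ rest))"
      unfolding e[symmetric] by (rule ex_seq[OF a1 ex_seq[OF a2 ex_seq[OF a3 a4]]])
  qed
  moreover have "pb ?B" by (intro pb_intros B)
  ultimately show ?thesis by (rule fpI) (use 0 in auto)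
qed

lemma foldl_step_iterate:
  fixes g :: "'c \<Rightarrow> 'a \<Rightarrow> 'x \<Rightarrow> 'a"
  defines "G \<equiv> \<lambda>y. (fst y, if snd (snd y) = [] then fst (snd y) else g (fst y) (fst (snd y)) (hd (snd (snd y))), tl (snd (snd y)))"
  shows "(G ^^ i) (c, a, xs) = (c, foldl (g c) a (take i xs), drop i xs)"
proof (induction i)
  case (Suc i)
  show ?case
  proof (cases "i < length xs")
    case True
    then show ?thesis using Suc
      by (simp add: G_def take_Suc_conv_app_nth hd_drop_conv_nth tl_drop drop_Suc)
  next
    case False
    then show ?thesis using Suc by (simp add: G_def)
  qed
qed simp

lemma sz_drop: "sz (drop i xs) \<le> sz xs"
proof (induction xs arbitrary: i)
  case (Cons x xs)
  show ?case
  proof (cases i)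
    case (Suc j)
    with Cons[of j] show ?thesis by simp
  qed simp
qed simp

lemma sz_elem: "x \<in> set xs \<Longrightarrow> sz x \<le> sz xs"
  by (induction xs) auto

text \<open>The growth condition is additive in the accumulator: a step may add an amount that
  depends on the parameter and the current element, but it may not, say, double the accumulator. So
  all intermediate values remain polynomial.\<close>

lemma fp_foldl:
  fixes g :: "'c::encodable \<Rightarrow> 'a::encodable \<Rightarrow> 'x::encodable \<Rightarrow> 'a"
  assumes g: "fp (\<lambda>p :: ('c \<times> 'a) \<times> 'x. g (fst (fst p)) (snd (fst p)) (snd p))"
    and K: "\<And>c a x. sz (g c a x) \<le> sz a + (sz c + sz x) ^ K + K"
    and f: "fp c" "fp a" "fp xs"
  shows "fp (\<lambda>z. foldl (g (c z)) (a z) (xs z))"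
proof -
  let ?G = "\<lambda>y :: 'c \<times> 'a \<times> 'x list. (fst y, if snd (snd y) = [] then fst (snd y)
     else g (fst y) (fst (snd y)) (hd (snd (snd y))), tl (snd (snd y)))"
  have "fp (\<lambda>y. (\<lambda>p :: ('c \<times> 'a) \<times> 'x. g (fst (fst p)) (snd (fst p)) (snd p))
     ((fst y, fst (snd y)), hd (snd (snd y :: 'a \<times> 'x list))))"
    by (rule fp_comp[OF g]) (intro fp_pair fp_fst fp_snd fp_hd fp_id)
  hence gg: "fp (\<lambda>y. g (fst y) (fst (snd y)) (hd (snd (snd y))))" by simp
  have G: "fp ?G" by (intro fp_pair fp_if gg fp_fst fp_snd fp_tl fp_id fp_Nil_eq)
  let ?B = "\<lambda>p :: 'x list \<times> 'c \<times> 'a \<times> 'x list. 2 + (sz p + (sz p + sz p * (sz p ^ K + K)) + sz p)"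
  have bound: "sz ((?G ^^ i) y) \<le> ?B (ys, y)" if "i \<le> length ys" for ys :: "'x list" and y i
  proof -
    obtain c a xs where y: "y = (c, a, xs)" by (cases y) auto
    let ?n = "sz (ys, y)"
    have fl: "sz (foldl (g c) a l) \<le> sz a + length l * (?n ^ K + K)" if "set l \<subseteq> set xs" for l
      using that
    proof (induction l rule: rev_induct)
      case (snoc x l)
      have "sz x \<le> sz xs" using snoc.prems sz_elem by auto
      hence "(sz c + sz x) ^ K \<le> ?n ^ K" by (intro power_mono) (auto simp: y)
      with K[of c "foldl (g c) a l" x] snoc show ?case by simp
    qed simp
    have "sz (foldl (g c) a (take i xs)) \<le> sz a + length (take i xs) * (?n ^ K + K)"
      by (rule fl) (rule set_take_subset)
    also have "\<dots> \<le> ?n + ?n * (?n ^ K + K)"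
    proof (intro add_mono mult_right_mono)
      have "length (take i xs) \<le> length ys" using that by simp
      also have "\<dots> \<le> ?n" using length_le_sz[of ys] by simp
      finally show "length (take i xs) \<le> ?n" .
    qed (auto simp: y)
    finally have 1: "sz (foldl (g c) a (take i xs)) \<le> ?n + ?n * (?n ^ K + K)" .
    have "sz (drop i xs) \<le> ?n" using sz_drop[of i xs] by (simp add: y)
    with 1 have "sz (c, foldl (g c) a (take i xs), drop i xs) \<le> ?B (ys, y)"
      by (simp add: y)
    then show ?thesis unfolding y foldl_step_iterate .
  qed
  have "fp (\<lambda>p :: 'x list \<times> 'c \<times> 'a \<times> 'x list. (?G ^^ length (fst p)) (snd p))"
    by (rule fp_iterate[OF G _ bound]) (intro pb_intros)
  moreover have "fp (\<lambda>z. (xs z, c z, a z, xs z))" by (intro fp_pair f)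
  ultimately have "fp (\<lambda>z. (?G ^^ length (xs z)) (c z, a z, xs z))"
    using fp_comp[of "\<lambda>p. (?G ^^ length (fst p)) (snd p)"] by fastforce
  hence "fp (\<lambda>z. fst (snd ((?G ^^ length (xs z)) (c z, a z, xs z))))" by (intro fp_fst fp_snd)
  thus ?thesis unfolding foldl_step_iterate by simp
qed

lemma fp_foldl0:
  fixes g :: "'a::encodable \<Rightarrow> 'x::encodable \<Rightarrow> 'a"
  assumes g: "fp (\<lambda>p. g (fst p) (snd p))"
    and K: "\<And>a x. sz (g a x) \<le> sz a + sz x ^ K + K"
    and f: "fp a" "fp xs"
  shows "fp (\<lambda>z. foldl g (a z) (xs z))"
proof (rule fp_foldl[where g = "\<lambda>_ :: unit. g" and K = K and c = "\<lambda>_. ()"])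
  show "fp (\<lambda>p :: (unit \<times> 'a) \<times> 'x. g (snd (fst p)) (snd p))"
    using fp_comp[OF g, of "\<lambda>p :: (unit \<times> 'a) \<times> 'x. (snd (fst p), snd p)"]
    by (simp add: fp_pair fp_fst fp_snd fp_id)
  fix c :: unit and a :: 'a and x :: 'x
  have "sz x ^ K \<le> (sz c + sz x) ^ K" by (rule power_mono) auto
  with K[of a x] show "sz (g a x) \<le> sz a + (sz c + sz x) ^ K + K" by linarith
qed (intro f fp_const)+

lemma fp_cong: assumes "fp f" "\<And>x. f x = g x" shows "fp g"
proof -
  have "f = g" using assms(2) by (rule ext)
  with assms(1) show ?thesis by simp
qed

lemma fp_comp2:
  assumes "fp (\<lambda>p. h (fst p) (snd p))" "fp f" "fp g"
  shows "fp (\<lambda>x. h (f x) (g x))"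
  using fp_comp[OF assms(1) fp_pair[OF assms(2,3)]] by simp

section \<open>A library of functions on lists, truth values and unary numbers\<close>

lemma fp_rev: assumes "fp f" shows "fp (\<lambda>x. rev (f x))"
proof -
  have "fp (\<lambda>x. foldl (\<lambda>a y. y # a) [] (f x))"
  proof (rule fp_foldl0[where K = 1 and g = "\<lambda>a y. y # a"])
    show "fp (\<lambda>p :: 'b list \<times> 'b. snd p # fst p)" by (intro fp_Cons fp_fst fp_snd fp_id)
    show "sz (x # a) \<le> sz a + sz x ^ 1 + 1" for x :: 'b and a by simp
  qed (intro assms fp_const)+
  moreover have "foldl (\<lambda>a y. y # a) [] l = rev l" for l :: "'b list"
    by (induction l rule: rev_induct) auto
  ultimately show ?thesis by simp
qed

lemma fp_append: assumes "fp f" "fp g" shows "fp (\<lambda>x. f x @ g x)"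
proof -
  have "fp (\<lambda>x. foldl (\<lambda>a y. y # a) (g x) (rev (f x)))"
  proof (rule fp_foldl0[where K = 1 and g = "\<lambda>a y. y # a"])
    show "fp (\<lambda>p :: 'b list \<times> 'b. snd p # fst p)" by (intro fp_Cons fp_fst fp_snd fp_id)
    show "sz (x # a) \<le> sz a + sz x ^ 1 + 1" for x :: 'b and a by simp
  qed (intro assms fp_const fp_rev)+
  moreover have "foldl (\<lambda>a y. y # a) r (rev l) = l @ r" for l r :: "'b list"
    by (induction l arbitrary: r) auto
  ultimately show ?thesis by simp
qed

lemma fp_concat_map:
  fixes f :: "'a::encodable \<Rightarrow> 'x::encodable \<Rightarrow> 'y::encodable list"
  assumes f: "fp (\<lambda>p. f (fst p) (snd p))" and l: "fp l"
  shows "fp (\<lambda>x. concat (map (f x) (l x)))"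
proof -
  from fp_sz[OF f] obtain k where k: "\<And>p. sz (f (fst p) (snd p)) \<le> (sz p + 2) ^ k"
    unfolding pb_def by blast
  have "fp (\<lambda>x. foldl (\<lambda>a y. a @ f x y) [] (l x))"
  proof (rule fp_foldl[where K = "3 * k" and g = "\<lambda>x a y. a @ f x y" and c = "\<lambda>x. x"])
    have "fp (\<lambda>p :: ('a \<times> 'y list) \<times> 'x. f (fst (fst p)) (snd p))"
      by (rule fp_comp2[OF f]) (intro fp_fst fp_snd fp_id)+
    then show "fp (\<lambda>p. snd (fst p) @ f (fst (fst p)) (snd p))"
      by (intro fp_append fp_fst fp_snd fp_id)
    show "sz (a @ f c x) \<le> sz a + (sz c + sz x) ^ (3 * k) + 3 * k" for c a x
    proof -
      have n: "sz c + sz x \<ge> 2" using sz_pos[of c] sz_pos[of x] by simp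
      \<comment> \<open>For s \<ge> 2 one has s + 3 \<le> s^3, which turns the bound (s + 3)^k for
        the value of \<open>f\<close> into a pure power of s. This is the origin of the exponent
        \<open>3 * k\<close>.\<close>
      have "sz c + sz x + 3 \<le> (sz c + sz x) ^ 3"
      proof -
        have "(sz c + sz x) * 4 \<le> (sz c + sz x) * ((sz c + sz x) * (sz c + sz x))"
          by (intro mult_left_mono) (use mult_mono[OF n n] in auto)
        with n show ?thesis by (simp add: power3_eq_cube)
      qed
      hence "(sz c + sz x + 3) ^ k \<le> ((sz c + sz x) ^ 3) ^ k" by (rule power_mono) simp
      also have "\<dots> = (sz c + sz x) ^ (3 * k)" by (simp add: power_mult)
      finally have "sz (f c x) \<le> (sz c + sz x) ^ (3 * k)" using k[of "(c, x)"]
        by (simp add: numeral_3_eq_3)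
      with sz_append[of a "f c x"] show ?thesis by simp
    qed
  qed (intro l fp_const fp_id)+
  moreover have "foldl (\<lambda>a y. a @ f x y) [] l = concat (map (f x) l)" for x l
    by (induction l rule: rev_induct) auto
  ultimately show ?thesis by simp
qed

lemma fp_map:
  fixes f :: "'a::encodable \<Rightarrow> 'x::encodable \<Rightarrow> 'y::encodable"
  assumes f: "fp (\<lambda>p. f (fst p) (snd p))" and l: "fp l"
  shows "fp (\<lambda>x. map (f x) (l x))"
proof -
  have "fp (\<lambda>x. concat (map (\<lambda>y. [f x y]) (l x)))"
    by (rule fp_concat_map) (intro fp_Cons f fp_const l)+
  moreover have "concat (map (\<lambda>y. [f x y]) l) = map (f x) l" for x l by (induction l) auto
  ultimately show ?thesis by simp
qed

lemma fp_concat: assumes "fp f" shows "fp (\<lambda>x. concat (f x))"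
proof -
  have "fp (\<lambda>x. concat (map (\<lambda>y. y) (f x)))"
    by (rule fp_concat_map) (intro fp_snd fp_id assms)+
  thus ?thesis by simp
qed

lemma fp_filter:
  fixes f :: "'a::encodable \<Rightarrow> 'x::encodable \<Rightarrow> bool"
  assumes f: "fp (\<lambda>p. f (fst p) (snd p))" and l: "fp l"
  shows "fp (\<lambda>x. filter (f x) (l x))"
proof -
  have "fp (\<lambda>x. concat (map (\<lambda>y. if f x y then [y] else []) (l x)))"
    by (rule fp_concat_map) (intro fp_if fp_Cons f fp_const l fp_snd fp_id)+
  moreover have "concat (map (\<lambda>y. if f x y then [y] else []) l) = filter (f x) l" for x l
    by (induction l) auto
  ultimately show ?thesis by simp
qed

lemma fp_not: "fp f \<Longrightarrow> fp (\<lambda>x. \<not> f x)"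
  by (rule fp_cong[OF fp_if[of f "\<lambda>_. False" "\<lambda>_. True"]]) (auto intro: fp_const)

lemma fp_conj: "fp f \<Longrightarrow> fp g \<Longrightarrow> fp (\<lambda>x. f x \<and> g x)"
  by (rule fp_cong[OF fp_if[of f g "\<lambda>_. False"]]) (auto intro: fp_const)

lemma fp_disj: "fp f \<Longrightarrow> fp g \<Longrightarrow> fp (\<lambda>x. f x \<or> g x)"
  by (rule fp_cong[OF fp_if[of f "\<lambda>_. True" g]]) (auto intro: fp_const)

lemma fp_bool_eq: "fp f \<Longrightarrow> fp g \<Longrightarrow> fp (\<lambda>x. f x = (g x :: bool))"
  by (rule fp_cong[OF fp_if[of f g "\<lambda>x. \<not> g x"]]) (auto intro: fp_not)

lemma fp_list_ex:
  fixes f :: "'a::encodable \<Rightarrow> 'x::encodable \<Rightarrow> bool"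
  assumes f: "fp (\<lambda>p. f (fst p) (snd p))" and l: "fp l"
  shows "fp (\<lambda>x. \<exists>y \<in> set (l x). f x y)"
proof -
  have "fp (\<lambda>x. \<not> filter (f x) (l x) = [])" by (intro fp_not fp_Nil_eq fp_filter f l)
  thus ?thesis by (simp add: filter_empty_conv)
qed

lemma fp_length: assumes "fp f" shows "fp (\<lambda>x. length (f x))"
proof -
  have "fp (\<lambda>x. foldl (\<lambda>a y. Suc a) 0 (f x))"
  proof (rule fp_foldl0[where K = 2 and g = "\<lambda>a y. Suc a"])
    show "fp (\<lambda>p :: nat \<times> 'b. Suc (fst p))" by (intro fp_Suc fp_fst fp_snd fp_id)
  qed (auto intro: assms fp_const)
  moreover have "foldl (\<lambda>a y. Suc a) n l = n + length l" for l :: "'b list" and n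
    by (induction l arbitrary: n) auto
  ultimately show ?thesis by simp
qed

lemma tree_of_replicate_unit: "tree_of (replicate n ()) = tree_of n"
  by (induction n) (auto simp: tree_of_unit_def)

text \<open>A list of units has the same tree as its length, so numbers double as lists of units and
  unary arithmetic becomes list processing.\<close>

lemma fp_replicate: assumes "fp f" "fp g" shows "fp (\<lambda>x. replicate (f x) (g x))"
proof -
  have "fp (\<lambda>x. replicate (f x) ())" using assms(1) by (rule fp_same_tree[rotated]) (rule tree_of_replicate_unit)
  hence "fp (\<lambda>x. map (\<lambda>_. g x) (replicate (f x) ()))" 
    by (intro fp_map fp_comp[OF assms(2)] fp_fst fp_id)
  thus ?thesis by simp
qed

lemma fp_add: assumes "fp f" "fp g" shows "fp (\<lambda>x. f x + g x :: nat)"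
proof -
  have "fp (\<lambda>x. length (replicate (f x) () @ replicate (g x) ()))"
    by (intro fp_length fp_append fp_replicate assms fp_const)
  thus ?thesis by simp
qed

lemma fp_mult: assumes "fp f" "fp g" shows "fp (\<lambda>x. f x * g x :: nat)"
proof -
  have "fp (\<lambda>x. length (concat (map (\<lambda>_. replicate (g x) ()) (replicate (f x) ()))))"
    by (intro fp_length fp_concat_map fp_replicate fp_comp[OF assms(2)] assms fp_const fp_fst fp_id)
  thus ?thesis by (simp add: length_concat comp_def sum_list_replicate)
qed

lemma fp_poly: assumes "fp f" shows "fp (\<lambda>x. poly (p :: nat poly) (f x))"
proof (induction p)
  case 0
  then show ?case by (simp add: fp_const)
next
  case (pCons a p)
  then show ?case by (simp, intro fp_add fp_const fp_mult assms)
qed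

lemma sz_tl: "sz (tl xs) \<le> sz xs"
  by (cases xs) auto

lemma foldl_tl: "foldl (\<lambda>a y. tl a) l ys = drop (length ys) l"
  by (induction ys arbitrary: l) (auto simp: drop_Suc)

lemma fp_drop: assumes "fp n" "fp l" shows "fp (\<lambda>x. drop (n x) (l x))"
proof -
  have "fp (\<lambda>x. foldl (\<lambda>a y. tl a) (l x) (replicate (n x) ()))"
  proof (rule fp_foldl0[where K = 1 and g = "\<lambda>a y. tl a"])
    show "fp (\<lambda>p :: 'b list \<times> unit. tl (fst p))" by (intro fp_tl fp_fst fp_snd fp_id)
    show "sz (tl a) \<le> sz a + sz x ^ 1 + 1" for a :: "'b list" and x :: unit
      using sz_tl[of a] by simp
  qed (intro assms fp_const fp_replicate)+
  thus ?thesis by (simp add: foldl_tl)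
qed

lemma fp_diff: assumes "fp f" "fp g" shows "fp (\<lambda>x. f x - g x :: nat)"
proof -
  have "fp (\<lambda>x. length (drop (g x) (replicate (f x) ())))"
    by (intro fp_length fp_drop fp_replicate assms fp_const)
  thus ?thesis by simp
qed

lemma fp_le: assumes "fp f" "fp g" shows "fp (\<lambda>x. f x \<le> (g x :: nat))"
  using fp_zero_eq[OF fp_diff[OF assms]] by simp

lemma fp_less: assumes "fp f" "fp g" shows "fp (\<lambda>x. f x < (g x :: nat))"
  using fp_not[OF fp_le[OF assms(2,1)]] by (simp add: not_le)

lemma fp_nat_eq: assumes "fp f" "fp g" shows "fp (\<lambda>x. f x = (g x :: nat))"
  using fp_conj[OF fp_le[OF assms] fp_le[OF assms(2,1)]] by (simp add: order_eq_iff)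

lemma fp_upt: assumes "fp f" shows "fp (\<lambda>x. [0..<f x])"
proof -
  \<comment> \<open>The test succeeds in every round of the actual fold. It is there for the growth
    condition of \<open>fp_foldl\<close>: it caps the size of the new element by that of the
    parameter \<open>c\<close>.\<close>
  let ?g = "\<lambda>c a (y :: unit). if length a \<le> c then length a # a else a"
  have "fp (\<lambda>x. rev (foldl (?g (f x)) [] (replicate (f x) ())))"
  proof (rule fp_rev, rule fp_foldl[where K = 1 and g = ?g])
    show "fp (\<lambda>p :: (nat \<times> nat list) \<times> unit. if length (snd (fst p)) \<le> fst (fst p)
        then length (snd (fst p)) # snd (fst p) else snd (fst p))"
      by (intro fp_if fp_le fp_Cons fp_length fp_fst fp_snd fp_id)
    show "sz (?g c a x) \<le> sz a + (sz c + sz x) ^ 1 + 1" for c a x by (simp add: sz_nat)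
  qed (intro assms fp_const fp_replicate)+
  moreover have "foldl (?g n) [] (replicate i ()) = rev [0..<i]" if "i \<le> Suc n" for i n
    using that
  proof (induction i)
    case (Suc i)
    have "replicate (Suc i) () = replicate i () @ [()]" by (simp add: replicate_append_same)
    with Suc show ?case by simp
  qed simp
  ultimately show ?thesis by simp
qed

text \<open>Outside the list the value is always \<open>hd []\<close>, one constant of the type, so
  this form of indexing is in the class for all arguments.\<close>

definition nth_hd :: "'a list \<Rightarrow> nat \<Rightarrow> 'a" where
  "nth_hd l n = hd (drop n l)"

lemma nth_hd [simp]: "n < length l \<Longrightarrow> nth_hd l n = l ! n"
  by (simp add: nth_hd_def hd_drop_conv_nth)

lemma fp_nth_hd: "fp l \<Longrightarrow> fp n \<Longrightarrow> fp (\<lambda>x. nth_hd (l x) (n x))"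
  unfolding nth_hd_def by (intro fp_hd fp_drop)

lemma fp_zip:
  assumes "fp f" "fp g"
  shows "fp (\<lambda>x. zip (f x) (g x))"
proof -
  have "fp (\<lambda>x. map (\<lambda>i. (nth_hd (f x) i, nth_hd (g x) i))
     (filter (\<lambda>i. i < length (g x)) [0..<length (f x)]))"
    by (intro fp_map fp_pair fp_nth_hd fp_filter fp_less fp_upt fp_length assms
        fp_comp[OF assms(1)] fp_comp[OF assms(2)] fp_fst fp_snd fp_id)
  moreover have "map (\<lambda>i. (nth_hd xs i, nth_hd ys i)) (filter (\<lambda>i. i < length ys) [0..<length xs]) = zip xs ys"
    for xs :: "'b list" and ys :: "'c list"
  proof -
    have "filter (\<lambda>i. i < m) [0..<n] = [0..<min n m]" for n m :: nat
    proof (induction n)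
      case (Suc n)
      then show ?case by (cases "Suc n \<le> m"; cases "n = m") (auto simp: min_def)
    qed simp
    thus ?thesis by (auto intro!: nth_equalityI)
  qed
  ultimately show ?thesis by simp
qed

lemma fp_tree_eq_const: "fp (\<lambda>t :: tree. t = k)"
proof (induction k)
  case Lf
  then show ?case using fp_is_Lf[OF fp_id] by (simp add: is_Lf_def)
next
  case (Nd l r)
  let ?p = "\<lambda>t. case t of Lf \<Rightarrow> (Lf, Lf) | Nd l r \<Rightarrow> (l, r)"
  have p: "fp ?p"
  proof (rule fp_case_tree[where k = "(Lf, Lf)" and c = SKIP and g = "\<lambda>l r. Nd l r" and K = 0])
    fix s :: store and l r rest assume "s 1 = code (Nd l r) @ rest"
    then have e: "s(1 := code (Nd l r) @ rest) = s" by (simp only: fun_upd_idem)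
    show "ex SKIP s (40 * length (code (Nd l r)) + 0) (s(1 := code (Nd l r) @ rest))"
      unfolding e by (rule ex_weaken[OF ex_skip]) simp
  qed (auto simp: tree_of_tree_def tree_of_prod_def)
  have "fp (\<lambda>t. \<not> is_Lf t \<and> fst (?p t) = l \<and> snd (?p t) = r)"
    by (intro fp_conj fp_not fp_is_Lf fp_id fp_comp[OF Nd(1)] fp_comp[OF Nd(2)] fp_fst fp_snd p)
  moreover have "(\<not> is_Lf t \<and> fst (?p t) = l \<and> snd (?p t) = r) \<longleftrightarrow> t = Nd l r" for t
    by (cases t) (auto simp: is_Lf_def)
  ultimately show ?case by simp
qed

lemma fp_eq_const: assumes "fp f" shows "fp (\<lambda>x. f x = k)"
proof -
  have "fp (\<lambda>x. tree_of (f x) = tree_of k)"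
    by (intro fp_comp[OF fp_tree_eq_const] fp_comp[OF fp_tree] assms)
  moreover have "tree_of (f x) = tree_of k \<longleftrightarrow> f x = k" for x by (auto dest: tree_of_inj)
  ultimately show ?thesis by simp
qed

text \<open>Here \<open>g\<close> may be any function whatsoever, as only its finitely many values
  on \<open>S\<close> enter the program.\<close>

lemma fp_finite_table:
  assumes "finite S"
  shows "fp (\<lambda>x. if x \<in> S then g x else h)"
  using assms
proof (induction S)
  case empty
  then show ?case by (simp add: fp_const)
next
  case (insert a S)
  have "fp (\<lambda>x. if x = a then g a else if x \<in> S then g x else h)"
    by (intro fp_if fp_eq_const fp_const fp_id insert)
  moreover have "(if x = a then g a else if x \<in> S then g x else h) =
     (if x \<in> insert a S then g x else h)" for x by auto
  ultimately show ?case by simp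
qed

subsection \<open>Simulating Turing machines\<close>

definition nth0 :: "nat list \<Rightarrow> nat \<Rightarrow> nat" where
  "nth0 l i = (if i < length l then l ! i else 0)"

definition hd0 :: "nat list \<Rightarrow> nat" where
  "hd0 l = (if l = [] then 0 else hd l)"

text \<open>A tape is split at the head; the moves \<open>0\<close>, \<open>1\<close>, \<open>-1\<close> are coded as \<open>0\<close>, \<open>1\<close>, \<open>2\<close>.\<close>

definition upd :: "nat \<times> nat \<Rightarrow> nat list \<times> nat list \<Rightarrow> nat list \<times> nat list" where
  "upd x t = (if snd x = 0 then (fst t, fst x # tl (snd t))
     else if snd x = 1 then (fst x # fst t, tl (snd t))
     else (tl (fst t), hd0 (fst t) # fst x # tl (snd t)))"

definition code_move :: "nat \<times> int \<Rightarrow> nat \<times> nat" where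
  "code_move x = (fst x, if snd x = 0 then 0 else if snd x = 1 then 1 else 2)"

type_synonym split_config = "nat \<times> (nat list \<times> nat list) list"

definition heads :: "split_config \<Rightarrow> nat \<times> nat list" where
  "heads c = (fst c, map (\<lambda>t. hd0 (snd t)) (snd c))"

definition domain :: "tm \<Rightarrow> (nat \<times> nat list) set" where
  "domain M = {(q, as). q < num_states M \<and> length as = num_tapes M \<and> set as \<subseteq> {..<num_symbols M}}"

definition ctrans :: "tm \<Rightarrow> nat \<times> nat list \<Rightarrow> nat \<times> (nat \<times> nat) list" where
  "ctrans M k = (let r = trans M (fst k) (snd k) in (fst r, map code_move (snd r)))"

text \<open>A transition function is an arbitrary function of the logic, and only its restriction to
  the finite \<open>domain\<close> can be tabulated. The empty list stands for a halted
  machine.\<close>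

definition table :: "tm \<Rightarrow> nat \<times> nat list \<Rightarrow> (nat \<times> (nat \<times> nat) list) list" where
  "table M k = (if k \<in> domain M then [ctrans M k] else [])"

definition split_step :: "tm \<Rightarrow> split_config \<Rightarrow> split_config" where
  "split_step M c = (if table M (heads c) = [] then c else
     (fst (hd (table M (heads c))),
      map (\<lambda>p. upd (fst p) (snd p)) (zip (snd (hd (table M (heads c)))) (snd c))))"

lemma finite_domain: "finite (domain M)"
proof -
  have "domain M \<subseteq> {..<num_states M} \<times> {as. set as \<subseteq> {..<num_symbols M} \<and> length as = num_tapes M}"
    by (auto simp: domain_def)
  thus ?thesis by (rule finite_subset) (auto intro: finite_lists_length_eq)
qed

lemma fp_split_step: "fp (split_step M)"
proof -
  have h0: "fp hd0" unfolding hd0_def by (intro fp_if fp_Nil_eq fp_const fp_hd fp_id)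
  have hds: "fp heads" unfolding heads_def
    by (intro fp_pair fp_fst fp_snd fp_map fp_id fp_comp[OF h0])
  have "fp (table M)" unfolding table_def by (rule fp_finite_table[OF finite_domain])
  note tb = fp_comp[OF this hds]
  have u: "fp (\<lambda>p. upd (fst p) (snd p))" unfolding upd_def
    by (intro fp_if fp_eq_const fp_snd fp_fst fp_pair fp_Cons fp_tl fp_id fp_comp[OF h0])
  show ?thesis unfolding split_step_def
    by (intro fp_if fp_Nil_eq tb fp_id fp_pair fp_fst fp_hd fp_map fp_comp2[OF u] fp_snd fp_zip)
qed

lemma sz_upd: "sz (upd x t) \<le> sz t + sz (fst x) + 3"
proof -
  obtain l r where t: "t = (l, r)" by fastforce
  have "sz (hd0 l) + sz (tl l) \<le> sz l + 1" by (cases l) (auto simp: hd0_def)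
  with sz_tl[of r] show ?thesis by (auto simp: upd_def t)
qed

text \<open>The table is finite and each move lengthens a tape by a bounded amount, so the growth
  per step is a constant of \<open>M\<close>; this meets the growth condition for folds.\<close>

lemma sz_split_step: "\<exists>K. \<forall>c. sz (split_step M c) \<le> sz c + K"
proof -
  let ?F = "(\<lambda>k. sz (ctrans M k)) ` domain M"
  define K where "K = Max (insert 0 ?F)"
  have K: "sz (ctrans M k) \<le> K" if "k \<in> domain M" for k
    unfolding K_def by (rule Max_ge) (use that finite_domain in auto)
  have z: "sz (map (\<lambda>p. upd (fst p) (snd p)) (zip acts ts)) \<le> sz ts + 4 * sz acts"
    for acts :: "(nat \<times> nat) list" and ts
  proof (induction acts arbitrary: ts)
    case Nil
    then show ?case using sz_pos[of ts] by simp
  next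
    case (Cons a acts)
    show ?case
    proof (cases ts)
      case (Cons t ts')
      obtain x y where a: "a = (x, y)" by fastforce
      from sz_upd[of a t] Cons.IH[of ts'] show ?thesis by (simp add: Cons a)
    qed simp
  qed
  have "sz (split_step M c) \<le> sz c + 5 * K" for c
  proof (cases "heads c \<in> domain M")
    case False
    then show ?thesis by (simp add: split_step_def table_def)
  next
    case True
    obtain q ts where c: "c = (q, ts)" by fastforce
    obtain q' acts where k: "ctrans M (heads c) = (q', acts)" by fastforce
    have "sz (split_step M c) = sz (q', map (\<lambda>p. upd (fst p) (snd p)) (zip acts ts))"
      using True k by (simp add: split_step_def table_def c)
    also have "\<dots> \<le> Suc (sz q' + (sz ts + 4 * sz acts))" using z[of acts ts] by simp
    also have "\<dots> \<le> sz c + 5 * K" using K[OF True] unfolding k by (simp add: c)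
    finally show ?thesis .
  qed
  thus ?thesis by blast
qed

definition split_of :: "tape \<Rightarrow> nat list \<times> nat list \<Rightarrow> bool" where
  "split_of tp t \<longleftrightarrow> (case tp of (h, c) \<Rightarrow>
     (\<forall>i. c (h + int i) = nth0 (snd t) i \<and> c (h - 1 - int i) = nth0 (fst t) i))"

lemma nth0_0: "nth0 l 0 = hd0 l"
  by (cases l) (auto simp: nth0_def hd0_def)

lemma nth0_tl: "nth0 (tl l) i = nth0 l (Suc i)"
  by (cases l) (auto simp: nth0_def)

lemma nth0_Cons: "nth0 (x # l) i = (case i of 0 \<Rightarrow> x | Suc j \<Rightarrow> nth0 l j)"
  by (cases i) (auto simp: nth0_def)

lemma split_of_head: "split_of (h, c) t \<Longrightarrow> c h = hd0 (snd t)"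
  unfolding split_of_def prod.case by (metis add.right_neutral nth0_0 of_nat_0)

lemma split_of_act:
  assumes "split_of tp t" "snd x \<in> {-1, 0, 1}"
  shows "split_of (act x tp) (upd (code_move x) t)"
proof -
  obtain h c where tp: "tp = (h, c)" by fastforce
  obtain l r where t: "t = (l, r)" by fastforce
  obtain a d where x: "x = (a, d)" by fastforce
  have R: "c (h + int i) = nth0 r i" and L: "c (h - 1 - int i) = nth0 l i" for i
    using assms(1) by (auto simp: split_of_def tp t)
  have R1: "c (h + 1 + int i) = nth0 r (Suc i)" for i using R[of "Suc i"] by (simp add: algebra_simps)
  have L1: "c (h - 1 - 1 - int i) = nth0 l (Suc i)" for i using L[of "Suc i"] by (simp add: algebra_simps)
  have L0: "c (h - 1) = hd0 l" using L[of 0] by (simp add: nth0_0)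
  consider "d = 0" | "d = 1" | "d = -1" using assms(2) x by auto
  then show ?thesis
  proof cases
    case 1
    have "(c(h := a)) (h + int i) = nth0 (a # tl r) i" for i
      using R[of i] by (cases i) (auto simp: nth0_Cons nth0_tl)
    moreover have "(c(h := a)) (h - 1 - int i) = nth0 l i" for i using L[of i] by auto
    ultimately show ?thesis using 1 by (simp add: split_of_def tp t x upd_def code_move_def)
  next
    case 2
    have "(c(h := a)) (h + 1 + int i) = nth0 (tl r) i" for i
      using R1[of i] by (auto simp: nth0_tl)
    moreover have "(c(h := a)) (h + 1 - 1 - int i) = nth0 (a # l) i" for i
    proof (cases i)
      case (Suc j)
      have e: "h + 1 - 1 - int i = h - 1 - int j" using Suc by simp
      from L[of j] show ?thesis unfolding e by (simp add: nth0_Cons Suc)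
    qed (simp add: nth0_Cons)
    ultimately show ?thesis using 2 by (simp add: split_of_def tp t x upd_def code_move_def)
  next
    case 3
    have "(c(h := a)) (h + (-1) + int i) = nth0 (hd0 l # a # tl r) i" for i
    proof (cases i)
      case 0
      with L0 show ?thesis by (simp add: nth0_Cons)
    next
      case (Suc j)
      have e: "h + (-1) + int i = h + int j" using Suc by simp
      show ?thesis unfolding e using R[of j] by (cases j) (auto simp: Suc nth0_Cons nth0_tl)
    qed
    moreover have "(c(h := a)) (h + (-1) - 1 - int i) = nth0 (tl l) i" for i
      using L1[of i] by (auto simp: nth0_tl)
    ultimately show ?thesis using 3 by (simp add: split_of_def tp t x upd_def code_move_def)
  qed
qed

definition simulates :: "tm \<Rightarrow> config \<Rightarrow> split_config \<Rightarrow> bool" where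
  "simulates M cfg c \<longleftrightarrow> fst cfg = fst c \<and> fst c \<le> num_states M \<and> length (snd cfg) = num_tapes M
     \<and> list_all2 split_of (snd cfg) (snd c)
     \<and> (\<forall>tp \<in> set (snd cfg). range (snd tp) \<subseteq> {..<num_symbols M})"

lemma simulates_step:
  assumes M: "wf_tm M" and s: "simulates M cfg c"
  shows "simulates M (tm_step M cfg) (split_step M c)"
proof -
  obtain q tps where cfg: "cfg = (q, tps)" by fastforce
  obtain ts where c: "c = (q, ts)" using s by (cases c) (auto simp: simulates_def cfg)
  have lt: "length tps = num_tapes M" "length ts = num_tapes M" and la: "list_all2 split_of tps ts"
    and rg: "\<And>tp. tp \<in> set tps \<Longrightarrow> range (snd tp) \<subseteq> {..<num_symbols M}" and qn: "q \<le> num_states M"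
    using s by (auto simp: simulates_def cfg c list_all2_lengthD)
  define as where "as = map (\<lambda>(h, c). c h) tps"
  have hds: "heads c = (q, as)"
  proof -
    have "map (\<lambda>t. hd0 (snd t)) ts = as"
      unfolding as_def
    proof (rule nth_equalityI)
      fix i assume "i < length (map (\<lambda>t. hd0 (snd t)) ts)"
      then have i: "i < length ts" by simp
      obtain h c where hc: "tps ! i = (h, c)" by fastforce
      have "split_of (h, c) (ts ! i)" using list_all2_nthD2[OF la i] hc by simp
      from split_of_head[OF this] i lt hc
      show "map (\<lambda>t. hd0 (snd t)) ts ! i = map (\<lambda>(h, c). c h) tps ! i" by simp
    qed (use lt in simp)
    thus ?thesis by (simp add: heads_def c)
  qed
  have as: "set as \<subseteq> {..<num_symbols M}" "length as = num_tapes M"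
    using rg lt by (auto simp: as_def) (metis (no_types) insertI1 insert_absorb lessThan_iff range_subsetD snd_conv)+
  show ?thesis
  proof (cases "q < num_states M")
    case False
    hence "split_step M c = c" by (simp add: split_step_def table_def hds domain_def)
    moreover have "tm_step M cfg = cfg" using False by (simp add: tm_step_def cfg)
    ultimately show ?thesis using s by simp
  next
    case True
    obtain q' acts where tr: "trans M q as = (q', acts)" by fastforce
    have w: "q' \<le> num_states M" "length acts = num_tapes M" "set acts \<subseteq> {..<num_symbols M} \<times> {-1, 0, 1}"
      using M True as tr unfolding wf_tm_def by (metis fst_conv snd_conv)+
    have 1: "tm_step M cfg = (q', map2 act acts tps)"
      using True tr by (simp add: tm_step_def cfg as_def)
    have "heads c \<in> domain M" using True as hds by (simp add: domain_def)
    hence 2: "split_step M c = (q', map (\<lambda>p. upd (fst p) (snd p)) (zip (map code_move acts) ts))"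
      using hds tr by (simp add: split_step_def table_def ctrans_def c Let_def)
    have "list_all2 split_of (map2 act acts tps) (map (\<lambda>p. upd (fst p) (snd p)) (zip (map code_move acts) ts))"
    proof (rule list_all2_all_nthI)
      fix i assume "i < length (map2 act acts tps)"
      hence i: "i < length acts" "i < length tps" "i < length ts" using lt w by auto
      have "acts ! i \<in> {..<num_symbols M} \<times> {-1, 0, 1}" using w(3) nth_mem[OF i(1)] by blast
      hence "snd (acts ! i) \<in> {-1, 0, 1}" by (cases "acts ! i") auto
      from split_of_act[OF list_all2_nthD[OF la i(2)] this] i
      show "split_of (map2 act acts tps ! i) (map (\<lambda>p. upd (fst p) (snd p)) (zip (map code_move acts) ts) ! i)"
        by simp
    qed (use lt w in simp)
    moreover have "range (snd tp) \<subseteq> {..<num_symbols M}" if "tp \<in> set (map2 act acts tps)" for tp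
    proof -
      from that obtain x tp0 where x: "tp = act x tp0" "(x, tp0) \<in> set (zip acts tps)" by auto
      have "fst x < num_symbols M" using w(3) set_zip_leftD[OF x(2)] by auto
      moreover have "range (snd tp0) \<subseteq> {..<num_symbols M}" using rg set_zip_rightD[OF x(2)] .
      ultimately show ?thesis by (cases x; cases tp0) (auto simp: x(1))
    qed
    ultimately show ?thesis using w lt by (simp add: simulates_def 1 2)
  qed
qed

definition split_init :: "tm \<Rightarrow> bool list \<Rightarrow> split_config" where
  "split_init M x = (0, ([], map bsym x) # replicate (num_tapes M - 1) ([], []))"

lemma simulates_init:
  assumes "wf_tm M"
  shows "simulates M (tm_init M x) (split_init M x)"
proof -
  have "split_of (0, string_contents x) ([], map bsym x)"
    by (auto simp: split_of_def string_contents_def nth0_def bsym_def)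
  moreover have "list_all2 split_of (replicate n (0, \<lambda>_. 0)) (replicate n ([], []))" for n
    by (rule list_all2_all_nthI) (auto simp: split_of_def nth0_def)
  moreover have "range (string_contents x) \<subseteq> {..<num_symbols M}" "0 < num_symbols M"
    using assms by (auto simp: string_contents_def wf_tm_def)
  ultimately show ?thesis using assms
    by (auto simp: simulates_def tm_init_def split_init_def wf_tm_def set_replicate_conv_if)
qed

text \<open>The split form forgets absolute positions, but an output is one contiguous block of
  nonblank cells, so deleting the blanks recovers it.\<close>

definition read_tape :: "nat list \<times> nat list \<Rightarrow> bool list" where
  "read_tape t = map (\<lambda>a. a = 2) (filter (\<lambda>a. a \<noteq> 0) (rev (fst t) @ snd t))"

lemma filter_blocks:
  assumes "\<And>i. i < n \<Longrightarrow> f (a + i) \<noteq> (0::nat)"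
    and "\<And>i. i < N \<Longrightarrow> \<not> (a \<le> i \<and> i < a + n) \<Longrightarrow> f i = 0" and "a + n \<le> N"
  shows "filter (\<lambda>x. x \<noteq> 0) (map f [0..<N]) = map (\<lambda>i. f (a + i)) [0..<n]"
proof -
  have s: "[0..<N] = [0..<a] @ [a..<a + n] @ [a + n..<N]"
    using assms(3) upt_add_eq_append[of 0 "a + n" "N - (a + n)"] upt_add_eq_append[of 0 a n] by simp
  have 1: "filter (\<lambda>x. x \<noteq> 0) (map f [0..<a]) = []" using assms(2,3) by (auto simp: filter_empty_conv)
  have 2: "filter (\<lambda>x. x \<noteq> 0) (map f [a + n..<N]) = []" using assms(2) by (auto simp: filter_empty_conv)
  have "filter (\<lambda>x. x \<noteq> 0) (map f [a..<a + n]) = map f [a..<a + n]"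
  proof (rule filter_True)
    show "\<forall>x\<in>set (map f [a..<a + n]). x \<noteq> 0"
    proof
      fix x assume "x \<in> set (map f [a..<a + n])"
      then obtain i where "a \<le> i" "i < a + n" "x = f i" by auto
      with assms(1)[of "i - a"] show "x \<noteq> 0" by simp
    qed
  qed
  also have "map f [a..<a + n] = map (\<lambda>i. f (a + i)) [0..<n]"
    by (rule nth_equalityI) auto
  finally show ?thesis unfolding s map_append filter_append 1 2 by simp
qed

lemma read_tape:
  assumes "split_of tp t" "snd tp = string_contents y"
  shows "read_tape t = y"
proof -
  obtain h c where tp: "tp = (h, c)" by fastforce
  obtain l r where t: "t = (l, r)" by fastforce
  let ?s = "string_contents y"
  have R: "?s (h + int i) = nth0 r i" and L: "?s (h - 1 - int i) = nth0 l i" for i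
    using assms by (auto simp: split_of_def tp t)
  \<comment> \<open>The position of the leftmost stored cell. Outside the stored window everything
    is blank, so the string, having no blanks, cannot stick out on either side.\<close>
  define z where "z = h - int (length l)"
  define N where "N = length l + length r"
  have e: "rev l @ r = map (\<lambda>i. ?s (z + int i)) [0..<N]"
  proof (rule nth_equalityI)
    fix i assume "i < length (rev l @ r)"
    hence i: "i < N" by (simp add: N_def)
    show "(rev l @ r) ! i = map (\<lambda>i. ?s (z + int i)) [0..<N] ! i"
    proof (cases "i < length l")
      case True
      have "z + int i = h - 1 - int (length l - 1 - i)" using True by (simp add: z_def)
      hence "?s (z + int i) = nth0 l (length l - 1 - i)" by (simp only: L)
      with True i show ?thesis
        by (simp add: nth_append rev_nth nth0_def)
    next
      case False
      have "z + int i = h + int (i - length l)" using False by (simp add: z_def)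
      hence "?s (z + int i) = nth0 r (i - length l)" by (simp only: R)
      with False i show ?thesis
        by (simp add: nth_append nth0_def N_def)
    qed
  qed (simp add: N_def)
  show ?thesis
  proof (cases "y = []")
    case True
    hence "?s i = 0" for i by (auto simp: string_contents_def)
    with True show ?thesis by (simp add: read_tape_def t e filter_empty_conv)
  next
    case False
    have nz: "?s (int i) \<noteq> 0" if "i < length y" for i using that by (simp add: string_contents_def)
    have z0: "z \<le> 0"
    proof (rule ccontr)
      assume "\<not> z \<le> 0"
      then have "h - 1 - int (nat (h - 1)) = 0" "nat (h - 1) \<ge> length l" by (auto simp: z_def)
      with L[of "nat (h - 1)"] nz[of 0] False show False by (simp add: nth0_def)
    qed
    have zN: "int (length y) \<le> z + int N"
    proof (rule ccontr)
      assume a: "\<not> int (length y) \<le> z + int N"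
      define i where "i = length y - 1"
      have i: "i < length y" "int i \<ge> z + int N" using a False by (auto simp: i_def)
      hence "h + int (nat (int i - h)) = int i" "nat (int i - h) \<ge> length r" by (auto simp: z_def N_def)
      with R[of "nat (int i - h)"] nz[OF i(1)] show False by (simp add: nth0_def)
    qed
    define a where "a = nat (- z)"
    have "filter (\<lambda>x. x \<noteq> 0) (map (\<lambda>i. ?s (z + int i)) [0..<N]) = map (\<lambda>i. ?s (z + int (a + i))) [0..<length y]"
    proof (rule filter_blocks)
      show "i < length y \<Longrightarrow> ?s (z + int (a + i)) \<noteq> 0" for i
        using nz[of i] z0 by (simp add: a_def)
      show "a + length y \<le> N" using zN z0 by (simp add: a_def)
      show "\<not> (a \<le> i \<and> i < a + length y) \<Longrightarrow> ?s (z + int i) = 0" for i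
        using z0 by (auto simp: a_def string_contents_def)
    qed
    also have "\<dots> = map bsym y"
      by (rule nth_equalityI) (use z0 in \<open>auto simp: a_def string_contents_def bsym_def\<close>)
    finally have "read_tape t = map (\<lambda>a. a = 2) (map bsym y)" by (simp add: read_tape_def t e)
    thus ?thesis by (simp add: comp_def bsym_def)
  qed
qed

definition sim :: "tm \<Rightarrow> nat \<Rightarrow> bool list \<Rightarrow> bool list" where
  "sim M t x = read_tape (nth_hd (snd ((split_step M ^^ t) (split_init M x))) 1)"

lemma sim_correct:
  assumes M: "wf_tm M" and o: "outputs_within M x t y"
  shows "sim M t x = y"
proof -
  have "simulates M ((tm_step M ^^ n) (tm_init M x)) ((split_step M ^^ n) (split_init M x))" for n
    by (induction n) (auto intro: simulates_init simulates_step M)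
  from this[of t] have s: "simulates M ((tm_step M ^^ t) (tm_init M x)) ((split_step M ^^ t) (split_init M x))" .
  obtain q tps where c: "(tm_step M ^^ t) (tm_init M x) = (q, tps)" by fastforce
  let ?ts = "snd ((split_step M ^^ t) (split_init M x))"
  have la: "list_all2 split_of tps ?ts" "1 < length tps"
    using s c M by (auto simp: simulates_def wf_tm_def)
  have "snd (tps ! 1) = string_contents y" using o c by (simp add: outputs_within_def)
  from read_tape[OF list_all2_nthD[OF la] this] la show ?thesis
    by (simp add: sim_def list_all2_lengthD[symmetric])
qed

lemma foldl_const_funpow: "foldl (\<lambda>a _. g a) a xs = (g ^^ length xs) a"
  by (induction xs arbitrary: a) (auto simp: funpow_swap1)

lemma fp_sim:
  assumes t: "fp t" and x: "fp x"
  shows "fp (\<lambda>z. sim M (t z) (x z))"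
proof -
  obtain K where K: "\<And>c. sz (split_step M c) \<le> sz c + K" using sz_split_step by blast
  have i: "fp (split_init M)" unfolding split_init_def bsym_def
    by (intro fp_pair fp_const fp_Cons fp_map fp_if fp_snd fp_id)
  have "fp (\<lambda>z. foldl (\<lambda>a (_ :: unit). split_step M a) (split_init M (x z)) (replicate (t z) ()))"
  proof (rule fp_foldl0[where K = K])
    show "fp (\<lambda>p :: split_config \<times> unit. split_step M (fst p))"
      by (intro fp_comp[OF fp_split_step] fp_fst fp_id)
    show "sz (split_step M a) \<le> sz a + sz u ^ K + K" for a and u :: unit
      using K[of a] by simp
  qed (intro fp_comp[OF i] x fp_replicate t fp_const)+
  hence st: "fp (\<lambda>z. (split_step M ^^ t z) (split_init M (x z)))"
    by (simp add: foldl_const_funpow)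
  have rt: "fp read_tape" unfolding read_tape_def
    by (intro fp_map fp_eq_const fp_filter fp_not fp_append fp_rev fp_fst fp_snd fp_id)
  show ?thesis unfolding sim_def
    by (intro fp_comp[OF rt] fp_nth_hd fp_snd st fp_const)
qed

subsection \<open>The class P and polynomial-time functions\<close>

definition load_input :: com where
  "load_input = drain 0 (PUSH 3) ;; PUSH 1 False ;; drain 3 (\<lambda>b. push_all 1 (True # enc b))"

lemma ex_load_input:
  "ex load_input ((\<lambda>_. [])(0 := x)) (17 * length x + 3) ((\<lambda>_. [])(1 := enc x))"
proof -
  let ?s = "(\<lambda>_. [])(0 := x) :: store"
  let ?s1 = "?s(0 := [], 3 := rev (?s 0) @ ?s 3)"
  let ?s2 = "?s1(1 := False # ?s1 1)"
  let ?h = "\<lambda>b (s :: store). s(1 := (True # enc b) @ s 1)"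
  let ?s3 = "(fold ?h (?s2 3) ?s2)(3 := [])"
  have a1: "ex (drain 0 (PUSH 3)) ?s (6 * length (?s 0) + 1) ?s1" by (rule ex_drain_push) simp
  have a2: "ex (PUSH 1 False) ?s1 1 ?s2" by (rule ex_push)
  have a3: "ex (drain 3 (\<lambda>b. push_all 1 (True # enc b))) ?s2 ((6 + 5) * length (?s2 3) + 1) ?s3"
  proof (rule ex_drain)
    show "ex (push_all 1 (True # enc b)) s 6 (?h b s)" for b :: bool and s :: store
      by (rule ex_weaken[OF ex_push_all]) (simp add: tree_of_bool_def)
  qed (auto simp: fun_eq_iff)
  have "fold ?h l (s(1 := enc y)) = s(1 := enc (rev l @ y))" for l y s
  proof (induction l arbitrary: y)
    case (Cons b l)
    have e: "?h b (s(1 := enc y)) = s(1 := enc (b # y))" by (auto simp: fun_eq_iff)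
    show ?case unfolding fold_simps e Cons[of "b # y"] by simp
  qed simp
  from this[of "rev x" "?s2(1 := [])" "[]"] have e: "?s3 = (\<lambda>_. [])(1 := enc x)"
    by (auto simp: fun_eq_iff)
  have "ex load_input ?s ((6 * length (?s 0) + 1) + (1 + ((6 + 5) * length (?s2 3) + 1))) ?s3"
    unfolding load_input_def by (rule ex_seq[OF a1 ex_seq[OF a2 a3]])
  then show ?thesis unfolding e by (rule ex_weaken) simp
qed

lemma sz_bools: "sz (x :: bool list) = 6 * length x + 1"
  by (induction x) auto

lemma fp_decidable:
  assumes "fp (f :: bool list \<Rightarrow> bool)"
  shows "{x. f x} \<in> class_P"
proof -
  from assms obtain c B where c: "runs c f B" "wf_com c" "pb B" by (rule fpE)
  obtain k where k: "\<And>x. B x \<le> (sz x + 2) ^ k" using c(3) unfolding pb_def by blast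
  \<comment> \<open>The raw input is rewritten as an encoded list before \<open>c\<close> runs. The
    final \<open>POP\<close> removes the leading bit of the resulting truth value and so brings the
    value bit to the top.\<close>
  let ?c = "load_input ;; c ;; POP 1"
  let ?P = "compile ?c 0"
  let ?N = "\<lambda>n. (17 * n + 3) + ((6 * n + 3) ^ k + 1)"
  have wf: "wf_com ?c" using c by (simp add: load_input_def drain_def)
  \<comment> \<open>Two machine steps per instruction and one for the output;
    \<open>6 * n + 3\<close> is the size of the encoded input plus the 2 from
    \<open>pb\<close>.\<close>
  define p :: "nat poly" where "p = [:2:] * ([:3, 17:] + ([:3, 6:] ^ k + [:1:])) + [:1:]"
  have p: "poly p n = 2 * ?N n + 1" for n by (simp add: p_def algebra_simps)
  have "outputs_within (tm_of ?P) x (poly p (length x)) [f x]" for x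
  proof -
    let ?s0 = "(\<lambda>_. [])(0 := x) :: store"
    let ?s1 = "(\<lambda>_. [])(1 := enc x) :: store"
    let ?s2 = "?s1(1 := enc (f x) @ [])"
    let ?s3 = "?s2(1 := tl (?s2 1))"
    have a1: "ex load_input ?s0 (17 * length x + 3) ?s1" by (rule ex_load_input)
    have a2: "ex c ?s1 (B x) ?s2" by (rule runsD[OF c(1)]) auto
    have a3: "ex (POP 1) ?s2 1 ?s3" by (rule ex_pop)
    have "B x \<le> (6 * length x + 3) ^ k" using k[of x] by (simp add: sz_bools numeral_3_eq_3)
    hence "ex ?c ?s0 (?N (length x)) ?s3"
      by (intro ex_weaken[OF ex_seq[OF a1 ex_seq[OF a2 a3]]]) simp
    then obtain n where n: "n \<le> ?N (length x)" "exec ?c ?s0 n ?s3" unfolding ex_def by blast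
    from compile_run[OF n(2) n(1)]
    have g: "(gstep ?P ^^ ?N (length x)) (0, ?s0) = (length ?P, ?s3)" .
    have top: "?s3 1 = f x # (if f x then [False, False, False] else [True, False, False])"
      by (simp add: tree_of_bool_def)
    show ?thesis
      by (rule tm_of_outputs[OF wf_prog_compile[OF wf] g top]) (simp add: p)
  qed
  with wf_tm_tm_of[OF wf_prog_compile[OF wf]] show ?thesis
    unfolding class_P_def by (auto intro!: exI[of _ "tm_of ?P"] exI[of _ p])
qed

lemma class_P_fp:
  assumes "L \<in> class_P"
  shows "fp (\<lambda>x. x \<in> L)"
proof -
  from assms obtain M and p :: "nat poly" where M: "wf_tm M"
    "\<And>x. outputs_within M x (poly p (length x)) [x \<in> L]"
    unfolding class_P_def by blast
  have "fp (\<lambda>x. hd (sim M (poly p (length x)) x))"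
    by (intro fp_hd fp_sim fp_poly fp_length fp_id)
  moreover have "hd (sim M (poly p (length x)) x) \<longleftrightarrow> x \<in> L" for x
    using sim_correct[OF M(1) M(2)[of x]] by simp
  ultimately show ?thesis by simp
qed

text \<open>Phase 0 expects a marker, phase 1 a bit of the first component, and phase 2 skips the
  second component.\<close>

definition unpair_step :: "(nat \<times> bool list) \<Rightarrow> bool \<Rightarrow> nat \<times> bool list" where
  "unpair_step st b = (if fst st = 0 then (if b then (1, snd st) else (2, snd st))
     else if fst st = 1 then (0, b # snd st) else st)"

definition unpair :: "bool list \<Rightarrow> bool list" where
  "unpair w = rev (snd (foldl unpair_step (0, []) w))"

lemma unpair_enc_pair: "unpair (enc_pair x y) = x"
proof -
  have 1: "foldl unpair_step (0, a) (concat (map (\<lambda>b. [True, b]) x)) = (0, rev x @ a)" for a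
    by (induction x arbitrary: a) (auto simp: unpair_step_def)
  have 2: "foldl unpair_step (2, a) y = (2, a)" for a
    by (induction y) (auto simp: unpair_step_def)
  have 3: "unpair_step (0, a) False = (2, a)" for a by (simp add: unpair_step_def)
  show ?thesis by (simp add: unpair_def enc_pair_def enc_bits_def 1 2 3)
qed

lemma fp_unpair: "fp unpair"
  unfolding unpair_def
proof (intro fp_rev fp_snd, rule fp_foldl0[where K = 6])
  show "fp (\<lambda>p. unpair_step (fst p) (snd p))" unfolding unpair_step_def
    by (intro fp_if fp_eq_const fp_fst fp_snd fp_pair fp_Cons fp_const fp_id)
  show "sz (unpair_step a x) \<le> sz a + sz x ^ 6 + 6" for a and x :: bool
    by (cases a) (auto simp: unpair_step_def sz_nat)
qed (intro fp_const fp_id)+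

text \<open>The theorem assumes only that the classes differ, so the easy inclusion has to be
  supplied. The verifier extracts the first component and decides it; the empty string is a
  certificate.\<close>

lemma class_P_subset_class_NP: "class_P \<subseteq> class_NP"
proof
  fix L assume L: "L \<in> class_P"
  let ?R = "{w. unpair w \<in> L}"
  have "?R \<in> class_P" by (intro fp_decidable fp_comp[OF class_P_fp[OF L] fp_unpair])
  moreover have "x \<in> L \<longleftrightarrow> (\<exists>y. length y \<le> poly (0 :: nat poly) (length x) \<and> enc_pair x y \<in> ?R)" for x
    by (auto simp: unpair_enc_pair)
  ultimately show "L \<in> class_NP" unfolding class_NP_def by blast
qed

lemma fp_enc_bits: "fp f \<Longrightarrow> fp (\<lambda>x. enc_bits (f x))"
  unfolding enc_bits_def by (intro fp_append fp_concat_map fp_Cons fp_const fp_snd fp_id)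

definition unpad_step :: "(bool \<times> bool list) \<Rightarrow> bool \<Rightarrow> bool \<times> bool list" where
  "unpad_step st b = (if fst st then (True, b # snd st) else (b, snd st))"

text \<open>Certificates of length at most \<open>n\<close> become strings of length exactly \<open>n + 1\<close>: append
  \<open>True\<close> and then as many \<open>False\<close> as needed.\<close>

definition unpad :: "bool list \<Rightarrow> bool list" where
  "unpad z = snd (foldl unpad_step (False, []) (rev z))"

lemma unpad_pad: "unpad (y @ True # replicate n False) = y"
proof -
  have 1: "foldl unpad_step (False, []) (replicate n False) = (False, [])"
    by (induction n) (auto simp: unpad_step_def)
  have 2: "foldl unpad_step (True, a) l = (True, rev l @ a)" for a l
    by (induction l arbitrary: a) (auto simp: unpad_step_def)
  show ?thesis by (simp add: unpad_def 1 2, simp add: unpad_step_def 2)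
qed

lemma length_unpad: "length (unpad z) \<le> length z - 1"
proof -
  have "length (snd (foldl unpad_step a l)) + (if fst a then 0 else 1) \<le> length (snd a) + length l \<or>
     (\<not> fst a \<and> length (snd (foldl unpad_step a l)) \<le> length (snd a) + (length l - 1))" for a l
  proof (induction l arbitrary: a)
    case (Cons b l)
    from Cons[of "unpad_step a b"] show ?case by (cases l) (auto simp: unpad_step_def split: if_splits)
  qed auto
  from this[of "(False, [])" "rev z"] show ?thesis unfolding unpad_def by auto
qed

lemma fp_unpad: "fp unpad"
  unfolding unpad_def
proof (intro fp_snd, rule fp_foldl0[where K = 6])
  show "fp (\<lambda>p. unpad_step (fst p) (snd p))" unfolding unpad_step_def
    by (intro fp_if fp_eq_const fp_fst fp_snd fp_pair fp_Cons fp_const fp_id)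
  show "sz (unpad_step a x) \<le> sz a + sz x ^ 6 + 6" for a and x :: bool
    by (cases a) (auto simp: unpad_step_def)
qed (intro fp_const fp_rev fp_id)+

text \<open>With certificates of one fixed length, the encoded input of the verifier has a fixed
  shape in which only the certificate bits vary. The formula is built on this shape.\<close>

lemma class_NP_fp:
  assumes "L \<in> class_NP"
  obtains V :: "bool list \<times> bool list \<Rightarrow> bool" and p :: "nat poly"
  where "fp V" "\<And>x. x \<in> L \<longleftrightarrow> (\<exists>z. length z = poly p (length x) + 1 \<and> V (x, z))"
proof -
  from assms obtain R and p :: "nat poly" where R: "R \<in> class_P"
    "\<And>x. x \<in> L \<longleftrightarrow> (\<exists>y. length y \<le> poly p (length x) \<and> enc_pair x y \<in> R)"
    unfolding class_NP_def by blast
  let ?V = "\<lambda>q. enc_pair (fst q) (unpad (snd q)) \<in> R"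
  have "fp ?V"
    unfolding enc_pair_def
    by (intro fp_comp[OF class_P_fp[OF R(1)]] fp_append fp_enc_bits fp_comp[OF fp_unpad] fp_fst fp_snd fp_id)
  moreover have "x \<in> L \<longleftrightarrow> (\<exists>z. length z = poly p (length x) + 1 \<and> ?V (x, z))" for x
  proof
    assume "x \<in> L"
    then obtain y where y: "length y \<le> poly p (length x)" "enc_pair x y \<in> R" using R(2) by blast
    let ?z = "y @ True # replicate (poly p (length x) - length y) False"
    have "length ?z = poly p (length x) + 1" "?V (x, ?z)" using y by (auto simp: unpad_pad)
    thus "\<exists>z. length z = poly p (length x) + 1 \<and> ?V (x, z)" by blast
  next
    assume "\<exists>z. length z = poly p (length x) + 1 \<and> ?V (x, z)"
    then obtain z where z: "length z = poly p (length x) + 1" "enc_pair x (unpad z) \<in> R" by auto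
    with length_unpad[of z] R(2) show "x \<in> L" by auto
  qed
  ultimately show thesis by (rule that)
qed

subsection \<open>Comparing encoded rationals\<close>

text \<open>A device of specification that is never executed: the trees of type \<open>nat\<close>
  are unary, and numerators may be exponential in the input length. All computations stay on the bit
  strings.\<close>

fun bval :: "bool list \<Rightarrow> nat" where
  "bval [] = 0"
| "bval (b # l) = of_bool b + 2 * bval l"

lemma bval_bits_of_nat [simp]: "bval (bits_of_nat n) = n"
proof (induction n rule: less_induct)
  case (less n)
  show ?case
  proof (cases "n = 0")
    case False
    hence "bval (bits_of_nat (n div 2)) = n div 2" by (intro less) simp
    with False show ?thesis by (subst bits_of_nat.simps) (auto simp: odd_two_times_div_two_succ)
  qed (simp add: bits_of_nat.simps)
qed

lemma bval_append: "bval (xs @ ys) = bval xs + 2 ^ length xs * bval ys"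
  by (induction xs) (auto simp: algebra_simps)

lemma bval_replicate_False [simp]: "bval (replicate n False) = 0"
  by (induction n) auto

text \<open>Padding each string by the length of the other yields equal lengths without computing a
  maximum; high zeros do not change the value.\<close>

definition padzip :: "bool list \<Rightarrow> bool list \<Rightarrow> (bool \<times> bool) list" where
  "padzip xs ys = zip (xs @ replicate (length ys) False) (ys @ replicate (length xs) False)"

lemma bval_padzip: "bval (map fst (padzip xs ys)) = bval xs" "bval (map snd (padzip xs ys)) = bval ys"
  by (auto simp: padzip_def bval_append)

lemma length_padzip: "length (padzip xs ys) = length xs + length ys"
  by (simp add: padzip_def)

lemma fp_padzip: "fp f \<Longrightarrow> fp g \<Longrightarrow> fp (\<lambda>x. padzip (f x) (g x))"
  unfolding padzip_def by (intro fp_zip fp_append fp_replicate fp_length fp_const)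

definition add_step :: "bool \<times> bool list \<Rightarrow> bool \<times> bool \<Rightarrow> bool \<times> bool list" where
  "add_step st p = ((fst p \<and> snd p) \<or> (fst st \<and> (fst p \<or> snd p)),
     snd st @ [(fst p = snd p) = fst st])"

definition badd :: "bool list \<Rightarrow> bool list \<Rightarrow> bool list" where
  "badd xs ys = (let r = foldl add_step (False, []) (padzip xs ys) in snd r @ [fst r])"

lemma add_step_foldl:
  "length (snd (foldl add_step (False, []) l)) = length l \<and>
   bval (snd (foldl add_step (False, []) l)) + 2 ^ length l * of_bool (fst (foldl add_step (False, []) l))
     = bval (map fst l) + bval (map snd l)"
proof (induction l rule: rev_induct)
  case (snoc p l)
  obtain c r where cr: "foldl add_step (False, []) l = (c, r)" by fastforce
  from snoc cr show ?case
    by (cases p; cases c; cases "fst p"; cases "snd p") (auto simp: add_step_def bval_append)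
qed simp

lemma bval_badd [simp]: "bval (badd xs ys) = bval xs + bval ys"
  and length_badd: "length (badd xs ys) = length xs + length ys + 1"
  using add_step_foldl[of "padzip xs ys"]
  by (auto simp: badd_def Let_def bval_append bval_padzip length_padzip mult.commute)

lemma fp_badd: "fp f \<Longrightarrow> fp g \<Longrightarrow> fp (\<lambda>x. badd (f x) (g x))"
proof -
  assume f: "fp f" "fp g"
  have "fp (\<lambda>x. foldl add_step (False, []) (padzip (f x) (g x)))"
  proof (rule fp_foldl0[where K = 6])
    show "fp (\<lambda>p. add_step (fst p) (snd p))" unfolding add_step_def
      by (intro fp_pair fp_disj fp_conj fp_append fp_Cons fp_const fp_bool_eq fp_fst fp_snd fp_id)
    show "sz (add_step a x) \<le> sz a + sz x ^ 6 + 6" for a x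
    proof -
      obtain c r u v where [simp]: "a = (c, r)" "x = (u, v)" by (cases a; cases x) blast
      have "sz (r @ [(u = v) = c]) + 1 = sz r + 7" using sz_append[of r "[(u = v) = c]"] by simp
      then show ?thesis by (simp add: add_step_def)
    qed
  qed (intro fp_const fp_padzip f)+
  then show ?thesis unfolding badd_def Let_def
    by (intro fp_append fp_snd fp_Cons fp_fst fp_const)
qed

text \<open>Horner's scheme from the most significant bit: double the accumulator, then add.\<close>

definition bmul :: "bool list \<Rightarrow> bool list \<Rightarrow> bool list" where
  "bmul xs ys = foldl (\<lambda>a b. badd (False # a) (if b then ys else [])) [] (rev xs)"

lemma bval_bmul [simp]: "bval (bmul xs ys) = bval xs * bval ys"
  by (induction xs) (auto simp: bmul_def algebra_simps)

lemma fp_bmul: "fp f \<Longrightarrow> fp g \<Longrightarrow> fp (\<lambda>x. bmul (f x) (g x))"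
proof -
  assume f: "fp f" "fp g"
  show ?thesis unfolding bmul_def
  proof (rule fp_foldl[where K = 18 and g = "\<lambda>ys a b. badd (False # a) (if b then ys else [])"])
    show "fp (\<lambda>p :: (bool list \<times> bool list) \<times> bool.
       badd (False # snd (fst p)) (if snd p then fst (fst p) else []))"
      by (intro fp_badd fp_Cons fp_const fp_if fp_fst fp_snd fp_id)
    show "sz (badd (False # a) (if b then ys else [])) \<le> sz a + (sz ys + sz b) ^ 18 + 18"
      for ys a and b :: bool
    proof -
      have "sz ys + sz b \<le> (sz ys + sz b) ^ 18" by (rule self_le_power) auto
      then show ?thesis by (auto simp: sz_bools length_badd)
    qed
  qed (intro fp_const fp_rev f)+
qed

text \<open>Going up from the least significant bit, the last position at which the strings differ
  decides.\<close>

definition blt :: "bool list \<Rightarrow> bool list \<Rightarrow> bool" where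
  "blt xs ys = foldl (\<lambda>a p. if fst p = snd p then a else snd p) False (padzip xs ys)"

lemma blt_iff: "blt xs ys \<longleftrightarrow> bval xs < bval ys"
proof -
  have bound: "bval l < 2 ^ length l" for l by (induction l) (auto simp: of_bool_def)
  have "foldl (\<lambda>a p. if fst p = snd p then a else snd p) False l \<longleftrightarrow> bval (map fst l) < bval (map snd l)"
    for l :: "(bool \<times> bool) list"
  proof (induction l rule: rev_induct)
    case (snoc p l)
    have "bval (map fst l) < 2 ^ length l" "bval (map snd l) < 2 ^ length l"
      using bound[of "map fst l"] bound[of "map snd l"] by auto
    with snoc show ?case by (cases p) (auto simp: bval_append of_bool_def)
  qed simp
  then show ?thesis by (simp add: blt_def bval_padzip)
qed

lemma fp_blt: "fp f \<Longrightarrow> fp g \<Longrightarrow> fp (\<lambda>x. blt (f x) (g x))"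
proof -
  assume f: "fp f" "fp g"
  show ?thesis unfolding blt_def
  proof (rule fp_foldl0[where K = 1])
    show "fp (\<lambda>p :: bool \<times> bool \<times> bool. if fst (snd p) = snd (snd p) then fst p else snd (snd p))"
      by (intro fp_if fp_bool_eq fp_fst fp_snd fp_id)
  qed (auto intro: fp_const fp_padzip f)
qed

type_synonym raw_rat = "bool \<times> bool list \<times> bool list"

definition raw_of :: "rat \<Rightarrow> raw_rat" where
  "raw_of r = (case quotient_of r of (a, b) \<Rightarrow> (a < 0, bits_of_nat (nat \<bar>a\<bar>), bits_of_nat (nat \<bar>b\<bar>)))"

text \<open>Cross multiplication. Denominators are positive, so the signs of the numerators decide;
  between two negative numbers the comparison of absolute values is reversed.\<close>

definition raw_less :: "raw_rat \<Rightarrow> raw_rat \<Rightarrow> bool" where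
  "raw_less r s = (if fst r then
      (if fst s then blt (bmul (fst (snd s)) (snd (snd r))) (bmul (fst (snd r)) (snd (snd s))) else True)
    else (if fst s then False else blt (bmul (fst (snd r)) (snd (snd s))) (bmul (fst (snd s)) (snd (snd r)))))"

lemma raw_less_iff: "raw_less (raw_of r) (raw_of s) \<longleftrightarrow> r < s"
proof -
  obtain a b where r: "quotient_of r = (a, b)" by fastforce
  obtain c d where s: "quotient_of s = (c, d)" by fastforce
  have b: "b > 0" and d: "d > 0" using quotient_of_denom_pos r s by blast+
  have rr: "r = of_int a / of_int b" and ss: "s = of_int c / of_int d"
    using quotient_of_div r s by blast+
  have "r < s \<longleftrightarrow> (of_int (a * d) :: rat) < of_int (c * b)" unfolding rr ss using b d
    by (simp add: field_simps)
  hence iff: "r < s \<longleftrightarrow> a * d < c * b" by (simp only: of_int_less_iff)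
  have m: "nat \<bar>x\<bar> * nat \<bar>y\<bar> = nat \<bar>x * y\<bar>" for x y :: int
    by (simp add: nat_mult_distrib abs_mult)
  have n: "nat \<bar>x\<bar> * nat \<bar>y\<bar> < nat \<bar>u\<bar> * nat \<bar>v\<bar> \<longleftrightarrow> \<bar>x * y\<bar> < \<bar>u * v\<bar>" for x y u v :: int
    unfolding m by (rule nat_less_eq_zless) simp
  have sg: "a * d < 0 \<longleftrightarrow> a < 0" "c * b < 0 \<longleftrightarrow> c < 0"
    using b d by (auto simp: mult_less_0_iff)
  have e: "raw_less (raw_of r) (raw_of s) \<longleftrightarrow> (if a < 0 then (if c < 0 then \<bar>c * b\<bar> < \<bar>a * d\<bar> else True)
     else if c < 0 then False else \<bar>a * d\<bar> < \<bar>c * b\<bar>)"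
    unfolding raw_less_def raw_of_def r s prod.case fst_conv snd_conv blt_iff bval_bmul bval_bits_of_nat n ..
  have "(if A then (if B then \<bar>Y\<bar> < \<bar>X\<bar> else True) else if B then False else \<bar>X\<bar> < \<bar>Y\<bar>) \<longleftrightarrow> X < Y"
    if "X < 0 \<longleftrightarrow> A" "Y < 0 \<longleftrightarrow> B" for X Y :: int and A B
    using that by (cases A; cases B) auto
  from this[OF sg] show ?thesis unfolding iff e .
qed

lemma fp_raw_less: "fp (\<lambda>p. raw_less (fst p) (snd p))"
  unfolding raw_less_def by (intro fp_if fp_blt fp_bmul fp_fst fp_snd fp_const fp_id)

text \<open>The parser state consists of a phase, the rationals read so far (in reverse order), and the
  parts of the current rational (bit strings in reverse order).\<close>

type_synonym pstate = "nat \<times> raw_rat list \<times> raw_rat"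

text \<open>Phases: 0 before a list item, 1 sign of the numerator, 2 and 3 marker and bit of the
  numerator, 4 sign of the denominator (always positive), 5 and 6 marker and bit of the denominator,
  7 end of the list.\<close>

definition parse_step :: "pstate \<Rightarrow> bool \<Rightarrow> pstate" where
  "parse_step st b = (let k = fst st; out = fst (snd st); cur = snd (snd st);
      sg = fst cur; num = fst (snd cur); den = snd (snd cur) in
     if k = 0 then (if b then 1 else 7, out, cur)
     else if k = 1 then (2, out, b, [], [])
     else if k = 2 then (if b then 3 else 4, out, cur)
     else if k = 3 then (2, out, sg, b # num, den)
     else if k = 4 then (5, out, cur)
     else if k = 5 then (if b then (6, out, cur) else (0, (sg, rev num, rev den) # out, False, [], []))
     else if k = 6 then (5, out, sg, num, b # den)
     else st)"

definition parse_rats :: "bool list \<Rightarrow> raw_rat list" where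
  "parse_rats w = rev (fst (snd (foldl parse_step (0, [], False, [], []) w)))"

lemma parse_rats_enc: "parse_rats (enc_list enc_rat rs) = map raw_of rs"
proof -
  have 2: "foldl parse_step (2, out, sg, num, den) (concat (map (\<lambda>b. [True, b]) x)) = (2, out, sg, rev x @ num, den)"
    for out sg num den x by (induction x arbitrary: num) (auto simp: parse_step_def)
  have 5: "foldl parse_step (5, out, sg, num, den) (concat (map (\<lambda>b. [True, b]) x)) = (5, out, sg, num, rev x @ den)"
    for out sg num den x by (induction x arbitrary: den) (auto simp: parse_step_def)
  have s: "parse_step (2, out, cur) False = (4, out, cur)" "parse_step (0, out, cur) True = (1, out, cur)"
     "parse_step (Suc 0, out, cur) b = (2, out, b, [], [])" "parse_step (4, out, cur) b = (5, out, cur)"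
     "parse_step (5, out, sg, num, den) False = (0, (sg, rev num, rev den) # out, False, [], [])"
     "parse_step (0, out, cur) False = (7, out, cur)" for out cur b sg num den
    by (auto simp: parse_step_def)
  have r: "foldl parse_step (0, out, cur) (True # enc_rat r) = (0, raw_of r # out, False, [], [])" for out cur r
  proof -
    obtain a b where q: "quotient_of r = (a, b)" by fastforce
    show ?thesis by (simp add: enc_rat_def q enc_int_def enc_nat_def enc_bits_def raw_of_def s 2 5)
  qed
  have "foldl parse_step (0, out, False, [], []) (concat (map (\<lambda>x. True # enc_rat x) rs)) =
     (0, rev (map raw_of rs) @ out, False, [], [])" for out
  proof (induction rs arbitrary: out)
    case (Cons x rs)
    have "concat (map (\<lambda>x. True # enc_rat x) (x # rs)) = (True # enc_rat x) @ concat (map (\<lambda>x. True # enc_rat x) rs)"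
      by simp
    then show ?case using Cons by (simp only: foldl_append r) simp
  qed simp
  then show ?thesis by (simp add: parse_rats_def enc_list_def s)
qed

lemma fp_parse_rats: "fp parse_rats"
  unfolding parse_rats_def
proof (intro fp_rev fp_fst fp_snd, rule fp_foldl0[where K = 30])
  show "fp (\<lambda>p. parse_step (fst p) (snd p))" unfolding parse_step_def Let_def
    by (intro fp_if fp_eq_const fp_fst fp_snd fp_pair fp_Cons fp_const fp_rev fp_id)
  show "sz (parse_step a x) \<le> sz a + sz x ^ 30 + 30" for a and x :: bool
    by (cases a) (auto simp: parse_step_def Let_def sz_nat sz_bools)
qed (intro fp_const fp_id)+

text \<open>By \<open>Taut_index\<close>, \<open>Taut u True\<close> and \<open>Taut u False\<close>
  have the positions \<open>2 * u\<close> and \<open>2 * u + 1\<close> among the trips. The bit is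
  true if the trip of the negative literal starts earlier.\<close>

definition decode_bits :: "raw_rat list \<Rightarrow> nat \<Rightarrow> bool" where
  "decode_bits rs u = raw_less (nth_hd rs (2 * u + 1)) (nth_hd rs (2 * u))"

lemma decode_bits:
  assumes "2 * u + 1 < length sol"
  shows "decode_bits (parse_rats (enc_list enc_rat sol)) u \<longleftrightarrow> sol ! (2 * u + 1) < sol ! (2 * u)"
  using assms by (simp add: decode_bits_def parse_rats_enc raw_less_iff)

lemma fp_decode_bits: "fp f \<Longrightarrow> fp g \<Longrightarrow> fp (\<lambda>x. decode_bits (f x) (g x))"
  unfolding decode_bits_def
  by (intro fp_comp2[OF fp_raw_less] fp_nth_hd fp_add fp_mult fp_const)

subsection \<open>Stack programs as Horn formulas\<close>

text \<open>An injective pairing of quadratic growth, which is harmless for unary numbers; the full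
  square saves the halving in Cantor's pairing.\<close>

definition pr :: "nat \<Rightarrow> nat \<Rightarrow> nat" where
  "pr a b = (a + b) * (a + b) + a"

lemma pr_inj [simp]: "pr a b = pr c d \<longleftrightarrow> a = c \<and> b = d"
proof
  assume e: "pr a b = pr c d"
  have le: "a + b \<le> c + d" if "pr a b = pr c d" for a b c d
  proof (rule ccontr)
    assume "\<not> a + b \<le> c + d"
    hence "Suc (c + d) * Suc (c + d) \<le> (a + b) * (a + b)" by (intro mult_mono) auto
    moreover have "(c + d) * (c + d) + c < Suc (c + d) * Suc (c + d)" by simp
    ultimately show False using that by (simp add: pr_def)
  qed
  have "a + b = c + d" using le[OF e] le[OF e[symmetric]] by simp
  with e show "a = c \<and> b = d" by (simp add: pr_def)
qed simp

lemma fp_pr: "fp f \<Longrightarrow> fp g \<Longrightarrow> fp (\<lambda>x. pr (f x) (g x))"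
  unfolding pr_def by (intro fp_add fp_mult)

text \<open>Propositional variables: bit \<open>j\<close> of the certificate; the program is at instruction \<open>q\<close> at
  time \<open>t\<close>; at time \<open>t\<close>, stack \<open>j\<close> has symbol \<open>a\<close> at depth \<open>i\<close>.\<close>

definition vY :: "nat \<Rightarrow> nat" where "vY j = pr 0 j"
definition vQ :: "nat \<Rightarrow> nat \<Rightarrow> nat" where "vQ t q = pr 1 (pr t q)"
definition vC :: "nat \<Rightarrow> nat \<Rightarrow> nat \<Rightarrow> nat \<Rightarrow> nat" where "vC t j i a = pr (2 + pr j a) (pr t i)"

lemma v_inj [simp]:
  "vY j = vY j' \<longleftrightarrow> j = j'" "vQ t q = vQ t' q' \<longleftrightarrow> t = t' \<and> q = q'"
  "vC t j i a = vC t' j' i' a' \<longleftrightarrow> t = t' \<and> j = j' \<and> i = i' \<and> a = a'"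
  "vY j \<noteq> vQ t q" "vQ t q \<noteq> vY j" "vY j \<noteq> vC t j' i a" "vC t j' i a \<noteq> vY j"
  "vQ t q \<noteq> vC t' j' i a" "vC t' j' i a \<noteq> vQ t q"
  by (auto simp: vY_def vQ_def vC_def)

lemma fp_vY: "fp f \<Longrightarrow> fp (\<lambda>x. vY (f x))"
  unfolding vY_def by (intro fp_pr fp_const)

lemma fp_vQ: "fp f \<Longrightarrow> fp g \<Longrightarrow> fp (\<lambda>x. vQ (f x) (g x))"
  unfolding vQ_def by (intro fp_pr fp_const)

lemma fp_vC: "fp f \<Longrightarrow> fp g \<Longrightarrow> fp h \<Longrightarrow> fp k \<Longrightarrow> fp (\<lambda>x. vC (f x) (g x) (h x) (k x))"
  unfolding vC_def by (intro fp_pr fp_add fp_const)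

type_synonym lit = "bool \<times> nat"

definition sat_lit :: "(nat \<Rightarrow> bool) \<Rightarrow> lit \<Rightarrow> bool" where
  "sat_lit \<sigma> l \<longleftrightarrow> \<sigma> (snd l) = fst l"

definition sat :: "(nat \<Rightarrow> bool) \<Rightarrow> lit list list \<Rightarrow> bool" where
  "sat \<sigma> F \<longleftrightarrow> (\<forall>c \<in> set F. \<exists>l \<in> set c. sat_lit \<sigma> l)"

lemma sat_append [simp]: "sat \<sigma> (F @ G) \<longleftrightarrow> sat \<sigma> F \<and> sat \<sigma> G"
  by (auto simp: sat_def)

lemma sat_concat_map: "sat \<sigma> (concat (map f l)) \<longleftrightarrow> (\<forall>x \<in> set l. sat \<sigma> (f x))"
  by (auto simp: sat_def)

lemma sat_map: "sat \<sigma> (map f l) \<longleftrightarrow> (\<forall>x \<in> set l. \<exists>y \<in> set (f x). sat_lit \<sigma> y)"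
  by (auto simp: sat_def)

lemma sat_Cons: "sat \<sigma> (c # F) \<longleftrightarrow> (\<exists>y \<in> set c. sat_lit \<sigma> y) \<and> sat \<sigma> F"
  by (auto simp: sat_def)

definition horn :: "nat list \<Rightarrow> nat \<Rightarrow> lit list" where
  "horn body h = map (\<lambda>v. (False, v)) body @ [(True, h)]"

lemma sat_horn: "(\<exists>l \<in> set (horn body h). sat_lit \<sigma> l) \<longleftrightarrow> ((\<forall>v \<in> set body. \<sigma> v) \<longrightarrow> \<sigma> h)"
  by (auto simp: horn_def sat_lit_def)

text \<open>Offsets of a cell before and after a step: a pop brings depth \<open>i + 1\<close> to
  depth \<open>i\<close>, a push brings depth \<open>i\<close> to depth
  \<open>i + 1\<close>.\<close>

definition shift :: "sop \<Rightarrow> nat \<times> nat" where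
  "shift op = (case op of Keep \<Rightarrow> (0, 0) | Drop \<Rightarrow> (1, 0) | Put b \<Rightarrow> (0, 1))"

text \<open>Of the three tables, \<open>rows1\<close> moves the program counter,
  \<open>rows2\<close> carries stack cells over to the next time, and \<open>rows3\<close> supplies
  a newly pushed symbol. The additional address \<open>length P\<close> keeps a halted configuration
  going.\<close>

definition rows1 :: "instr list \<Rightarrow> ((nat \<times> nat) \<times> (nat \<times> nat)) list" where
  "rows1 P = map (\<lambda>(q, a). ((q, fst (instr_at P q)), (a, fst (snd (instr_at P q) a))))
     (List.product [0..<Suc (length P)] [0..<3])"

definition rows3 :: "instr list \<Rightarrow> ((nat \<times> nat) \<times> (nat \<times> nat)) list" where
  "rows3 P = concat (map (\<lambda>(q, a). case snd (snd (instr_at P q) a) of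
       Put b \<Rightarrow> [((q, fst (instr_at P q)), (a, bsym b))] | _ \<Rightarrow> [])
     (List.product [0..<Suc (length P)] [0..<3]))"

definition rows2 :: "instr list \<Rightarrow> (((nat \<times> nat) \<times> nat) \<times> ((nat \<times> nat) \<times> (nat \<times> nat))) list" where
  "rows2 P = map (\<lambda>((q, a), (j, c)). (((q, fst (instr_at P q)), a), ((j, c),
       if j = fst (instr_at P q) then shift (snd (snd (instr_at P q) a)) else (0, 0))))
     (List.product (List.product [0..<Suc (length P)] [0..<3]) (List.product [0..<5] [0..<3]))"

definition clause1 :: "nat \<Rightarrow> (nat \<times> nat) \<times> (nat \<times> nat) \<Rightarrow> lit list" where
  "clause1 t w = horn [vQ t (fst (fst w)), vC t (snd (fst w)) 0 (fst (snd w))] (vQ (Suc t) (snd (snd w)))"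

definition clause3 :: "nat \<Rightarrow> (nat \<times> nat) \<times> (nat \<times> nat) \<Rightarrow> lit list" where
  "clause3 t w = horn [vQ t (fst (fst w)), vC t (snd (fst w)) 0 (fst (snd w))]
     (vC (Suc t) (snd (fst w)) 0 (snd (snd w)))"

definition clause2 :: "nat \<Rightarrow> nat \<Rightarrow> ((nat \<times> nat) \<times> nat) \<times> ((nat \<times> nat) \<times> (nat \<times> nat)) \<Rightarrow> lit list" where
  "clause2 t i w = horn [vQ t (fst (fst (fst w))), vC t (snd (fst (fst w))) 0 (snd (fst w)),
      vC t (fst (fst (snd w))) (i + fst (snd (snd w))) (snd (fst (snd w)))]
     (vC (Suc t) (fst (fst (snd w))) (i + snd (snd (snd w))) (snd (fst (snd w))))"

text \<open>A cell lists the possible symbols at an input position, each guarded by literals one of which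
  holds if the symbol is absent.\<close>

type_synonym cell = "(lit list \<times> nat) list"

definition init_cell :: "cell list \<Rightarrow> nat \<Rightarrow> cell" where
  "init_cell cells i = (if i < length cells then nth_hd cells i else [([], 0)])"

text \<open>At time 0 the depths up to \<open>T + 1\<close> are described, because each step may use
  up one cell and depth 1 is needed at time \<open>T\<close>. There stack 1 holds a truth value,
  whose value bit lies at depth 1; the last clause says that this bit is not
  \<open>False\<close>.\<close>

definition formula :: "instr list \<Rightarrow> nat \<Rightarrow> cell list \<Rightarrow> lit list list" where
  "formula P T cells =
     ([(True, vQ 0 0)] # concat (map (\<lambda>j. map (\<lambda>i. [(True, vC 0 j i 0)]) [0..<T + 2]) [0, 2, 3, 4])) @
     concat (map (\<lambda>i. map (\<lambda>x. fst x @ [(True, vC 0 1 i (snd x))]) (init_cell cells i)) [0..<T + 2]) @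
     concat (map (\<lambda>t. map (clause1 t) (rows1 P) @ map (clause3 t) (rows3 P) @
        concat (map (\<lambda>i. map (clause2 t i) (rows2 P)) [0..<T + 1])) [0..<T]) @
     [[(False, vC T 1 1 1)]]"

lemma fp_formula:
  assumes "fp T" "fp cells"
  shows "fp (\<lambda>x. formula P (T x) (cells x))"
proof -
  have 1: "fp (\<lambda>p. clause1 (fst p) (snd p))" and 3: "fp (\<lambda>p. clause3 (fst p) (snd p))"
    and 2: "fp (\<lambda>p. clause2 (fst (fst p)) (snd (fst p)) (snd p))"
    unfolding clause1_def clause2_def clause3_def horn_def
    by (intro fp_append fp_map fp_pair fp_Cons fp_vQ fp_vC fp_fst fp_snd fp_const fp_id fp_Suc fp_add)+
  have 1: "fp f \<Longrightarrow> fp g \<Longrightarrow> fp (\<lambda>x. clause1 (f x) (g x))"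
    and 3: "fp f \<Longrightarrow> fp g \<Longrightarrow> fp (\<lambda>x. clause3 (f x) (g x))" for f :: "'z::encodable \<Rightarrow> nat" and g
    using fp_comp2[OF 1] fp_comp2[OF 3] by blast+
  have 2: "fp f \<Longrightarrow> fp g \<Longrightarrow> fp h \<Longrightarrow> fp (\<lambda>x. clause2 (f x) (g x) (h x))"
    for f g :: "'z::encodable \<Rightarrow> nat" and h
    using fp_comp[OF 2, of "\<lambda>x. ((f x, g x), h x)"] by (simp add: fp_pair)
  show ?thesis unfolding formula_def init_cell_def
    by (intro fp_append fp_Cons fp_pair fp_const fp_concat_map fp_map fp_vC fp_vQ fp_snd fp_fst fp_id
       fp_upt fp_add fp_if fp_less fp_length fp_nth_hd 1 2 3 assms fp_comp[OF assms(1)] fp_comp[OF assms(2)])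
qed

definition cell_ok :: "(nat \<Rightarrow> bool) \<Rightarrow> cell \<Rightarrow> bool \<Rightarrow> bool" where
  "cell_ok \<sigma> c b \<longleftrightarrow> (\<exists>x \<in> set c. snd x = bsym b \<and> (\<forall>l \<in> set (fst x). \<not> sat_lit \<sigma> l))
     \<and> (\<forall>x \<in> set c. snd x \<noteq> bsym b \<longrightarrow> (\<exists>l \<in> set (fst x). sat_lit \<sigma> l))"

context
  fixes P :: "instr list" and s0 :: store and T :: nat and cells :: "cell list"
  assumes P: "wf_prog P"
begin

definition conf :: "nat \<Rightarrow> nat \<times> store" where
  "conf t = (gstep P ^^ t) (0, s0)"

lemma instr_at_bounds:
  assumes "q \<le> length P"
  shows "fst (instr_at P q) < 5" "fst (snd (instr_at P q) a) \<le> length P"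
  using assms wf_prog_nth[OF P, of q "fst (P ! q)" "snd (P ! q)"]
  by (auto simp: instr_at_def)

lemma conf_Suc: "conf (Suc t) = gstep P (conf t)"
  by (simp add: conf_def)

lemma conf_le: "fst (conf t) \<le> length P"
proof (induction t)
  case (Suc t)
  have "fst (conf (Suc t)) = fst (snd (instr_at P (fst (conf t)))
      (sym_at (snd (conf t) (fst (instr_at P (fst (conf t))))) 0))"
    by (auto simp: conf_Suc gstep_def split: prod.split)
  then show ?case using instr_at_bounds(2)[OF Suc] by simp
qed (simp add: conf_def)

lemma sym_at_less: "sym_at l i < 3"
  by (auto simp: sym_at_def bsym_def)

lemma step_facts:
  fixes t
  defines "q \<equiv> fst (conf t)" and "s \<equiv> snd (conf t)"
  defines "r \<equiv> fst (instr_at P q)" and "f \<equiv> snd (instr_at P q)"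
  defines "a \<equiv> sym_at (s r) 0"
  shows "r < 5" "a < 3" "q \<le> length P" "fst (conf (Suc t)) = fst (f a)"
    "snd (conf (Suc t)) = s(r := apply_sop (snd (f a)) (s r))"
proof -
  show q: "q \<le> length P" unfolding q_def by (rule conf_le)
  show "r < 5" unfolding r_def using instr_at_bounds(1)[OF q] .
  show "a < 3" unfolding a_def by (rule sym_at_less)
  show "fst (conf (Suc t)) = fst (f a)" "snd (conf (Suc t)) = s(r := apply_sop (snd (f a)) (s r))"
    by (auto simp: conf_Suc gstep_def q_def s_def r_def f_def a_def split: prod.split)
qed

text \<open>The clauses propagate along the run, so every fact of the run is forced to be true.
  Other variables may be true as well, but a rejecting run would force the variable that the last
  clause forbids.\<close>

lemma formula_sound:
  assumes sat: "sat \<sigma> (formula P T cells)"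
    and D: "list_all2 (cell_ok \<sigma>) cells (s0 1)" and E: "\<And>j. j \<noteq> 1 \<Longrightarrow> s0 j = []"
  shows "sym_at (snd (conf T) 1) 1 \<noteq> 1"
proof -
  note parts = sat[unfolded formula_def sat_append sat_Cons sat_concat_map sat_map]
  \<comment> \<open>The depth up to which facts are available shrinks by one per step, since a pop
    reads one cell deeper.\<close>
  have main: "\<sigma> (vQ t (fst (conf t))) \<and> (\<forall>j < 5. \<forall>i. i + t \<le> T + 1 \<longrightarrow> \<sigma> (vC t j i (sym_at (snd (conf t) j) i)))"
    if "t \<le> T" for t
    using that
  proof (induction t)
    case 0
    have "\<sigma> (vQ 0 0)" using parts by (simp add: sat_lit_def)
    moreover have "\<sigma> (vC 0 j i (sym_at (s0 j) i))" if "j < 5" "i \<le> T + 1" for i j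
    proof (cases "j = 1")
      case False
      hence "j \<in> set [0, 2, 3, 4]" using that by auto
      moreover have "i \<in> set [0..<T + 2]" unfolding set_upt using that by simp
      ultimately have "\<exists>y \<in> set [(True, vC 0 j i 0)]. sat_lit \<sigma> y" using parts by blast
      with False show ?thesis by (simp add: sat_lit_def E)
    next
      case True
      have cl: "\<exists>l \<in> set (fst x @ [(True, vC 0 1 i (snd x))]). sat_lit \<sigma> l" if "x \<in> set (init_cell cells i)" for x
      proof -
        have "i \<in> set [0..<T + 2]" unfolding set_upt using \<open>i \<le> T + 1\<close> by simp
        with that parts show ?thesis by blast
      qed
      have len: "length cells = length (s0 1)" using D by (rule list_all2_lengthD)
      show ?thesis
      proof (cases "i < length cells")
        case i: True
        from list_all2_nthD[OF D i] obtain x where x: "x \<in> set (cells ! i)" "snd x = bsym (s0 1 ! i)"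
          "\<forall>l \<in> set (fst x). \<not> sat_lit \<sigma> l" unfolding cell_ok_def by blast
        with cl[of x] i have "\<sigma> (vC 0 1 i (snd x))" by (auto simp: init_cell_def sat_lit_def)
        with x i len True show ?thesis by (simp add: sym_at_def)
      next
        case False
        with cl[of "([], 0)"] len True show ?thesis by (simp add: init_cell_def sat_lit_def sym_at_def)
      qed
    qed
    ultimately show ?case by (simp add: conf_def)
  next
    case (Suc t)
    define q s where "q = fst (conf t)" and "s = snd (conf t)"
    define r f where "r = fst (instr_at P q)" and "f = snd (instr_at P q)"
    define a where "a = sym_at (s r) 0"
    note st = step_facts[of t, folded q_def s_def, folded r_def f_def, folded a_def]
    have IQ: "\<sigma> (vQ t q)" and IC: "\<And>j i. j < 5 \<Longrightarrow> i + t \<le> T + 1 \<Longrightarrow> \<sigma> (vC t j i (sym_at (s j) i))"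
      using Suc by (auto simp: q_def s_def)
    have Ia: "\<sigma> (vC t r 0 a)" unfolding a_def by (rule IC) (use st Suc.prems in auto)
    have tT: "t \<in> set [0..<T]" using Suc.prems by simp
    have tr1: "\<exists>l \<in> set (clause1 t w). sat_lit \<sigma> l" if "w \<in> set (rows1 P)" for w
      using parts tT that by blast
    have tr3: "\<exists>l \<in> set (clause3 t w). sat_lit \<sigma> l" if "w \<in> set (rows3 P)" for w
      using parts tT that by blast
    have tr2: "\<exists>l \<in> set (clause2 t i w). sat_lit \<sigma> l" if "w \<in> set (rows2 P)" "i < T + 1" for w i
    proof -
      have "i \<in> set [0..<T + 1]" unfolding set_upt using that by simp
      then show ?thesis using parts tT that(1) by blast
    qed
    have "((q, r), (a, fst (f a))) \<in> set (rows1 P)"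
      using st by (force simp: rows1_def r_def f_def)
    hence "\<exists>l \<in> set (clause1 t ((q, r), (a, fst (f a)))). sat_lit \<sigma> l" by (rule tr1)
    hence Q: "\<sigma> (vQ (Suc t) (fst (f a)))" unfolding clause1_def sat_horn using IQ Ia by simp
    have C2: "\<sigma> (vC (Suc t) j (i + dd) c)"
      if j: "j < 5" and i: "i < T + 1" and c: "c < 3"
        and d: "(ds, dd) = (if j = r then shift (snd (f a)) else (0, 0))" and o: "\<sigma> (vC t j (i + ds) c)"
      for j i c ds dd
    proof -
      have "(((q, r), a), ((j, c), (ds, dd))) \<in> set (rows2 P)"
        unfolding rows2_def set_map d r_def f_def using st j c
        by (intro image_eqI[of _ _ "((q, a), (j, c))"]) auto
      hence "\<exists>l \<in> set (clause2 t i (((q, r), a), ((j, c), (ds, dd)))). sat_lit \<sigma> l" using i by (rule tr2)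
      thus ?thesis unfolding clause2_def sat_horn using IQ Ia o by simp
    qed
    have C: "\<sigma> (vC (Suc t) j i (sym_at (snd (conf (Suc t)) j) i))" if j: "j < 5" and i: "i + Suc t \<le> T + 1" for j i
    proof (cases "j = r")
      case False
      with C2[OF j, of i "sym_at (s j) i" 0 0] IC[OF j, of i] i sym_at_less st show ?thesis by simp
    next
      case True
      show ?thesis
      proof (cases "snd (f a)")
        case Keep
        with True C2[OF j, of i "sym_at (s j) i" 0 0] IC[OF j, of i] i sym_at_less st show ?thesis
          by (simp add: shift_def)
      next
        case Drop
        with True C2[OF j, of i "sym_at (s j) (Suc i)" 1 0] IC[OF j, of "Suc i"] i sym_at_less st show ?thesis
          by (simp add: shift_def sym_at_tl)
      next
        case (Put b)
        show ?thesis
        proof (cases i)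
          case 0
          have "((q, r), (a, bsym b)) \<in> set (rows3 P)"
            unfolding rows3_def set_concat set_map image_image
            by (rule UN_I[of "(q, a)"]) (use st Put in \<open>auto simp: r_def f_def\<close>)
          hence "\<exists>l \<in> set (clause3 t ((q, r), (a, bsym b))). sat_lit \<sigma> l" by (rule tr3)
          hence "\<sigma> (vC (Suc t) r 0 (bsym b))" unfolding clause3_def sat_horn using IQ Ia by simp
          with 0 True Put st show ?thesis by (simp add: sym_at_Cons)
        next
          case (Suc k)
          with True Put C2[OF j, of k "sym_at (s j) k" 0 1] IC[OF j, of k] i sym_at_less st show ?thesis
            by (simp add: shift_def sym_at_Cons)
        qed
      qed
    qed
    from Q C st show ?case by simp
  qed
  have "\<sigma> (vC T 1 1 (sym_at (snd (conf T) 1) 1))" using main[of T] by simp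
  moreover have "\<not> \<sigma> (vC T 1 1 1)" using parts by (simp add: sat_lit_def)
  ultimately show ?thesis by auto
qed

text \<open>With exactly the facts of the run true, the body of a transition clause holds only for
  the instruction and symbol actually met, and then its head describes the next
  configuration.\<close>

lemma formula_complete:
  fixes \<sigma>
  assumes sY: "\<And>t q. \<sigma> (vQ t q) \<longleftrightarrow> q = fst (conf t)"
    and sC: "\<And>t j i a. \<sigma> (vC t j i a) \<longleftrightarrow> a = sym_at (snd (conf t) j) i"
    and D: "list_all2 (cell_ok \<sigma>) cells (s0 1)" and E: "\<And>j. j \<noteq> 1 \<Longrightarrow> s0 j = []"
    and acc: "sym_at (snd (conf T) 1) 1 \<noteq> 1"
  shows "sat \<sigma> (formula P T cells)"
proof -
  have c0: "conf 0 = (0, s0)" by (simp add: conf_def)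
  have len: "length cells = length (s0 1)" using D by (rule list_all2_lengthD)
  have A: "sat \<sigma> ([(True, vQ 0 0)] # concat (map (\<lambda>j. map (\<lambda>i. [(True, vC 0 j i 0)]) [0..<T + 2]) [0, 2, 3, 4]))"
    using E by (auto simp: sat_def sat_lit_def sY sC c0)
  have B: "sat \<sigma> (concat (map (\<lambda>i. map (\<lambda>x. fst x @ [(True, vC 0 1 i (snd x))]) (init_cell cells i)) [0..<T + 2]))"
  proof -
    have "\<exists>l \<in> set (fst x @ [(True, vC 0 1 i (snd x))]). sat_lit \<sigma> l" if "x \<in> set (init_cell cells i)" for x i
    proof (cases "i < length cells")
      case True
      from list_all2_nthD[OF D True] that True
      have "snd x \<noteq> bsym (s0 1 ! i) \<longrightarrow> (\<exists>l \<in> set (fst x). sat_lit \<sigma> l)"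
        by (auto simp: cell_ok_def init_cell_def)
      moreover have "sym_at (s0 1) i = bsym (s0 1 ! i)" using True len by (simp add: sym_at_def)
      ultimately show ?thesis by (auto simp: sat_lit_def sC c0)
    next
      case False
      with that len show ?thesis by (auto simp: init_cell_def sat_lit_def sC c0 sym_at_def)
    qed
    thus ?thesis unfolding sat_concat_map sat_map by blast
  qed
  have "sat \<sigma> (map (clause1 t) (rows1 P) @ map (clause3 t) (rows3 P) @
        concat (map (\<lambda>i. map (clause2 t i) (rows2 P)) [0..<T + 1]))" for t
  proof -
    define q s where "q = fst (conf t)" and "s = snd (conf t)"
    define r f where "r = fst (instr_at P q)" and "f = snd (instr_at P q)"
    define a where "a = sym_at (s r) 0"
    note st = step_facts[of t, folded q_def s_def, folded r_def f_def, folded a_def]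
    have 1: "sat \<sigma> (map (clause1 t) (rows1 P))"
      unfolding sat_def
    proof
      fix c assume "c \<in> set (map (clause1 t) (rows1 P))"
      then obtain q' a' where c: "c = clause1 t ((q', fst (instr_at P q')), (a', fst (snd (instr_at P q') a')))"
        by (auto simp: rows1_def)
      show "\<exists>l \<in> set c. sat_lit \<sigma> l" unfolding c clause1_def sat_horn
        using st by (auto simp: sY sC q_def[symmetric] s_def[symmetric] r_def f_def a_def)
    qed
    have 3: "sat \<sigma> (map (clause3 t) (rows3 P))"
      unfolding sat_def
    proof
      fix c assume "c \<in> set (map (clause3 t) (rows3 P))"
      then obtain q' a' b where c: "c = clause3 t ((q', fst (instr_at P q')), (a', bsym b))"
        and p: "snd (snd (instr_at P q') a') = Put b"
        by (auto simp: rows3_def split: sop.splits)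
      show "\<exists>l \<in> set c. sat_lit \<sigma> l" unfolding c clause3_def sat_horn
        using st p by (auto simp: sY sC q_def[symmetric] s_def[symmetric] r_def f_def a_def sym_at_Cons)
    qed
    have 2: "sat \<sigma> (concat (map (\<lambda>i. map (clause2 t i) (rows2 P)) [0..<T + 1]))"
      unfolding sat_def
    proof
      fix c assume "c \<in> set (concat (map (\<lambda>i. map (clause2 t i) (rows2 P)) [0..<T + 1]))"
      then obtain i w where "c = clause2 t i w" "w \<in> set (rows2 P)" by auto
      then obtain q' a' j b where c0: "c = clause2 t i (((q', fst (instr_at P q')), a'), ((j, b),
          if j = fst (instr_at P q') then shift (snd (snd (instr_at P q') a')) else (0, 0)))"
        by (auto simp: rows2_def)
      obtain ds dd where d: "(if j = fst (instr_at P q') then shift (snd (snd (instr_at P q') a')) else (0, 0)) = (ds, dd)"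
        by (metis surj_pair)
      note c = c0[unfolded d]
      show "\<exists>l \<in> set c. sat_lit \<sigma> l" unfolding c clause2_def fst_conv snd_conv sat_horn
      proof
        assume h: "\<forall>v \<in> set [vQ t q', vC t (fst (instr_at P q')) 0 a', vC t j (i + ds) b]. \<sigma> v"
        from h have q': "q' = q" by (simp add: sY q_def)
        from h have a': "a' = a" by (simp add: sC q' a_def s_def r_def)
        from h have b: "b = sym_at (s j) (i + ds)" by (simp add: sC s_def)
        have "(ds, dd) = (if j = r then shift (snd (f a)) else (0, 0))" using d[symmetric] by (simp add: q' a' r_def f_def)
        hence "b = sym_at (snd (conf (Suc t)) j) (i + dd)"
          using b st by (cases "snd (f a)") (auto simp: shift_def sym_at_tl sym_at_Cons split: if_splits)
        thus "\<sigma> (vC (Suc t) j (i + dd) b)" by (simp add: sC)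
      qed
    qed
    show ?thesis using 1 2 3 by simp
  qed
  hence C: "sat \<sigma> (concat (map (\<lambda>t. map (clause1 t) (rows1 P) @ map (clause3 t) (rows3 P) @
        concat (map (\<lambda>i. map (clause2 t i) (rows2 P)) [0..<T + 1])) [0..<T]))"
    unfolding sat_concat_map[of _ _ "[0..<T]"] by blast
  have F: "sat \<sigma> [[(False, vC T 1 1 1)]]" using acc by (auto simp: sat_def sat_lit_def sC)
  show ?thesis unfolding formula_def using A B C F by (simp only: sat_append)
qed

end

definition const_cell :: "bool \<Rightarrow> cell" where
  "const_cell b = [([], if b then 2 else 1)]"

definition bit_cell :: "bool \<Rightarrow> nat \<Rightarrow> cell" where
  "bit_cell b v = [([(\<not> b, v)], 2), ([(b, v)], 1)]"

text \<open>This mirrors \<open>enc_bools\<close>: six bits per list element, the third and fourth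
  being the value and its negation. The leading \<open>True\<close> is the constructor of the
  pair.\<close>

definition input_cells :: "nat \<Rightarrow> bool list \<Rightarrow> cell list" where
  "input_cells n x = map const_cell (True # concat (map (\<lambda>b. [True, True, b, \<not> b, False, False]) x) @ [False]) @
     concat (map (\<lambda>j. [const_cell True, const_cell True, bit_cell True (vY j), bit_cell False (vY j),
       const_cell False, const_cell False]) [0..<n]) @ [const_cell False]"

lemma enc_bools: "enc (x :: bool list) = concat (map (\<lambda>b. [True, True, b, \<not> b, False, False]) x) @ [False]"
  by (induction x) (auto simp: tree_of_bool_def)

lemma cell_ok_const: "cell_ok \<sigma> (const_cell b) b"
  by (auto simp: cell_ok_def const_cell_def bsym_def)

lemma cell_ok_bit: "cell_ok \<sigma> (bit_cell c v) (\<sigma> v = c)"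
  by (auto simp: cell_ok_def bit_cell_def bsym_def sat_lit_def)

lemma input_cells_ok:
  "list_all2 (cell_ok \<sigma>) (input_cells n x) (enc (x, map (\<lambda>j. \<sigma> (vY j)) [0..<n]))"
proof -
  have c: "list_all2 (cell_ok \<sigma>) (map const_cell l) l" for l
    by (induction l) (auto simp: cell_ok_const)
  have "list_all2 (cell_ok \<sigma>) (concat (map (\<lambda>j. [const_cell True, const_cell True, bit_cell True (vY j),
      bit_cell False (vY j), const_cell False, const_cell False]) l))
     (concat (map (\<lambda>b. [True, True, b, \<not> b, False, False]) (map (\<lambda>j. \<sigma> (vY j)) l)))" for l
    using cell_ok_bit[of \<sigma> True] cell_ok_bit[of \<sigma> False] by (induction l) (auto simp: cell_ok_const)
  then show ?thesis
    unfolding input_cells_def enc_bools tree_of_prod_def code.simps fst_conv snd_conv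
    by (auto intro!: list_all2_appendI c simp: cell_ok_const)
qed

lemma fp_input_cells:
  assumes "fp n" "fp x" shows "fp (\<lambda>z. input_cells (n z) (x z))"
proof -
  have 1: "fp f \<Longrightarrow> fp (\<lambda>z. const_cell (f z))" for f :: "'z::encodable \<Rightarrow> bool"
    unfolding const_cell_def by (intro fp_Cons fp_pair fp_if fp_const)
  have 2: "fp f \<Longrightarrow> fp (\<lambda>z. bit_cell b (f z))" for f :: "'z::encodable \<Rightarrow> nat" and b
    unfolding bit_cell_def by (intro fp_Cons fp_pair fp_const)
  show ?thesis unfolding input_cells_def
    by (intro fp_append fp_map fp_Cons fp_const fp_concat_map fp_not fp_snd fp_id 1 2 fp_vY fp_upt assms)
qed

text \<open>The first property holds for any satisfying assignment and looks only at the variables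
  \<open>vY j\<close>; through it the bits extracted from a good temporalisation pass the
  verifier.\<close>

lemma cook_levin:
  fixes V :: "bool list \<times> bool list \<Rightarrow> bool" and n :: "bool list \<Rightarrow> nat"
  assumes V: "fp V" and n: "fp n"
  obtains F where "fp F"
    "\<And>x \<sigma>. sat \<sigma> (F x) \<Longrightarrow> V (x, map (\<lambda>j. \<sigma> (vY j)) [0..<n x])"
    "\<And>x z. length z = n x \<Longrightarrow> V (x, z) \<Longrightarrow> \<exists>\<sigma>. sat \<sigma> (F x)"
proof -
  from V obtain c B where c: "runs c V B" "wf_com c" "pb B" by (rule fpE)
  obtain k where k: "\<And>x. B x \<le> (sz x + 2) ^ k" using c(3) unfolding pb_def by blast
  let ?P = "compile c 0"
  define p :: "nat poly" where "p = [:2, 1:] ^ k"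
  \<comment> \<open>The argument of \<open>p\<close> is the size of the input of the verifier. It is
    the same for all certificates of length \<open>n x\<close>, so a single time bound fits them
    all.\<close>
  define T where "T x = poly p (3 + 6 * length x + 6 * n x)" for x :: "bool list"
  define F where "F x = formula ?P (T x) (input_cells (n x) x)" for x
  note P = wf_prog_compile[OF c(2)]
  have T: "B (x, z) \<le> T x" if "length z = n x" for x z
  proof -
    have e: "sz (x, z) + 2 = 2 + (3 + 6 * length x + 6 * n x)" using that by (simp add: sz_bools)
    have "T x = (2 + (3 + 6 * length x + 6 * n x)) ^ k" by (simp add: T_def p_def)
    then show ?thesis using k[of "(x, z)"] unfolding e by simp
  qed
  define s0 :: "bool list \<Rightarrow> store" where "s0 w = (\<lambda>_. [])(1 := w)" for w
  have run: "sym_at (snd (conf ?P (s0 (enc (x, z))) (T x)) 1) 1 \<noteq> 1 \<longleftrightarrow> V (x, z)" if "length z = n x" for x z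
  proof -
    have "ex c (s0 (enc (x, z))) (B (x, z)) ((s0 (enc (x, z)))(1 := enc (V (x, z)) @ []))"
      by (rule runsD[OF c(1)]) (auto simp: s0_def)
    then obtain m where m: "m \<le> B (x, z)" "exec c (s0 (enc (x, z))) m ((s0 (enc (x, z)))(1 := enc (V (x, z)) @ []))"
      unfolding ex_def by blast
    from compile_run[OF m(2) le_trans[OF m(1) T[OF that]]]
    have "snd (conf ?P (s0 (enc (x, z))) (T x)) 1 = enc (V (x, z))" by (simp add: conf_def[OF P])
    then show ?thesis by (simp add: tree_of_bool_def sym_at_def bsym_def)
  qed
  show thesis
  proof (rule that[of F])
    show "fp F" unfolding F_def T_def
      by (intro fp_formula fp_input_cells fp_poly fp_add fp_mult fp_const fp_length fp_id n)
  next
    fix x \<sigma> assume s: "sat \<sigma> (F x)"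
    let ?z = "map (\<lambda>j. \<sigma> (vY j)) [0..<n x]"
    have "sym_at (snd (conf ?P (s0 (enc (x, ?z))) (T x)) 1) 1 \<noteq> 1"
      by (rule formula_sound[OF P s[unfolded F_def]]) (auto simp: s0_def input_cells_ok)
    then show "V (x, ?z)" using run[of ?z x] by simp
  next
    fix x z assume z: "length z = n x" and v: "V (x, z)"
    let ?c = "conf ?P (s0 (enc (x, z)))"
    \<comment> \<open>The three families of variables are injective and disjoint, so each disjunct
      determines one family.\<close>
    define \<sigma> where "\<sigma> v \<longleftrightarrow> (\<exists>j. v = vY j \<and> z ! j) \<or> (\<exists>t. v = vQ t (fst (?c t)))
       \<or> (\<exists>t j i. v = vC t j i (sym_at (snd (?c t) j) i))" for v
    have s: "\<sigma> (vY j) \<longleftrightarrow> z ! j" "\<sigma> (vQ t q) \<longleftrightarrow> q = fst (?c t)"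
      "\<sigma> (vC t j i a) \<longleftrightarrow> a = sym_at (snd (?c t) j) i" for j t q i a
      by (auto simp: \<sigma>_def)
    have "map (\<lambda>j. \<sigma> (vY j)) [0..<n x] = z" by (rule nth_equalityI) (auto simp: s z)
    with input_cells_ok[of \<sigma> "n x" x] have i: "list_all2 (cell_ok \<sigma>) (input_cells (n x) x) (enc (x, z))" by simp
    have "sat \<sigma> (F x)" unfolding F_def
      by (rule formula_complete[OF P]) (use s i run[OF z] v in \<open>auto simp: s0_def\<close>)
    then show "\<exists>\<sigma>. sat \<sigma> (F x)" by blast
  qed
qed

subsection \<open>The trip network of a formula\<close>

datatype node = W nat | V nat bool nat | X nat | Z nat | E | B nat nat

datatype trip = Taut nat bool | Occ nat bool nat | Link nat bool | Enter | Skip nat | CheatEnd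
  | HonestEnd | Gate nat | Block nat nat | Jump node | Back node

text \<open>The path through \<open>W 0, \<dots>, W nv\<close> passes the variables, the next \<open>nv\<close> steps serve to read off
  the assignment (crossing them by \<open>Taut u b\<close> means that the other trip \<open>Taut u (\<not> b)\<close> was used
  before), and the last \<open>nc\<close> steps pass the clauses.  The nodes \<open>X j\<close> and \<open>Z j\<close> form the second way
  to the gates, where exactly one gate is skipped between \<open>X\<close> and \<open>Z\<close>.\<close>

locale net =
  fixes nv nc m :: nat and mem :: "nat \<Rightarrow> bool \<Rightarrow> nat \<Rightarrow> bool"
begin

text \<open>What matters is the order within a walk: \<open>Taut\<close> and \<open>Occ\<close> pass
  the reading step or the clause before the chain, and \<open>Gate\<close> opens its block before it
  serves the second way. The edges in between only join these parts into a walk. A literal absent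
  from a clause keeps the bare chain edge, so all chains have length \<open>nc\<close>.
  \<open>Jump\<close> and \<open>Back\<close> serve strong temporalisability.\<close>

fun walk :: "trip \<Rightarrow> (node \<times> node) list" where
  "walk (Taut u b) = [(W (nv + u), W (nv + u + 1)), (W (nv + u + 1), W u), (W u, V u b 0)]"
| "walk (Occ u b i) = (if mem i b u then [(W (2 * nv + i), W (2 * nv + i + 1)), (W (2 * nv + i + 1), V u b i)] else [])
     @ [(V u b i, V u b (i + 1))]"
| "walk (Link u b) = [(V u b nc, W (u + 1))]"
| "walk Enter = [(W 0, X 0)]"
| "walk (Skip j) = [(X j, Z (j + 1))]"
| "walk CheatEnd = [(Z m, E)]"
| "walk HonestEnd = [(W (2 * nv + nc), E)]"
| "walk (Gate j) = [(E, B j 0), (B j 0, X j), (X j, X (j + 1)), (X (j + 1), Z j), (Z j, Z (j + 1))]"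
| "walk (Block j k) = [(B j 0, B j (k + 1))]"
| "walk (Jump x) = [(E, x)]"
| "walk (Back x) = [(x, W 0)]"

definition lits :: "(nat \<times> bool) list" where
  "lits = List.product [0..<nv] [True, False]"

definition gadgets :: "node list" where
  "gadgets = map W [0..<2 * nv + nc + 1] @ map (\<lambda>p. V (fst (fst p)) (snd (fst p)) (snd p)) (List.product lits [0..<nc + 1])
     @ map X [0..<m + 1] @ map Z [0..<m + 1]"

definition all_nodes :: "node list" where
  "all_nodes = gadgets @ E # map (\<lambda>p. B (fst p) (snd p)) (List.product [0..<m] [0..<m + 1])"

text \<open>The \<open>Taut\<close> trips come first, two per variable, so that the decoder finds
  their starting times at positions independent of the clauses.\<close>

definition tags :: "trip list" where
  "tags = map (\<lambda>p. Taut (fst p) (snd p)) lits @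
     map (\<lambda>p. Occ (fst (fst p)) (snd (fst p)) (snd p)) (List.product lits [0..<nc]) @
     map (\<lambda>p. Link (fst p) (snd p)) lits @ [Enter, CheatEnd, HonestEnd] @
     map Skip [0..<m] @ map Gate [0..<m] @
     map (\<lambda>p. Block (fst p) (snd p)) (List.product [0..<m] [0..<m]) @
     map Jump gadgets @ map Back all_nodes"

lemma set_lits: "set lits = {(u, b). u < nv}"
  by (auto simp: lits_def)

lemma set_gadgets: "set gadgets = {W j | j. j \<le> 2 * nv + nc} \<union> {V u b i | u b i. u < nv \<and> i \<le> nc}
    \<union> {X j | j. j \<le> m} \<union> {Z j | j. j \<le> m}"
  by (auto simp: gadgets_def set_lits image_iff less_Suc_eq_le simp del: upt_Suc) 

lemma set_all_nodes: "set all_nodes = set gadgets \<union> {E} \<union> {B j k | j k. j < m \<and> k \<le> m}"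
  by (auto simp: all_nodes_def image_iff less_Suc_eq_le simp del: upt_Suc)

lemma tags_iff:
  "g \<in> set tags \<longleftrightarrow> (case g of Taut u b \<Rightarrow> u < nv | Occ u b i \<Rightarrow> u < nv \<and> i < nc | Link u b \<Rightarrow> u < nv
     | Enter \<Rightarrow> True | Skip j \<Rightarrow> j < m | CheatEnd \<Rightarrow> True | HonestEnd \<Rightarrow> True | Gate j \<Rightarrow> j < m
     | Block j k \<Rightarrow> j < m \<and> k < m | Jump x \<Rightarrow> x \<in> set gadgets | Back x \<Rightarrow> x \<in> set all_nodes)"
  by (cases g) (auto simp: tags_def set_lits image_iff)

lemma distinct_gadgets: "distinct gadgets"
proof -
  have "inj_on (\<lambda>p :: (nat \<times> bool) \<times> nat. V (fst (fst p)) (snd (fst p)) (snd p)) A" for A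
    by (auto simp: inj_on_def prod_eq_iff)
  moreover have "distinct lits" unfolding lits_def by (rule distinct_product) auto
  ultimately show ?thesis unfolding gadgets_def
    by (auto simp del: upt_Suc simp add: distinct_map inj_on_def distinct_product)
qed

lemma distinct_all_nodes: "distinct all_nodes"
proof -
  have "inj_on (\<lambda>p :: nat \<times> nat. B (fst p) (snd p)) A" for A
    by (auto simp: inj_on_def prod_eq_iff)
  then show ?thesis unfolding all_nodes_def using distinct_gadgets
    by (auto simp del: upt_Suc simp add: distinct_map distinct_product set_gadgets)
qed

lemma distinct_tags: "distinct tags"
proof -
  have "inj_on (\<lambda>p. Taut (fst p) (snd p)) A" "inj_on (\<lambda>p. Link (fst p) (snd p)) A"
    "inj_on (\<lambda>p. Occ (fst (fst p)) (snd (fst p)) (snd p)) A'" "inj_on (\<lambda>p. Block (fst p) (snd p)) A''"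
    "inj_on Skip S" "inj_on Gate S" "inj_on Jump S'" "inj_on Back S'" for A A' A'' S S'
    by (auto simp: inj_on_def prod_eq_iff)
  moreover have "distinct lits" unfolding lits_def by (rule distinct_product) auto
  ultimately show ?thesis unfolding tags_def
    by (auto simp del: upt_Suc simp add: distinct_map distinct_product distinct_gadgets distinct_all_nodes)
qed

lemma Taut_index: "u < nv \<Longrightarrow> tags ! (2 * u) = Taut u True" "u < nv \<Longrightarrow> tags ! (2 * u + 1) = Taut u False"
  "2 * nv \<le> length tags"
proof -
  have l: "length lits = 2 * nv" by (simp add: lits_def)
  then show "2 * nv \<le> length tags" by (simp add: tags_def)
  assume u: "u < nv"
  have two: "length [True, False] = 2" by simp
  have "lits ! (2 * u) = (u, True)" "lits ! (2 * u + 1) = (u, False)"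
    using u product_nth[of "2 * u" "[0..<nv]" "[True, False]", unfolded two]
      product_nth[of "2 * u + 1" "[0..<nv]" "[True, False]", unfolded two]
    by (auto simp: lits_def)
  with u l show "tags ! (2 * u) = Taut u True" "tags ! (2 * u + 1) = Taut u False"
    by (auto simp: tags_def nth_append)
qed

end

section \<open>Invariants that hold under every temporalisation\<close>

locale timed_net = net +
  fixes \<theta> :: "trip \<Rightarrow> real" and src :: node
begin

text \<open>With waiting as a rule of its own, the predicate is monotone in the time, and an
  invariant that is monotone has to be checked for single rides only. All weights are 1, hence the
  arrival one unit after departure.\<close>

inductive arr :: "node \<Rightarrow> real \<Rightarrow> bool" where
  start: "arr src t"
| wait: "arr v t \<Longrightarrow> t \<le> t' \<Longrightarrow> arr v t'"
| ride: "arr u t \<Longrightarrow> g \<in> set tags \<Longrightarrow> k < length (walk g) \<Longrightarrow> walk g ! k = (u, v) \<Longrightarrow> t \<le> \<theta> g + real k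
    \<Longrightarrow> arr v (\<theta> g + real k + 1)"

lemma ride_at:
  "arr u t \<Longrightarrow> g \<in> set tags \<Longrightarrow> k < length (walk g) \<Longrightarrow> walk g ! k = (u, v) \<Longrightarrow> \<theta> g = t - real k
    \<Longrightarrow> arr v (t + 1)"
  using ride[of u t g k v] by simp

text \<open>The chain edge is the third edge of \<open>Taut\<close>, and of \<open>Occ\<close> if
  the literal occurs in the clause. Arriving behind it at time \<open>t\<close> means a start at
  \<open>t - 3\<close> or earlier, so the first edge of that trip is already missed.\<close>

definition pass :: "nat \<Rightarrow> bool \<Rightarrow> nat \<Rightarrow> real \<Rightarrow> bool" where
  "pass u b i t \<longleftrightarrow> \<theta> (Taut u b) + 3 \<le> t \<and> (\<forall>i'<i. mem i' b u \<longrightarrow> \<theta> (Occ u b i') + 3 \<le> t)"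

definition pref :: "nat \<Rightarrow> real \<Rightarrow> bool" where
  "pref u t \<longleftrightarrow> (\<forall>u'<u. \<exists>b. pass u' b nc t)"

text \<open>On the sections after the variables, \<open>t0\<close> is a time at which all chains had
  been passed and after which all reading and clause trips start. Truncated subtraction lets one
  formula describe all three sections of the path.\<close>

definition wspec :: "nat \<Rightarrow> real \<Rightarrow> bool" where
  "wspec j t \<longleftrightarrow> (\<exists>t0\<le>t. pref (min j nv) t0 \<and> (\<forall>u<min (j - nv) nv. \<exists>b. t0 \<le> \<theta> (Taut u b))
     \<and> (\<forall>i<j - 2 * nv. \<exists>u<nv. \<exists>b. mem i b u \<and> t0 \<le> \<theta> (Occ u b i)))"

definition honest :: bool where
  "honest \<longleftrightarrow> (\<exists>t. wspec (2 * nv + nc) t)"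

text \<open>The gate \<open>e\<close> is the only one whose first edge, the entrance to its block,
  can still be boarded at time \<open>t\<close> or later.\<close>

definition eflag :: "real \<Rightarrow> bool" where
  "eflag t \<longleftrightarrow> (\<exists>e. \<forall>j<m. j \<noteq> e \<longrightarrow> \<theta> (Gate j) < t)"

text \<open>This is meant for the case that \<open>honest\<close> fails. \<open>eflag\<close> is an
  alternative at all gadget nodes because \<open>Jump\<close> leads to each of them from
  \<open>E\<close>; \<open>pref nv\<close> is one at chain nodes because they are also entered from
  the clause section. For a block, a time \<open>t'\<close> no later than the departure of its gate
  is kept, to compare two blocks.\<close>

fun invar :: "node \<Rightarrow> real \<Rightarrow> bool" where
  "invar (W j) t \<longleftrightarrow> eflag t \<or> wspec j t"
| "invar (V u b i) t \<longleftrightarrow> eflag t \<or> pref nv t \<or> (pref u t \<and> pass u b i t)"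
| "invar (X j) t \<longleftrightarrow> eflag t \<or> (\<forall>j'<j. \<theta> (Gate j') < t)"
| "invar (Z j) t \<longleftrightarrow> eflag t \<or> (\<exists>e. \<forall>j'<j. j' \<noteq> e \<longrightarrow> \<theta> (Gate j') < t)"
| "invar E t \<longleftrightarrow> eflag t"
| "invar (B j k) t \<longleftrightarrow> j < m \<and> (\<exists>t'\<le>t. eflag t' \<and> t' \<le> \<theta> (Gate j))"

lemma pass_mono: "pass u b i t \<Longrightarrow> t \<le> t' \<Longrightarrow> pass u b i t'"
  unfolding pass_def by (meson order_trans)

lemma pref_mono: "pref u t \<Longrightarrow> t \<le> t' \<Longrightarrow> pref u t'"
  unfolding pref_def using pass_mono by blast

lemma pref_le: "pref u t \<Longrightarrow> u' \<le> u \<Longrightarrow> pref u' t"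
  unfolding pref_def by auto

lemma wspec_mono: "wspec j t \<Longrightarrow> t \<le> t' \<Longrightarrow> wspec j t'"
  unfolding wspec_def by (meson order_trans)

lemma eflag_mono: "eflag t \<Longrightarrow> t \<le> t' \<Longrightarrow> eflag t'"
  unfolding eflag_def by (meson less_le_trans)

lemma invar_mono: "invar v t \<Longrightarrow> t \<le> t' \<Longrightarrow> invar v t'"
proof (cases v)
  case (X j)
  then show "invar v t \<Longrightarrow> t \<le> t' \<Longrightarrow> invar v t'" using eflag_mono[of t t'] by (auto intro: less_le_trans)
next
  case (Z j)
  then show "invar v t \<Longrightarrow> t \<le> t' \<Longrightarrow> invar v t'" using eflag_mono[of t t'] by (auto intro: less_le_trans)
next
  case (B j k)
  then show "invar v t \<Longrightarrow> t \<le> t' \<Longrightarrow> invar v t'" by (auto intro: order_trans)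
qed (auto intro: eflag_mono wspec_mono pref_mono pass_mono)

lemma invar_eflag: "invar (B j k) t \<Longrightarrow> eflag t"
  using eflag_mono by auto

lemma wspec_0: "wspec 0 t"
  unfolding wspec_def pref_def by (intro exI[of _ t]) simp

lemma wspec_pref: "wspec j t \<Longrightarrow> pref (min j nv) t"
  unfolding wspec_def using pref_mono by blast

lemma wspec_low: "pref j t \<Longrightarrow> j \<le> nv \<Longrightarrow> wspec j t"
  unfolding wspec_def by (intro exI[of _ t]) auto

lemma invar_ride:
  assumes nh: "\<not> honest" and g: "g \<in> set tags" and k: "k < length (walk g)" and w: "walk g ! k = (u, v)"
    and t: "invar u t" "t \<le> \<theta> g + real k"
  shows "invar v (\<theta> g + real k + 1)"
proof -
  define t1 where "t1 = \<theta> g + real k + 1"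
  have tt: "t \<le> t1" using t by (simp add: t1_def)
  have u1: "invar u t1" using invar_mono[OF t(1) tt] .
  have "invar v t1"
  proof (cases g)
    case (Taut x b)
    hence x: "x < nv" using g by (simp add: tags_iff)
    from k w Taut consider "k = 0" "u = W (nv + x)" "v = W (nv + x + 1)"
      | "k = 1" "u = W (nv + x + 1)" "v = W x" | "k = 2" "u = W x" "v = V x b 0"
      by (auto simp: less_Suc_eq numeral_2_eq_2)
    then show ?thesis
    proof cases
      case 1
      show ?thesis
      proof (cases "eflag t")
        case True
        then show ?thesis using 1 eflag_mono[OF _ tt] by simp
      next
        case False
        with t(1) 1 obtain t0 where t0: "t0 \<le> t" "pref nv t0" "\<forall>u<x. \<exists>b. t0 \<le> \<theta> (Taut u b)"
          using x by (auto simp: wspec_def min_def split: if_splits)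
        \<comment> \<open>The first edge is boarded at offset 0, so the trip itself starts no
          earlier than \<open>t\<close>, hence not before \<open>t0\<close>.\<close>
        have "t0 \<le> \<theta> (Taut x b)" using t0 t(2) 1 Taut by simp
        hence "\<forall>u<Suc x. \<exists>b. t0 \<le> \<theta> (Taut u b)" using t0(3) by (auto simp: less_Suc_eq)
        with t0 tt x have "wspec (nv + x + 1) t1" unfolding wspec_def
          by (intro exI[of _ t0]) auto
        then show ?thesis using 1 by simp
      qed
    next
      case 2
      with u1 show ?thesis using wspec_pref[of "nv + x + 1" t1] x wspec_low[of x t1] pref_le[of nv t1 x]
        by auto
    next
      case 3
      have "pass x b 0 t1" using Taut 3 by (simp add: pass_def t1_def)
      with 3 u1 show ?thesis using wspec_pref[of x t1] x by (auto simp: min_def)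
    qed
  next
    case (Occ x b i)
    hence x: "x < nv" "i < nc" using g by (auto simp: tags_iff)
    from k w Occ consider "mem i b x" "k = 0" "u = W (2 * nv + i)" "v = W (2 * nv + i + 1)"
      | "mem i b x" "k = 1" "u = W (2 * nv + i + 1)" "v = V x b i"
      | "mem i b x \<longrightarrow> k = 2" "u = V x b i" "v = V x b (i + 1)"
      by (auto simp: less_Suc_eq numeral_2_eq_2 split: if_splits)
    then show ?thesis
    proof cases
      case 1
      show ?thesis
      proof (cases "eflag t")
        case True
        then show ?thesis using 1 eflag_mono[OF _ tt] by simp
      next
        case False
        with t(1) 1 obtain t0 where t0: "t0 \<le> t" "pref nv t0" "\<forall>u<nv. \<exists>b. t0 \<le> \<theta> (Taut u b)"
          "\<forall>i'<i. \<exists>u<nv. \<exists>b. mem i' b u \<and> t0 \<le> \<theta> (Occ u b i')"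
          by (auto simp: wspec_def)
        have "t0 \<le> \<theta> (Occ x b i)" using t0 t(2) 1 Occ by simp
        hence "\<forall>i'<Suc i. \<exists>u<nv. \<exists>b. mem i' b u \<and> t0 \<le> \<theta> (Occ u b i')"
          using t0(4) 1(1) x by (auto simp: less_Suc_eq)
        with t0 tt x have "wspec (2 * nv + i + 1) t1" unfolding wspec_def
          by (intro exI[of _ t0]) auto
        then show ?thesis using 1 by simp
      qed
    next
      case 2
      with u1 show ?thesis using wspec_pref[of "2 * nv + i + 1" t1] by auto
    next
      case 3
      have "mem i b x \<longrightarrow> \<theta> (Occ x b i) + 3 \<le> t1" using Occ 3 by (simp add: t1_def)
      hence "pass x b i t1 \<Longrightarrow> pass x b (Suc i) t1" by (auto simp: pass_def less_Suc_eq)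
      with 3 u1 show ?thesis by auto
    qed
  next
    case (Link x b)
    hence x: "x < nv" using g by (simp add: tags_iff)
    have uv: "u = V x b nc" "v = W (x + 1)" using k w Link by auto
    have "pref x t1 \<Longrightarrow> pass x b nc t1 \<Longrightarrow> pref (Suc x) t1" by (auto simp: pref_def less_Suc_eq)
    with uv u1 x show ?thesis using wspec_low[of "Suc x" t1] pref_le[of nv t1 "Suc x"] by auto
  next
    case Enter
    then show ?thesis using k w by auto
  next
    case (Skip j)
    have uv: "u = X j" "v = Z (j + 1)" using k w Skip by auto
    with u1 show ?thesis by (auto intro!: exI[of _ j] simp: less_Suc_eq)
  next
    case CheatEnd
    then show ?thesis using k w u1 by (auto simp: eflag_def)
  next
    \<comment> \<open>The only entrance to \<open>E\<close> besides the second way; it is closed by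
      \<open>nh\<close>.\<close>
    case HonestEnd
    then show ?thesis using k w u1 nh by (auto simp: honest_def)
  next
    case (Gate j)
    hence j: "j < m" using g by (simp add: tags_iff)
    from k w Gate consider "k = 0" "u = E" "v = B j 0" | "k = 1" "u = B j 0" "v = X j"
      | "k = 2" "u = X j" "v = X (j + 1)" | "k = 3" "u = X (j + 1)" "v = Z j" | "k = 4" "u = Z j" "v = Z (j + 1)"
      by (auto simp: less_Suc_eq numeral_eq_Suc)
    then show ?thesis
    proof cases
      case 1
      then show ?thesis using t tt j Gate by auto
    next
      case 2
      then show ?thesis using invar_eflag[of j 0 t1] u1 by simp
    next
      case 3
      have "\<theta> (Gate j) < t1" using Gate by (simp add: t1_def)
      with 3 u1 show ?thesis by (auto simp: less_Suc_eq)
    next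
      case 4
      with u1 show ?thesis by auto
    next
      case 5
      have "\<theta> (Gate j) < t1" using Gate by (simp add: t1_def)
      with 5 u1 show ?thesis by (auto simp: less_Suc_eq)
    qed
  next
    case (Block j k)
    then show ?thesis using k w u1 by auto
  next
    case (Jump x)
    hence "x \<in> set gadgets" "v = x" "eflag t1" using g k w u1 by (auto simp: tags_iff)
    then show ?thesis by (auto simp: set_gadgets)
  next
    case (Back x)
    then show ?thesis using k w wspec_0 by auto
  qed
  then show ?thesis by (simp add: t1_def)
qed

lemma arr_invar:
  assumes "\<not> honest" "src = W 0" "arr v t"
  shows "invar v t"
  using assms(3)
proof induction
  case (start t)
  then show ?case using assms(2) wspec_0 by simp
next
  case (wait v t t')
  then show ?case using invar_mono by blast
next
  case (ride u t g k v)
  then show ?case using invar_ride[OF assms(1)] by blast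
qed

text \<open>Take the earlier of the two witness times given by the invariant. From then on at most
  one gate is left, yet the gates of both blocks depart no earlier, so they coincide.\<close>

lemma two_blocks_honest:
  assumes "src = W 0" "arr (B j k) t" "arr (B j' k') t'" "j \<noteq> j'"
  shows honest
proof (rule ccontr)
  assume nh: "\<not> honest"
  from arr_invar[OF nh assms(1,2)] obtain a where a: "j < m" "eflag a" "a \<le> \<theta> (Gate j)" by auto
  from arr_invar[OF nh assms(1,3)] obtain b where b: "j' < m" "eflag b" "b \<le> \<theta> (Gate j')" by auto
  have False if "x < m" "y < m" "eflag c" "c \<le> \<theta> (Gate x)" "c \<le> \<theta> (Gate y)" "x \<noteq> y" for x y c
    using that by (auto simp: eflag_def) (metis not_less)
  from this[of j j' a] this[of j j' b] a b assms(4) show False by (cases "a \<le> b") auto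
qed

text \<open>The clause is crossed by a trip of a literal \<open>b\<close> that starts after
  \<open>t0\<close>, so the chain passed for \<open>u\<close> was that of \<open>\<not> b\<close>,
  and \<open>Taut u (\<not> b)\<close> started before \<open>t0\<close>. Some \<open>Taut\<close>
  trip of \<open>u\<close> starts after \<open>t0\<close>; it must be that of \<open>b\<close>, and
  so the comparison of the two yields \<open>b\<close>.\<close>

lemma honest_sat:
  assumes honest "i < nc"
  shows "\<exists>u<nv. mem i (\<theta> (Taut u False) < \<theta> (Taut u True)) u"
proof -
  from assms(1) obtain t0 where t0: "pref nv t0" "\<forall>u<nv. \<exists>b. t0 \<le> \<theta> (Taut u b)"
    "\<forall>i<nc. \<exists>u<nv. \<exists>b. mem i b u \<and> t0 \<le> \<theta> (Occ u b i)"
    by (auto simp: honest_def wspec_def)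
  from t0(3) assms(2) obtain u b where u: "u < nv" "mem i b u" "t0 \<le> \<theta> (Occ u b i)" by blast
  from t0(1) u(1) obtain b' where b': "pass u b' nc t0" by (auto simp: pref_def)
  have "b' \<noteq> b"
  proof
    assume "b' = b"
    hence "\<theta> (Occ u b i) + 3 \<le> t0" using b' u(2) assms(2) by (simp add: pass_def)
    with u(3) show False by simp
  qed
  hence bb: "b' = (\<not> b)" by auto
  have "\<theta> (Taut u b') + 3 \<le> t0" using b' by (simp add: pass_def)
  moreover from t0(2) u(1) obtain b'' where "t0 \<le> \<theta> (Taut u b'')" by blast
  ultimately have "\<theta> (Taut u (\<not> b)) < \<theta> (Taut u b)" using bb by (cases "b'' = b") auto
  hence "(\<theta> (Taut u False) < \<theta> (Taut u True)) = b" by (cases b) auto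
  with u show ?thesis by auto
qed

end

section \<open>Explicit temporalisations\<close>

context net
begin

text \<open>The position of the chain edge in the walk of \<open>Occ u b i\<close>.\<close>

definition off :: "nat \<Rightarrow> bool \<Rightarrow> nat \<Rightarrow> nat" where
  "off u b i = (if mem i b u then 2 else 0)"

text \<open>The time at which \<open>W u\<close> is left: a variable takes \<open>nc + 2\<close>
  rides, and one unit is to spare.\<close>

definition base :: "nat \<Rightarrow> real" where
  "base u = real u * (real nc + 3)"

text \<open>The path takes the chains of the literals that are false under \<sigma>; the trips of
  the true literals are saved for the reading steps and clauses. Subtracting 2 or \<open>off\<close>
  puts the chain edge, rather than the start of the trip, at the wanted time.\<close>

fun honest_time :: "(nat \<Rightarrow> bool) \<Rightarrow> trip \<Rightarrow> real" where
  "honest_time \<sigma> (Taut u b) = (if b = \<sigma> u then base nv + real u else base u - 2)"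
| "honest_time \<sigma> (Occ u b i) = (if b = \<sigma> u then base nv + real nv + real i else base u + 1 + real i - real (off u b i))"
| "honest_time \<sigma> (Link u b) = base u + 1 + real nc"
| "honest_time \<sigma> HonestEnd = base nv + real nv + real nc"
| "honest_time \<sigma> (Gate j) = base nv + real nv + real nc + 1"
| "honest_time \<sigma> (Block j k) = base nv + real nv + real nc + 2"
| "honest_time \<sigma> _ = 0"

lemma honest_reaches:
  assumes sat: "\<And>i. i < nc \<Longrightarrow> \<exists>u<nv. mem i (\<sigma> u) u" and j: "j < m" and k: "k \<le> m"
  shows "\<exists>t. timed_net.arr nv nc m mem (honest_time \<sigma>) (W 0) (B j k) t"
proof -
  interpret timed_net nv nc m mem "honest_time \<sigma>" "W 0" .
  have W1: "arr (W u) (base u)" if "u \<le> nv" for u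
    using that
  proof (induction u)
    case 0
    show ?case by (rule start)
  next
    case (Suc u)
    hence u: "u < nv" and a: "arr (W u) (base u)" by auto
    have "arr (V u (\<not> \<sigma> u) i) (base u + 1 + real i)" if "i \<le> nc" for i
      using that
    proof (induction i)
      case 0
      have "arr (V u (\<not> \<sigma> u) 0) (base u + 1)"
        by (rule ride_at[OF a, of "Taut u (\<not> \<sigma> u)" 2]) (use u in \<open>auto simp: tags_iff\<close>)
      then show ?case by simp
    next
      case (Suc i)
      hence i: "i < nc" and ai: "arr (V u (\<not> \<sigma> u) i) (base u + 1 + real i)" by auto
      have "arr (V u (\<not> \<sigma> u) (Suc i)) (base u + 1 + real i + 1)"
        by (rule ride_at[OF ai, of "Occ u (\<not> \<sigma> u) i" "off u (\<not> \<sigma> u) i"]) (use u i in \<open>auto simp: tags_iff off_def\<close>)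
      then show ?case by (simp add: algebra_simps)
    qed
    from this[of nc] have "arr (V u (\<not> \<sigma> u) nc) (base u + 1 + real nc)" by simp
    hence "arr (W (u + 1)) (base u + 1 + real nc + 1)"
      by (rule ride_at[of _ _ "Link u (\<not> \<sigma> u)" 0]) (use u in \<open>auto simp: tags_iff\<close>)
    then show ?case unfolding Suc_eq_plus1 by (rule wait) (simp add: base_def algebra_simps)
  qed
  have W2: "arr (W (nv + u)) (base nv + real u)" if "u \<le> nv" for u
    using that
  proof (induction u)
    case 0
    then show ?case using W1[of nv] by simp
  next
    case (Suc u)
    hence u: "u < nv" and a: "arr (W (nv + u)) (base nv + real u)" by auto
    have "arr (W (nv + u + 1)) (base nv + real u + 1)"
      by (rule ride_at[OF a, of "Taut u (\<sigma> u)" 0]) (use u in \<open>auto simp: tags_iff\<close>)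
    then show ?case by (simp add: algebra_simps)
  qed
  have W3: "arr (W (2 * nv + i)) (base nv + real nv + real i)" if "i \<le> nc" for i
    using that
  proof (induction i)
    case 0
    then show ?case using W2[of nv] by (simp add: mult_2)
  next
    case (Suc i)
    hence i: "i < nc" and a: "arr (W (2 * nv + i)) (base nv + real nv + real i)" by auto
    from sat[OF i] obtain u where u: "u < nv" "mem i (\<sigma> u) u" by blast
    have "arr (W (2 * nv + i + 1)) (base nv + real nv + real i + 1)"
      by (rule ride_at[OF a, of "Occ u (\<sigma> u) i" 0]) (use u i in \<open>auto simp: tags_iff\<close>)
    then show ?case by (simp add: algebra_simps)
  qed
  have "arr E (base nv + real nv + real nc + 1)"
    by (rule ride_at[OF W3[of nc], of HonestEnd 0]) (auto simp: tags_iff)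
  hence B0: "arr (B j 0) (base nv + real nv + real nc + 1 + 1)"
    by (rule ride_at[of _ _ "Gate j" 0]) (use j in \<open>auto simp: tags_iff\<close>)
  show ?thesis
  proof (cases k)
    case 0
    with B0 show ?thesis by blast
  next
    case (Suc k')
    have "arr (B j (k' + 1)) (base nv + real nv + real nc + 1 + 1 + 1)"
      by (rule ride_at[OF B0, of "Block j k'" 0]) (use j k Suc in \<open>auto simp: tags_iff\<close>)
    with Suc show ?thesis by auto
  qed
qed

text \<open>Gates before \<open>e\<close> are used by their third edge and gates after
  \<open>e\<close> by their fifth, in both cases at time \<open>j + 1\<close>; hence
  \<open>- 1\<close> and \<open>- 3\<close>. Gate \<open>e\<close> is kept for time
  \<open>m + 2\<close>, when \<open>E\<close> is reached.\<close>

fun cheat_time :: "nat \<Rightarrow> trip \<Rightarrow> real" where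
  "cheat_time e (Gate j) = (if j < e then real j - 1 else if j = e then real m + 2 else real j - 3)"
| "cheat_time e (Skip j) = real e + 1"
| "cheat_time e CheatEnd = real m + 1"
| "cheat_time e (Jump x) = real m + 2"
| "cheat_time e (Block j k) = real m + 3"
| "cheat_time e (Back x) = -2"
| "cheat_time e _ = 0"

lemma cheat_reaches:
  assumes src: "src \<in> set all_nodes" and e: "e < m"
    and v: "v \<in> set gadgets \<union> {E} \<union> {B e k | k. k \<le> m}"
  shows "\<exists>t. timed_net.arr nv nc m mem (cheat_time e) src v t"
proof -
  interpret timed_net nv nc m mem "cheat_time e" src .
  have "arr (W 0) (-2 + 1)"
    by (rule ride_at[OF start[of "-2"], of "Back src" 0]) (use src in \<open>auto simp: tags_iff\<close>)
  hence "arr (W 0) 0" by (rule wait) simp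
  hence "arr (X 0) (0 + 1)"
    by (rule ride_at[of _ _ Enter 0]) (auto simp: tags_iff)
  hence X0: "arr (X 0) 1" by simp
  have XX: "arr (X j) (real j + 1)" if "j \<le> e" for j
    using that
  proof (induction j)
    case 0
    then show ?case using X0 by simp
  next
    case (Suc j)
    hence a: "arr (X j) (real j + 1)" by simp
    have "arr (X (j + 1)) (real j + 1 + 1)"
      by (rule ride_at[OF a, of "Gate j" 2]) (use Suc e in \<open>auto simp: tags_iff\<close>)
    then show ?case by (simp add: algebra_simps)
  qed
  have Z0: "arr (Z (e + 1)) (real e + 1 + 1)"
    by (rule ride_at[OF XX[of e], of "Skip e" 0]) (use e in \<open>auto simp: tags_iff\<close>)
  have ZZ: "arr (Z (e + 1 + i)) (real (e + 1 + i) + 1)" if "e + 1 + i \<le> m" for i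
    using that
  proof (induction i)
    case 0
    then show ?case using Z0 by (simp add: algebra_simps)
  next
    case (Suc i)
    hence a: "arr (Z (e + 1 + i)) (real (e + 1 + i) + 1)" by simp
    have "arr (Z (e + 1 + i + 1)) (real (e + 1 + i) + 1 + 1)"
      by (rule ride_at[OF a, of "Gate (e + 1 + i)" 4]) (use Suc in \<open>auto simp: tags_iff numeral_eq_Suc\<close>)
    then show ?case by (simp add: algebra_simps)
  qed
  have "arr (Z m) (real m + 1)" using ZZ[of "m - (e + 1)"] e by simp
  hence "arr E (real m + 1 + 1)"
    by (rule ride_at[of _ _ CheatEnd 0]) (auto simp: tags_iff)
  hence aE: "arr E (real m + 2)" by (simp add: add.assoc)
  from v consider "v \<in> set gadgets" | "v = E" | k where "v = B e k" "k \<le> m" by blast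
  then show ?thesis
  proof cases
    case 1
    have "arr v (real m + 2 + 1)"
      by (rule ride_at[OF aE, of "Jump v" 0]) (use 1 in \<open>auto simp: tags_iff\<close>)
    then show ?thesis by blast
  next
    case 2
    with aE show ?thesis by blast
  next
    case 3
    have B0: "arr (B e 0) (real m + 2 + 1)"
      by (rule ride_at[OF aE, of "Gate e" 0]) (use e in \<open>auto simp: tags_iff\<close>)
    show ?thesis
    proof (cases k)
      case 0
      with B0 3 show ?thesis by blast
    next
      case (Suc k')
      have "arr (B e (k' + 1)) (real m + 2 + 1 + 1)"
        by (rule ride_at[OF B0, of "Block e k'" 0]) (use e 3 Suc in \<open>auto simp: tags_iff\<close>)
      with Suc 3 show ?thesis by auto
    qed
  qed
qed

text \<open>A target in a block is reached by skipping the gate of that very block. Different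
  targets may use different temporalisations, so saving one gate at a time is enough.\<close>

lemma strongly_connected:
  assumes "src \<in> set all_nodes" "v \<in> set all_nodes" "0 < m"
  shows "\<exists>\<theta> t. timed_net.arr nv nc m mem \<theta> src v t"
proof -
  have "\<exists>e<m. v \<in> set gadgets \<union> {E} \<union> {B e k | k. k \<le> m}"
    using assms by (auto simp: set_all_nodes)
  then show ?thesis using cheat_reaches[OF assms(1)] by blast
qed

lemma walk_nonempty: "walk g \<noteq> []"
  by (cases g) auto

lemma walk_consecutive: "Suc k < length (walk g) \<Longrightarrow> snd (walk g ! k) = fst (walk g ! Suc k)"
  by (cases g) (auto simp: less_Suc_eq split: if_splits)

lemma walk_nodes:
  assumes "g \<in> set tags" "(u, v) \<in> set (walk g)"
  shows "u \<in> set all_nodes \<and> v \<in> set all_nodes"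
  by (rule trip.exhaust[of g]; use assms in \<open>auto simp: tags_iff set_all_nodes set_gadgets split: if_splits\<close>)

lemma length_gadgets: "length gadgets = (2 * nv + nc + 1) + 2 * nv * (nc + 1) + 2 * (m + 1)"
  by (simp add: gadgets_def lits_def)

lemma length_all_nodes: "length all_nodes = length gadgets + 1 + m * (m + 1)"
  by (simp add: all_nodes_def)

end

subsection \<open>Encoding the network\<close>

fun lab :: "node \<Rightarrow> nat list" where
  "lab (W j) = [0, j]"
| "lab (V u b i) = [1, u, if b then 1 else 0, i]"
| "lab (X j) = [2, j]"
| "lab (Z j) = [3, j]"
| "lab E = [4]"
| "lab (B j k) = [5, j, k]"

lemma lab_inj: "lab v = lab w \<Longrightarrow> v = w"
  by (cases v; cases w) (auto split: if_splits)

instantiation node :: encodable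
begin
definition tree_of_node :: "node \<Rightarrow> tree" where "tree_of_node v = tree_of (lab v)"
instance by standard (auto simp: tree_of_node_def dest: tree_of_inj lab_inj)
end

text \<open>Every bit string that ends in \<open>True\<close> is the binary representation of a number, so node
  numbers can be any such strings.\<close>

definition label_bits :: "nat list \<Rightarrow> bool list" where
  "label_bits l = concat (map (\<lambda>n. replicate n True @ [False]) l) @ [True]"

text \<open>As a number, \<open>nd v\<close> is exponential in the entries of its label. The class
  never computes it, only its bits, which are the label bits by \<open>bits_of_nd\<close>.\<close>

definition nd :: "node \<Rightarrow> nat" where
  "nd v = bval (label_bits (lab v))"

lemma bits_of_nat_bval: "l \<noteq> [] \<Longrightarrow> last l \<Longrightarrow> bits_of_nat (bval l) = l"
proof (induction l)
  case (Cons b l)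
  show ?case
  proof (cases "l = []")
    case True
    with Cons show ?thesis by (simp add: bits_of_nat.simps)
  next
    case False
    with Cons have l: "bits_of_nat (bval l) = l" by simp
    have "bval l \<noteq> 0"
    proof
      assume "bval l = 0"
      with l False show False by (simp add: bits_of_nat.simps)
    qed
    with l show ?thesis by (subst bits_of_nat.simps) auto
  qed
qed simp

lemma bits_of_nd: "bits_of_nat (nd v) = label_bits (lab v)"
  unfolding nd_def by (rule bits_of_nat_bval) (auto simp: label_bits_def)

lemma unary_cancel:
  "replicate n True @ False # xs = replicate n' True @ False # ys \<Longrightarrow> n = n' \<and> xs = ys"
proof (induction n arbitrary: n')
  case 0 then show ?case by (cases n') auto
next
  case (Suc n) then show ?case by (cases n') auto
qed

lemma label_bits_inj: "label_bits l = label_bits l' \<Longrightarrow> l = l'"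
proof (induction l arbitrary: l')
  case Nil
  then show ?case
  proof (cases l')
    case (Cons n' l'')
    with Nil show ?thesis by (cases n') (auto simp: label_bits_def)
  qed simp
next
  case (Cons n l)
  then show ?case
  proof (cases l')
    case Nil
    with Cons show ?thesis by (cases n) (auto simp: label_bits_def)
  next
    case (Cons n' l'')
    with Cons.prems have "n = n' \<and> label_bits l = label_bits l''"
      by (intro unary_cancel) (simp add: label_bits_def)
    with Cons.IH Cons show ?thesis by simp
  qed
qed

lemma nd_inj [simp]: "nd v = nd w \<longleftrightarrow> v = w"
  using bits_of_nd[of v] bits_of_nd[of w] label_bits_inj lab_inj by metis

lemma inj_nd: "inj_on nd A"
  by (simp add: inj_on_def)

definition nedge :: "node \<times> node \<Rightarrow> nat \<times> nat \<times> rat" where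
  "nedge e = (nd (fst e), nd (snd e), 1)"

definition redge :: "node \<times> node \<Rightarrow> nat edge" where
  "redge e = (nd (fst e), nd (snd e), 1)"

lemma real_edge_nedge: "real_edge (nedge e) = redge e"
  by (simp add: real_edge_def nedge_def redge_def)

context net
begin

definition trip_list :: "(nat \<times> nat \<times> rat) list list" where
  "trip_list = map (\<lambda>g. map nedge (walk g)) tags"

definition network :: "nat trip_network" where
  "network = network_of (map nd all_nodes) (concat trip_list) trip_list"

lemma network_simps [simp]:
  "nodes network = nd ` set all_nodes"
  "trips network = map (\<lambda>g. map redge (walk g)) tags"
  by (auto simp: network_def network_of_def trip_list_def real_edge_nedge)

lemma edges_network:
  "set_mset (edges network) = {(nd u, nd v, 1) | u v. \<exists>g \<in> set tags. (u, v) \<in> set (walk g)}"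
  by (force simp: network_def network_of_def trip_list_def real_edge_nedge redge_def)

lemma is_trip_network: "is_trip_network network"
  unfolding is_trip_network_def
proof (intro conjI)
  show "finite (nodes network)" by simp
  show "\<forall>(u, v, w)\<in>#edges network. u \<in> nodes network \<and> v \<in> nodes network \<and> 0 < w"
    using walk_nodes by (fastforce simp: edges_network)
  show "\<forall>T\<in>set (trips network). walk_in (edges network) T"
  proof
    fix T assume "T \<in> set (trips network)"
    then obtain g where g: "g \<in> set tags" "T = map redge (walk g)" by auto
    show "walk_in (edges network) T"
      unfolding walk_in_def
    proof (intro conjI)
      show "T \<noteq> []" using g walk_nonempty by simp
      show "set T \<subseteq> set_mset (edges network)" using g by (fastforce simp: edges_network redge_def)
      show "successively (\<lambda>(u, v, w) (u', v', w'). v = u') T"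
        unfolding successively_conv_nth using walk_consecutive[of _ g] g(2)
        by (auto simp: case_prod_unfold redge_def)
    qed
  qed
  show "\<forall>x\<in>nodes network. \<exists>T\<in>set (trips network). \<exists>(u, v, w)\<in>set T. x = u \<or> x = v"
  proof
    fix x assume "x \<in> nodes network"
    then obtain v where v: "v \<in> set all_nodes" "x = nd v" by auto
    hence "Back v \<in> set tags" by (simp add: tags_iff)
    hence "map redge (walk (Back v)) \<in> set (trips network)"
      unfolding network_simps set_map by (rule imageI)
    then show "\<exists>T\<in>set (trips network). \<exists>(u, v, w)\<in>set T. x = u \<or> x = v"
      by (rule bexI[rotated]) (use v in \<open>auto simp: redge_def\<close>)
  qed
  show "\<forall>e\<in>#edges network. \<exists>T\<in>set (trips network). e \<in> set T"
    by (force simp: edges_network redge_def)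
qed

text \<open>Temporalisations assign times to positions, the invariants to named trips; distinctness
  of \<open>tags\<close> permits the passage from the former to the latter.\<close>

lemma exists_tag_times:
  obtains \<theta> where "\<forall>i<length tags. \<theta> (tags ! i) = (\<tau> i :: real)"
proof -
  define \<theta> where "\<theta> g = the (map_of (zip tags (map \<tau> [0..<length tags])) g)" for g
  have "\<theta> (tags ! i) = \<tau> i" if "i < length tags" for i
    using that distinct_tags by (simp add: \<theta>_def map_of_zip_nth)
  then show thesis using that by blast
qed

end

context timed_net
begin

definition edge_set :: "nat temporal_edge set" where
  "edge_set = {(nd u, nd v, \<theta> g + real k, 1) | g k u v. g \<in> set tags \<and> k < length (walk g) \<and> walk g ! k = (u, v)}"

lemma induced:
  assumes \<tau>: "\<And>i. i < length tags \<Longrightarrow> \<theta> (tags ! i) = \<tau> i"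
  shows "induced_edges network \<tau> =
     edge_set"
proof -
  have w: "(\<Sum>j<i. weight (map redge (walk g) ! j)) = real i"
    if "i < length (walk g)" for i g
  proof -
    have "(\<Sum>j<i. weight (map redge (walk g) ! j)) = (\<Sum>j<i. 1)"
      using that by (intro sum.cong) (auto simp: weight_def redge_def)
    then show ?thesis by simp
  qed
  have ib: "induced_by_trip (map redge (walk g)) t =
     {(nd u, nd v, t + real k, 1) | k u v. k < length (walk g) \<and> walk g ! k = (u, v)}" for g t
  proof -
    have "(u, v, t + (\<Sum>j<i. weight (map redge (walk g) ! j)), w')
       \<in> {(nd u, nd v, t + real k, 1) | k u v. k < length (walk g) \<and> walk g ! k = (u, v)}"
      if "i < length (walk g)" "map redge (walk g) ! i = (u, v, w')" for u v w' i
      using that w[OF that(1)] by (cases "walk g ! i") (auto simp: redge_def)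
    moreover have "(nd u, nd v, t + real k, 1) \<in> induced_by_trip (map redge (walk g)) t"
      if "k < length (walk g)" "walk g ! k = (u, v)" for k u v
      unfolding induced_by_trip_def using that w[OF that(1)]
      by (auto intro!: exI[of _ k] simp: redge_def)
    ultimately show ?thesis unfolding induced_by_trip_def by fastforce
  qed
  show ?thesis
    unfolding induced_edges_def network_simps length_map
  proof (intro equalityI subsetI)
    fix x assume "x \<in> (\<Union>i<length tags. induced_by_trip (map (\<lambda>g. map redge (walk g)) tags ! i) (\<tau> i))"
    then obtain i where i: "i < length tags"
      "x \<in> induced_by_trip (map redge (walk (tags ! i))) (\<tau> i)" by auto
    then show "x \<in> edge_set"
      unfolding edge_set_def ib \<tau>[OF i(1), symmetric] using nth_mem[OF i(1)] by blast
  next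
    fix x :: "nat temporal_edge" assume "x \<in> edge_set"
    then obtain g k u v where x: "x = (nd u, nd v, \<theta> g + real k, 1)" "g \<in> set tags" "k < length (walk g)" "walk g ! k = (u, v)"
      unfolding edge_set_def by blast
    from x(2) obtain i where i: "i < length tags" "tags ! i = g" by (auto simp: in_set_conv_nth)
    have "x \<in> induced_by_trip (map redge (walk (tags ! i))) (\<tau> i)"
      unfolding ib using x i \<tau>[OF i(1)] by auto
    with i show "x \<in> (\<Union>i<length tags. induced_by_trip (map (\<lambda>g. map redge (walk g)) tags ! i) (\<tau> i))"
      by auto
  qed
qed

lemma reachable_iff:
  assumes \<tau>: "\<And>i. i < length tags \<Longrightarrow> \<theta> (tags ! i) = \<tau> i"
  shows "reachable network \<tau> (nd src) y \<longleftrightarrow> (\<exists>v t. y = nd v \<and> arr v t)"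
proof
  let ?A = "induced_edges network \<tau>"
  let ?R = "\<lambda>(u, v, t, w) (u', v', t', w'). v = u' \<and> t + w \<le> (t' :: real)"
  have "\<exists>v. fst (snd (last es)) = nd v \<and> arr v (fst (snd (snd (last es))) + snd (snd (snd (last es))))"
    if "es \<noteq> []" "set es \<subseteq> ?A" "fst (hd es) = nd src" "successively ?R es" for es
    using that
  proof (induction es rule: rev_induct)
    case (snoc e es)
    have "e \<in> ?A" using snoc.prems(2) by simp
    hence "e \<in> edge_set"
      by (simp only: induced[OF \<tau>])
    then obtain g k u v where e: "e = (nd u, nd v, \<theta> g + real k, 1)" "g \<in> set tags"
      "k < length (walk g)" "walk g ! k = (u, v)" unfolding edge_set_def by blast
    have "\<exists>t. arr u t \<and> t \<le> \<theta> g + real k"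
    proof (cases "es = []")
      case True
      with snoc.prems e have "u = src" by simp
      then show ?thesis using start by blast
    next
      case False
      hence "successively ?R es" "?R (last es) e"
        using snoc.prems(4) by (auto simp: successively_append_iff)
      moreover have "\<exists>v. fst (snd (last es)) = nd v \<and> arr v (fst (snd (snd (last es))) + snd (snd (snd (last es))))"
        by (rule snoc.IH) (use snoc.prems False calculation in auto)
      ultimately show ?thesis using e by (cases "last es") auto
    qed
    then obtain t where "arr u t" "t \<le> \<theta> g + real k" by blast
    from ride[OF this(1) e(2-4) this(2)] e(1) show ?case by auto
  qed simp
  moreover assume "reachable network \<tau> (nd src) y"
  ultimately show "\<exists>v t. y = nd v \<and> arr v t"
    unfolding reachable_def temporal_path_def using start by metis
next
  let ?A = "induced_edges network \<tau>"
  \<comment> \<open>The claim also bounds the arrival time of the path, so that it can be extended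
    by a ride. Arrival at \<open>src\<close> is set apart, since there a ride starts a new
    path.\<close>
  have "v = src \<or> (\<exists>es. temporal_path ?A (nd src) es (nd v) \<and> fst (snd (snd (last es))) + snd (snd (snd (last es))) \<le> t)"
    if "arr v t" for v t
    using that
  proof induction
    case (wait v t t')
    then show ?case by force
  next
    case (ride u t g k v)
    let ?e = "(nd u, nd v, \<theta> g + real k, 1) :: nat temporal_edge"
    have e: "?e \<in> ?A" by (simp only: induced[OF \<tau>] edge_set_def) (use ride.hyps in blast)
    from ride.IH show ?case
    proof
      assume "u = src"
      with e have "temporal_path ?A (nd src) [?e] (nd v)" by (simp add: temporal_path_def)
      then show ?case by (intro disjI2 exI[of _ "[?e]"]) simp
    next
      assume "\<exists>es. temporal_path ?A (nd src) es (nd u) \<and> fst (snd (snd (last es))) + snd (snd (snd (last es))) \<le> t"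
      then obtain es where es: "temporal_path ?A (nd src) es (nd u)" "fst (snd (snd (last es))) + snd (snd (snd (last es))) \<le> t"
        by blast
      have "temporal_path ?A (nd src) (es @ [?e]) (nd v)"
        using es ride.hyps(5) e unfolding temporal_path_def
        by (cases "last es") (auto simp: successively_append_iff)
      then show ?case by (intro disjI2 exI[of _ "es @ [?e]"]) simp
    qed
  qed simp
  moreover assume "\<exists>v t. y = nd v \<and> arr v t"
  ultimately show "reachable network \<tau> (nd src) y" unfolding reachable_def by blast
qed

end

context net
begin

lemma strongly_temporalisable_network:
  assumes "0 < m" shows "strongly_temporalisable network"
  unfolding strongly_temporalisable_def
proof (intro ballI)
  fix s t assume "s \<in> nodes network" "t \<in> nodes network"
  then obtain src v where v: "src \<in> set all_nodes" "v \<in> set all_nodes" "s = nd src" "t = nd v" by auto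
  from strongly_connected[OF v(1,2) assms] obtain \<theta> t' where a: "timed_net.arr nv nc m mem \<theta> src v t'" by blast
  interpret timed_net nv nc m mem \<theta> src .
  have "reachable network (\<lambda>i. \<theta> (tags ! i)) (nd src) (nd v)"
    using reachable_iff[OF refl] a by blast
  then show "\<exists>\<tau>. reachable network \<tau> s t" using v by blast
qed

lemma ss_opt_ge:
  "ss_reach network s \<tau> \<le> ss_opt network s"
proof -
  have "range (ss_reach network s) \<subseteq> {..card (nodes network)}"
    by (auto simp: ss_reach_def intro: card_mono)
  hence "finite (range (ss_reach network s))" by (rule finite_subset) simp
  then show ?thesis unfolding ss_opt_def by (intro Max_ge) auto
qed

lemma opt_if_satisfiable:
  assumes "\<And>i. i < nc \<Longrightarrow> \<exists>u<nv. mem i (\<sigma> u) u"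
  shows "m * (m + 1) \<le> ss_opt network (nd (W 0))"
proof -
  interpret timed_net nv nc m mem "honest_time \<sigma>" "W 0" .
  let ?\<tau> = "\<lambda>i. honest_time \<sigma> (tags ! i)"
  let ?S = "(\<lambda>p. nd (B (fst p) (snd p))) ` ({..<m} \<times> {..m})"
  have "card ?S = m * (m + 1)"
    by (subst card_image) (auto simp: inj_on_def card_cartesian_product)
  moreover have "?S \<subseteq> {v \<in> nodes network. reachable network ?\<tau> (nd (W 0)) v}"
  proof
    fix y assume "y \<in> ?S"
    then obtain j k where y: "y = nd (B j k)" "j < m" "k \<le> m" by auto
    from honest_reaches[OF assms y(2,3)] obtain t where "arr (B j k) t" by blast
    hence "reachable network ?\<tau> (nd (W 0)) y"
      using reachable_iff[OF refl] y(1) by blast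
    with y show "y \<in> {v \<in> nodes network. reachable network ?\<tau> (nd (W 0)) v}"
      by (auto simp: set_all_nodes)
  qed
  ultimately have "m * (m + 1) \<le> ss_reach network (nd (W 0)) ?\<tau>"
    unfolding ss_reach_def by (metis (no_types, lifting) card_mono finite_Collect_conjI finite_imageI List.finite_set network_simps(1) finite_subset mem_Collect_eq subsetI)
  with ss_opt_ge[of "nd (W 0)" ?\<tau>] show ?thesis by simp
qed

text \<open>The threshold counts the gadgets, \<open>E\<close> and a single block of
  \<open>m + 1\<close> nodes; exceeding it forces nodes of two different blocks.\<close>

lemma satisfied_if_large:
  assumes large: "length gadgets + m + 2 < ss_reach network (nd (W 0)) \<tau>" and i: "i < nc"
    and len: "\<And>u. u < nv \<Longrightarrow> \<sigma> u = (\<tau> (2 * u + 1) < \<tau> (2 * u))"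
  shows "\<exists>u<nv. mem i (\<sigma> u) u"
proof -
  obtain \<theta> where "\<forall>i<length tags. \<theta> (tags ! i) = \<tau> i" by (rule exists_tag_times)
  hence \<theta>: "\<And>i. i < length tags \<Longrightarrow> \<theta> (tags ! i) = \<tau> i" by blast
  interpret timed_net nv nc m mem \<theta> "W 0" .
  note reach = reachable_iff[OF \<theta>]
  have honest
  proof (rule ccontr)
    assume nh: "\<not> honest"
    obtain j where j: "\<And>j' k t. arr (B j' k) t \<Longrightarrow> j' = j"
      using two_blocks_honest[OF refl] nh by metis
    let ?S = "nd ` (set gadgets \<union> {E} \<union> B j ` {..m})"
    have "{v \<in> nodes network. reachable network \<tau> (nd (W 0)) v} \<subseteq> ?S"
    proof
      fix y assume "y \<in> {v \<in> nodes network. reachable network \<tau> (nd (W 0)) v}"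
      then obtain v t where v: "y = nd v" "v \<in> set all_nodes" "arr v t" using reach by auto
      then show "y \<in> ?S" using j by (auto simp: set_all_nodes)
    qed
    hence "ss_reach network (nd (W 0)) \<tau> \<le> card ?S" unfolding ss_reach_def by (intro card_mono) auto
    also have "\<dots> \<le> card (set gadgets \<union> {E} \<union> B j ` {..m})" by (rule card_image_le) auto
    also have "\<dots> \<le> card (set gadgets \<union> {E}) + card (B j ` {..m})" by (rule card_Un_le)
    also have "\<dots> \<le> (card (set gadgets) + card {E}) + card {..m}"
      by (intro add_mono card_Un_le card_image_le) auto
    also have "\<dots> \<le> length gadgets + m + 2" using card_length[of gadgets] by simp
    finally show False using large by simp
  qed
  from honest_sat[OF this i] obtain u where u: "u < nv" "mem i (\<theta> (Taut u False) < \<theta> (Taut u True)) u" by blast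
  have "2 * u + 1 < length tags" using u(1) Taut_index(3) by linarith
  hence "\<theta> (Taut u False) = \<tau> (2 * u + 1)" "\<theta> (Taut u True) = \<tau> (2 * u)"
    using \<theta>[of "2 * u"] \<theta>[of "2 * u + 1"] Taut_index(1,2)[OF u(1)] by auto
  with u len show ?thesis by auto
qed

lemma card_nodes: "card (nodes network) = length all_nodes"
  by (simp add: card_image inj_nd distinct_card distinct_all_nodes)

end

subsection \<open>The reduction\<close>

lemma fp_product: "fp f \<Longrightarrow> fp g \<Longrightarrow> fp (\<lambda>x. List.product (f x) (g x))"
proof -
  assume f: "fp f" "fp g"
  have "fp (\<lambda>x. concat (map (\<lambda>y. map (\<lambda>z. (y, z)) (g x)) (f x)))"
    by (intro fp_concat_map fp_map fp_pair fp_fst fp_snd fp_id f fp_comp[OF f(2)])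
  moreover have "concat (map (\<lambda>y. map (\<lambda>z. (y, z)) ys) xs) = List.product xs ys" for xs :: "'b list" and ys :: "'c list"
    by (induction xs) auto
  ultimately show ?thesis by simp
qed

lemma fp_W: "fp f \<Longrightarrow> fp (\<lambda>x. W (f x))"
  by (rule fp_same_tree[where g = "\<lambda>x. [0, f x]"]) (auto simp: tree_of_node_def intro!: fp_Cons fp_const)

lemma fp_X: "fp f \<Longrightarrow> fp (\<lambda>x. X (f x))"
  by (rule fp_same_tree[where g = "\<lambda>x. [2, f x]"]) (auto simp: tree_of_node_def intro!: fp_Cons fp_const)

lemma fp_Z: "fp f \<Longrightarrow> fp (\<lambda>x. Z (f x))"
  by (rule fp_same_tree[where g = "\<lambda>x. [3, f x]"]) (auto simp: tree_of_node_def intro!: fp_Cons fp_const)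

lemma fp_B: "fp f \<Longrightarrow> fp g \<Longrightarrow> fp (\<lambda>x. B (f x) (g x))"
  by (rule fp_same_tree[where g = "\<lambda>x. [5, f x, g x]"]) (auto simp: tree_of_node_def intro!: fp_Cons fp_const)

lemma fp_V: "fp f \<Longrightarrow> fp g \<Longrightarrow> fp h \<Longrightarrow> fp (\<lambda>x. V (f x) (g x) (h x))"
  by (rule fp_same_tree[where g = "\<lambda>x. [1, f x, if g x then 1 else 0, h x]"])
    (auto simp: tree_of_node_def intro!: fp_Cons fp_const fp_if)

lemmas fp_basic = fp_fst fp_snd fp_pair fp_Cons fp_append fp_map fp_concat_map fp_const fp_id
  fp_if fp_upt fp_product fp_add fp_mult fp_Suc fp_length fp_replicate

lemma fp_enc_nd: "fp f \<Longrightarrow> fp (\<lambda>x. enc_nat (nd (f x)))"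
proof -
  assume f: "fp f"
  have "fp (\<lambda>x. lab (f x))" using f by (rule fp_same_tree[rotated]) (simp add: tree_of_node_def)
  note l = this
  show ?thesis unfolding enc_nat_def bits_of_nd label_bits_def
    by (intro fp_enc_bits fp_append fp_concat_map fp_replicate fp_Cons fp_const fp_snd fp_id l)
qed

lemma fp_enc_nedge: "fp f \<Longrightarrow> fp (\<lambda>x. enc_edge (nedge (f x)))"
  unfolding enc_edge_def nedge_def prod.case
  by (intro fp_append fp_enc_nd fp_fst fp_snd fp_const)

lemma fp_enc_list:
  fixes e :: "'b::encodable \<Rightarrow> 'c"
  assumes "fp (\<lambda>y. h (e y))" "fp l"
  shows "fp (\<lambda>x. enc_list h (map e (l x)))"
  unfolding enc_list_def map_map comp_def
  by (intro fp_append fp_concat_map fp_Cons fp_const fp_comp[OF assms(1)] fp_snd fp_id assms(2))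

lemma fp_instance:
  fixes nv nc m :: "'a::encodable \<Rightarrow> nat" and mem :: "'a \<Rightarrow> nat \<Rightarrow> bool \<Rightarrow> nat \<Rightarrow> bool"
  assumes p: "fp nv" "fp nc" "fp m"
    and mem: "fp (\<lambda>p. mem (fst p) (fst (snd p)) (fst (snd (snd p))) (snd (snd (snd p))))"
  shows "fp (\<lambda>x. enc_instance (map nd (net.all_nodes (nv x) (nc x) (m x)))
     (concat (net.trip_list (nv x) (nc x) (m x) (mem x))) (net.trip_list (nv x) (nc x) (m x) (mem x)) (nd (W 0)))"
proof -
  have mm: "fp (\<lambda>y. mem (f y) (g y) (h y) (k y))" if "fp f" "fp g" "fp h" "fp k"
    for f :: "'z::encodable \<Rightarrow> 'a" and g h k
    using fp_comp[OF mem, of "\<lambda>y. (f y, g y, h y, k y)"] that by (simp add: fp_pair)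
  note c = fp_comp[OF p(1)] fp_comp[OF p(2)] fp_comp[OF p(3)]
  note n = fp_W fp_X fp_Z fp_B fp_V
  have lits: "fp (\<lambda>x. net.lits (nv x))" unfolding net.lits_def by (intro fp_basic p)
  have gad: "fp (\<lambda>x. net.gadgets (nv x) (nc x) (m x))" unfolding net.gadgets_def
    by (intro fp_basic n p lits)
  have all: "fp (\<lambda>x. net.all_nodes (nv x) (nc x) (m x))" unfolding net.all_nodes_def
    by (intro fp_basic n p gad)
  \<comment> \<open>Type \<open>trip\<close> has no encoding, so the walks are computed directly:
    unfolding turns each group of trips into a map that yields lists of edges.\<close>
  have walks: "fp (\<lambda>x. map (net.walk (nv x) (nc x) (m x) (mem x)) (net.tags (nv x) (nc x) (m x)))"
    unfolding net.tags_def map_append map_map comp_def net.walk.simps list.map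
    by (intro fp_basic n p c gad all lits mm)
  have ts: "net.trip_list (nv x) (nc x) (m x) (mem x) =
     map (map nedge) (map (net.walk (nv x) (nc x) (m x) (mem x)) (net.tags (nv x) (nc x) (m x)))" for x
    by (simp add: net.trip_list_def comp_def)
  have "fp (\<lambda>x. enc_list enc_edge (map nedge (concat (map (net.walk (nv x) (nc x) (m x) (mem x)) (net.tags (nv x) (nc x) (m x))))))"
    by (intro fp_enc_list fp_enc_nedge fp_id fp_concat walks)
  hence 1: "fp (\<lambda>x. enc_list enc_edge (concat (net.trip_list (nv x) (nc x) (m x) (mem x))))"
    unfolding ts map_concat .
  have 2: "fp (\<lambda>x. enc_list (enc_list enc_edge) (net.trip_list (nv x) (nc x) (m x) (mem x)))"
    unfolding ts by (intro fp_enc_list fp_enc_nedge fp_id walks)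
  show ?thesis unfolding enc_instance_def
    by (intro fp_append fp_enc_list fp_enc_nd fp_id all 1 2 fp_const)
qed

text \<open>If v \<le> 4 * (m + 1), the approximation guarantee gives m \<le> 4 * r, whereas 12 * r
  < m + 2 \<le> 3 * m.\<close>

lemma gap_arith:
  assumes "1 \<le> (r :: real)" "r < sqrt (real N) / 12" "N \<le> (m + 2) * (m + 2)" "1 \<le> m"
    "m * (m + 1) \<le> opt" "1 / r * real opt \<le> real v"
  shows "4 * m + 4 < v"
proof -
  have "sqrt (real N) \<le> sqrt (real ((m + 2) * (m + 2)))" using assms(3) by (simp only: real_sqrt_le_iff of_nat_le_iff)
  also have "\<dots> = real (m + 2)" by (simp only: of_nat_mult real_sqrt_abs2 abs_of_nat)
  finally have r: "12 * r < real m + 2" using assms(2) by simp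
  have "real m * (real m + 1) \<le> real opt" using assms(5) by (metis of_nat_1 of_nat_add of_nat_le_iff of_nat_mult)
  also have "real opt \<le> r * real v" using assms(1,6) by (simp add: field_simps)
  finally have a: "real m * (real m + 1) \<le> r * real v" .
  show ?thesis
  proof (rule ccontr)
    assume "\<not> 4 * m + 4 < v"
    hence "real v \<le> 4 * (real m + 1)" by (simp add: not_less flip: of_nat_le_iff[where 'a = real])
    hence "r * real v \<le> r * (4 * (real m + 1))" using assms(1) by (intro mult_left_mono) auto
    with a have "real m * (real m + 1) \<le> (4 * r) * (real m + 1)" by (simp add: algebra_simps)
    hence "real m \<le> 4 * r" by simp
    with r assms(4) show False by simp
  qed
qed

lemma NP_subset_P:
  assumes approx: "ss_mrtt_approximable strongly_temporalisable \<rho>"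
    and \<rho>1: "\<And>n. 1 \<le> \<rho> n" and \<rho>: "\<forall>\<^sub>F n in sequentially. \<rho> n < sqrt (real n) / 12"
  shows "class_NP \<subseteq> class_P"
proof
  fix L assume L: "L \<in> class_NP"
  from approx obtain M and p :: "nat poly" where M: "wf_tm M" and A: "\<And>vs es ts s.
      distinct vs \<Longrightarrow> is_trip_network (network_of vs es ts) \<Longrightarrow> s \<in> nodes (network_of vs es ts) \<Longrightarrow>
      strongly_temporalisable (network_of vs es ts) \<Longrightarrow>
      \<exists>sol :: rat list. length sol = length ts
        \<and> outputs_within M (enc_instance vs es ts s) (poly p (length (enc_instance vs es ts s))) (enc_list enc_rat sol)
        \<and> real (ss_reach (network_of vs es ts) s (\<lambda>i. of_rat (sol ! i)))
            \<ge> 1 / \<rho> (card (nodes (network_of vs es ts))) * real (ss_opt (network_of vs es ts) s)"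
    unfolding ss_mrtt_approximable_def Let_def by blast
  obtain n0 where n0: "\<And>n. n0 \<le> n \<Longrightarrow> \<rho> n < sqrt (real n) / 12"
    using \<rho> unfolding eventually_sequentially by blast
  obtain Ver :: "bool list \<times> bool list \<Rightarrow> bool" and pn :: "nat poly" where Ver: "fp Ver"
    and LV: "\<And>x. x \<in> L \<longleftrightarrow> (\<exists>z. length z = poly pn (length x) + 1 \<and> Ver (x, z))"
    using class_NP_fp[OF L] by blast
  define n where "n x = poly pn (length x) + 1" for x :: "bool list"
  have fn: "fp n" unfolding n_def by (intro fp_add fp_poly fp_length fp_id fp_const)
  obtain F where F: "fp F"
    and sound: "\<And>x \<sigma>. sat \<sigma> (F x) \<Longrightarrow> Ver (x, map (\<lambda>j. \<sigma> (vY j)) [0..<n x])"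
    and complete: "\<And>x z. length z = n x \<Longrightarrow> Ver (x, z) \<Longrightarrow> \<exists>\<sigma>. sat \<sigma> (F x)"
    using cook_levin[OF Ver fn] by blast
  \<comment> \<open>The sum of \<open>v + 1\<close> over all variables is a crude bound that exceeds
    every index and is computed by mere concatenation.\<close>
  define nv where "nv x = length (concat (map (\<lambda>v. replicate (Suc v) ())
      (map vY [0..<n x] @ concat (map (map snd) (F x)))))" for x
  define nc where "nc x = length (F x)" for x
  \<comment> \<open>The summand \<open>n0\<close> makes the network large enough for the bound on
    \<rho>. The others count the nodes \<open>W\<close> and \<open>V\<close>, so that the gadgets
    have at most \<open>3 * m + 2\<close> nodes.\<close>
  define m where "m x = n0 + (2 * nv x + nc x + 1) + 2 * nv x * (nc x + 1)" for x
  define mem where "mem x i b u = (\<exists>y \<in> set (nth_hd (F x) i). fst y = b \<and> snd y = u)" for x i b and u :: nat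
  define inst where "inst x = enc_instance (map nd (net.all_nodes (nv x) (nc x) (m x)))
     (concat (net.trip_list (nv x) (nc x) (m x) (mem x))) (net.trip_list (nv x) (nc x) (m x) (mem x)) (nd (W 0))" for x
  define bits where "bits x u = decode_bits (parse_rats (sim M (poly p (length (inst x))) (inst x))) u" for x u
  define dec where "dec x = Ver (x, map (\<lambda>j. bits x (vY j)) [0..<n x])" for x
  have nv: "v < nv x" if "v \<in> set (map vY [0..<n x] @ concat (map (map snd) (F x)))" for v x
  proof -
    have "v < length (concat (map (\<lambda>v. replicate (Suc v) ()) l))" if "v \<in> set l" for l
      using that by (induction l) auto
    from this[OF that] show ?thesis by (simp add: nv_def)
  qed
  have fnv: "fp nv" unfolding nv_def
    by (intro fp_basic fp_vY fn fp_concat F)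
  have fnc: "fp nc" unfolding nc_def by (intro fp_length F)
  have fm: "fp m" unfolding m_def by (intro fp_basic fnv fnc)
  have fmem: "fp (\<lambda>p. mem (fst p) (fst (snd p)) (fst (snd (snd p))) (snd (snd (snd p))))"
    unfolding mem_def
    by (intro fp_list_ex fp_conj fp_bool_eq fp_nat_eq fp_nth_hd fp_comp[OF F] fp_fst fp_snd fp_id)
  have finst: "fp inst" unfolding inst_def by (rule fp_instance[OF fnv fnc fm fmem])
  have "fp dec" unfolding dec_def bits_def
    by (intro fp_comp[OF Ver] fp_pair fp_id fp_map fp_decode_bits fp_comp[OF fp_parse_rats] fp_sim
        fp_poly fp_length fp_comp[OF finst] fp_fst fp_snd fp_vY fp_upt fn)
  moreover have "dec x \<longleftrightarrow> x \<in> L" for x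
  proof
    \<comment> \<open>Whatever the approximation algorithm returned, a candidate accepted by the
      verifier is a certificate of the required length.\<close>
    assume "dec x"
    then show "x \<in> L" unfolding LV dec_def by (intro exI[of _ "map (\<lambda>j. bits x (vY j)) [0..<n x]"]) (simp add: n_def)
  next
    assume "x \<in> L"
    then obtain \<sigma> where \<sigma>: "sat \<sigma> (F x)" using complete unfolding LV n_def by blast
    interpret net "nv x" "nc x" "m x" "mem x" .
    have m1: "1 \<le> m x" by (simp add: m_def)
    obtain sol :: "rat list" where sol: "length sol = length trip_list"
      "outputs_within M (inst x) (poly p (length (inst x))) (enc_list enc_rat sol)"
      "real (ss_reach network (nd (W 0)) (\<lambda>i. of_rat (sol ! i)))
         \<ge> 1 / \<rho> (card (nodes network)) * real (ss_opt network (nd (W 0)))"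
    proof -
      have "distinct (map nd all_nodes)" by (simp add: distinct_map distinct_all_nodes inj_nd)
      moreover have "nd (W 0) \<in> nodes network" by (auto simp: set_all_nodes set_gadgets)
      ultimately show thesis
        using A[of "map nd all_nodes" "concat trip_list" trip_list "nd (W 0)"] is_trip_network
          strongly_temporalisable_network m1 that unfolding network_def inst_def by fastforce
    qed
    define \<tau> :: "nat \<Rightarrow> real" where "\<tau> = (\<lambda>i. of_rat (sol ! i))"
    have memI: "mem x i (fst y) (snd y)" "snd y < nv x" if "i < nc x" "y \<in> set (F x ! i)" for i y
    proof -
      show "mem x i (fst y) (snd y)" using that by (auto simp: mem_def nc_def)
      have "F x ! i \<in> set (F x)" using that by (simp add: nc_def)
      with that show "snd y < nv x" by (intro nv) auto
    qed
    have "m x * (m x + 1) \<le> ss_opt network (nd (W 0))"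
    proof (rule opt_if_satisfiable)
      fix i assume i: "i < nc x"
      hence "F x ! i \<in> set (F x)" by (simp add: nc_def)
      with \<sigma> obtain y where y: "y \<in> set (F x ! i)" "\<sigma> (snd y) = fst y" unfolding sat_def sat_lit_def by blast
      with memI[OF i y(1)] show "\<exists>u<nv x. mem x i (\<sigma> u) u" by auto
    qed
    moreover have N: "card (nodes network) \<le> (m x + 2) * (m x + 2)" "n0 \<le> card (nodes network)"
      unfolding card_nodes length_all_nodes length_gadgets by (auto simp: m_def algebra_simps)
    ultimately have "4 * m x + 4 < ss_reach network (nd (W 0)) \<tau>"
      unfolding \<tau>_def by (intro gap_arith[OF \<rho>1 n0 _ m1 _ sol(3)])
    moreover have "length gadgets + m x + 2 \<le> 4 * m x + 4" 
      unfolding length_gadgets by (simp add: m_def algebra_simps)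
    ultimately have large: "length gadgets + m x + 2 < ss_reach network (nd (W 0)) \<tau>" by simp
    have bits: "bits x u = (\<tau> (2 * u + 1) < \<tau> (2 * u))" if "u < nv x" for u
    proof -
      have "2 * u + 1 < length sol" using that sol(1) Taut_index(3) by (simp add: trip_list_def)
      then show ?thesis unfolding bits_def sim_correct[OF M sol(2)] \<tau>_def
        by (simp add: decode_bits of_rat_less)
    qed
    have "sat (bits x) (F x)" unfolding sat_def
    proof
      fix c assume "c \<in> set (F x)"
      then obtain i where i: "i < nc x" "c = F x ! i" by (auto simp: in_set_conv_nth nc_def)
      from satisfied_if_large[OF large i(1) bits] obtain u where "mem x i (bits x u) u" by blast
      with i show "\<exists>l \<in> set c. sat_lit (bits x) l" by (auto simp: mem_def sat_lit_def nc_def)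
    qed
    then show "dec x" unfolding dec_def by (rule sound)
  qed
  ultimately show "L \<in> class_P" using fp_decidable[of dec] by simp
qed

theorem theorem7:
  fixes \<rho> :: "nat \<Rightarrow> real"
  assumes "class_P \<noteq> class_NP"
    and "\<And>n. 1 \<le> \<rho> n"
    and "\<forall>\<^sub>F n in sequentially. \<rho> n < sqrt (real n) / 12"
  shows "\<not> ss_mrtt_approximable strongly_temporalisable \<rho>"
proof
  assume "ss_mrtt_approximable strongly_temporalisable \<rho>"
  from NP_subset_P[OF this assms(2,3)] class_P_subset_class_NP assms(1) show False by simp
qed

end
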